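(* Assume that either $a=1$ and $\gamma<0$, or $a\neq1$ and $\gamma\le0$, and set $$\delta(\gamma)=\begin{cases}-\dfrac{1}{\gamma}, & \text{if } a=1 \text{ and } \gamma<0,\\[2mm] \dfrac{1}{1-\gamma}, & \text{if } a\neq 1\text{ and }\gamma\le 0.\end{cases}$$ There exists a constant $C>0$ such that for every initial datum $U_0\in D(\mathcal{A})$ the energy $E(t)$ of the solution of $$u_{tt}+aAu+A^{\gamma}u_t+\alpha y_t=0,\qquad y_{tt}+Ay-\alpha u_t=0$$ satisfies $$E(t)\le \frac{C}{t^{\delta(\gamma)}}\,\|\mathcal{A}U_0\|_{\mathcal{H}}^2\qquad\forall\, t>0.$$ In addition, this energy decay rate is optimal: for every sufficiently small $\varepsilon>0$ there is no constant $C'>0$ such that $E(t)\le C' t^{-(\delta(\gamma)+\varepsilon)}\|\mathcal{A}U_0\|_{\mathcal{H}}^2$ for all $t>0$ and all $U_0\in D(\mathcal{A})$.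
   Context: $H$ is an infinite-dimensional separable complex Hilbert space with norm $\|\cdot\|$; $A$ is a self-adjoint, coercive operator in $H$ with compact resolvent and simple spectrum; fractional powers of $A$ are defined by spectral calculus. The parameters satisfy $a>0$, $\gamma\le 0$, $\alpha\in\mathbb{R}\setminus\{0\}$. The energy space is $\mathcal{H}=D(A^{1/2})\times H\times D(A^{1/2})\times H$ with norm $\|(u,v,y,z)\|_{\mathcal{H}}^2=a\|A^{1/2}u\|^2+\|A^{1/2}y\|^2+\|v\|^2+\|z\|^2$. The operator $\mathcal{A}$ has domain $D(\mathcal{A})=\{(u,v,y,z)\in\mathcal{H}:\ v,z\in D(A^{1/2}),\ u,y\in D(A)\}$ and acts by $\mathcal{A}(u,v,y,z)=(v,\,-aAu-A^{\gamma}v-\alpha z,\,z,\,-Ay+\alpha v)$. It is maximal dissipative and generates a $C_0$-semigroup of contractions $(e^{t\mathcal{A}})_{t\ge0}$ on $\mathcal{H}$; the system is the evolution equation $U_t=\mathcal{A}U$, $U(0)=U_0$, with $U=(u,u_t,y,y_t)$. The energy is $$E(t)=\tfrac12\left(a\|A^{1/2}u\|^2+\|A^{1/2}y\|^2+\|u_t\|^2+\|y_t\|^2\right)=\tfrac12\|e^{t\mathcal{A}}U_0\|_{\mathcal{H}}^2 .$$ *)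

theory Defs
  imports "HOL-Analysis.Analysis"
begin

section \<open>Complex Hilbert spaces\<close>

class scaleC = scaleR +
  fixes scaleC :: "complex \<Rightarrow> 'a \<Rightarrow> 'a" (infixr "*\<^sub>C" 75)
  assumes scaleR_scaleC: "r *\<^sub>R x = complex_of_real r *\<^sub>C x"

class complex_vector = scaleC + real_vector +
  assumes scaleC_add_right: "c *\<^sub>C (x + y) = c *\<^sub>C x + c *\<^sub>C y"
    and scaleC_add_left: "(c + d) *\<^sub>C x = c *\<^sub>C x + d *\<^sub>C x"
    and scaleC_scaleC: "c *\<^sub>C d *\<^sub>C x = (c * d) *\<^sub>C x"
    and scaleC_one: "1 *\<^sub>C x = x"

instantiation prod :: (complex_vector, complex_vector) complex_vector
begin

definition scaleC_prod :: "complex \<Rightarrow> 'a \<times> 'b \<Rightarrow> 'a \<times> 'b" where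
  "scaleC_prod c p = (c *\<^sub>C fst p, c *\<^sub>C snd p)"

instance
  by standard
    (auto simp: scaleC_prod_def scaleR_prod_def scaleR_scaleC scaleC_add_right
      scaleC_add_left scaleC_scaleC scaleC_one)

end

text \<open>
  The inner product is linear in its first argument.  Norm, metric and topology are those of the
  underlying real inner product space, whose inner product is the real part of the complex one;
  hence \<open>norm x = sqrt (Re (cinner x x))\<close>.
\<close>

class complex_inner = complex_vector + real_inner +
  fixes cinner :: "'a \<Rightarrow> 'a \<Rightarrow> complex"
  assumes cinner_add_left: "cinner (x + y) z = cinner x z + cinner y z"
    and cinner_scaleC_left: "cinner (c *\<^sub>C x) y = c * cinner x y"
    and cinner_commute: "cinner x y = cnj (cinner y x)"
    and inner_eq_Re_cinner: "inner x y = Re (cinner x y)"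

class complex_hilbert = complex_inner + complete_space

definition infinite_dimensional :: "'h::complex_vector itself \<Rightarrow> bool" where
  "infinite_dimensional _ \<longleftrightarrow>
     \<not> (\<exists>B::'h set. finite B \<and> module.span (*\<^sub>C) B = UNIV)"


section \<open>Unbounded operators\<close>

text \<open>
  An operator is given by its domain \<open>D\<close> and a total function \<open>A\<close> whose values
  outside \<open>D\<close> are irrelevant.
\<close>

definition linear_operator :: "'h::complex_vector set \<Rightarrow> ('h \<Rightarrow> 'h) \<Rightarrow> bool" where
  "linear_operator D A \<longleftrightarrow> module.subspace (*\<^sub>C) D \<and>
     (\<forall>x\<in>D. \<forall>y\<in>D. A (x + y) = A x + A y) \<and> (\<forall>c. \<forall>x\<in>D. A (c *\<^sub>C x) = c *\<^sub>C A x)"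

text \<open>The last conjunct is the equality of the graphs of the adjoint of \<open>A\<close> and of \<open>A\<close>.\<close>

definition self_adjoint :: "'h::complex_inner set \<Rightarrow> ('h \<Rightarrow> 'h) \<Rightarrow> bool" where
  "self_adjoint D A \<longleftrightarrow> linear_operator D A \<and> closure D = UNIV \<and>
     (\<forall>y z. (\<forall>x\<in>D. cinner (A x) y = cinner x z) \<longleftrightarrow> y \<in> D \<and> z = A y)"

definition coercive :: "'h::complex_inner set \<Rightarrow> ('h \<Rightarrow> 'h) \<Rightarrow> bool" where
  "coercive D A \<longleftrightarrow> (\<exists>c>0. \<forall>x\<in>D. Re (cinner (A x) x) \<ge> c * (norm x)\<^sup>2)"

definition resolvent :: "'h::complex_inner set \<Rightarrow> ('h \<Rightarrow> 'h) \<Rightarrow> complex \<Rightarrow> 'h \<Rightarrow> 'h" where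
  "resolvent D A l = inv_into D (\<lambda>x. l *\<^sub>C x - A x)"

definition resolvent_set :: "'h::complex_inner set \<Rightarrow> ('h \<Rightarrow> 'h) \<Rightarrow> complex set" where
  "resolvent_set D A =
     {l. bij_betw (\<lambda>x. l *\<^sub>C x - A x) D UNIV \<and> bounded_linear (resolvent D A l)}"

definition compact_operator :: "('h::real_normed_vector \<Rightarrow> 'h) \<Rightarrow> bool" where
  "compact_operator K \<longleftrightarrow> bounded_linear K \<and> (\<forall>B. bounded B \<longrightarrow> compact (closure (K ` B)))"

text \<open>By the resolvent identity, compactness for one point of the resolvent set gives it for all.\<close>

definition compact_resolvent :: "'h::complex_inner set \<Rightarrow> ('h \<Rightarrow> 'h) \<Rightarrow> bool" where
  "compact_resolvent D A \<longleftrightarrow> (\<exists>l\<in>resolvent_set D A. compact_operator (resolvent D A l))"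

definition eigenspace :: "'h::complex_vector set \<Rightarrow> ('h \<Rightarrow> 'h) \<Rightarrow> complex \<Rightarrow> 'h set" where
  "eigenspace D A l = {x\<in>D. A x = l *\<^sub>C x}"

definition eigenvalues :: "'h::complex_vector set \<Rightarrow> ('h \<Rightarrow> 'h) \<Rightarrow> complex set" where
  "eigenvalues D A = {l. \<exists>x\<in>eigenspace D A l. x \<noteq> 0}"

text \<open>
  Simplicity of the spectrum of a self-adjoint operator with compact resolvent: its spectrum
  consists of eigenvalues, and geometric and algebraic multiplicities coincide.
\<close>

definition simple_spectrum :: "'h::complex_vector set \<Rightarrow> ('h \<Rightarrow> 'h) \<Rightarrow> bool" where
  "simple_spectrum D A \<longleftrightarrow>
     (\<forall>l\<in>eigenvalues D A. \<exists>e. e \<noteq> 0 \<and> eigenspace D A l = range (\<lambda>c. c *\<^sub>C e))"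


section \<open>Fractional powers by spectral calculus\<close>

definition orthogonal_projection :: "'h::complex_inner set \<Rightarrow> 'h \<Rightarrow> 'h" where
  "orthogonal_projection S x = (THE p. p \<in> S \<and> (\<forall>q\<in>S. cinner (x - p) q = 0))"

definition spectral_projection :: "'h::complex_inner set \<Rightarrow> ('h \<Rightarrow> 'h) \<Rightarrow> real \<Rightarrow> 'h \<Rightarrow> 'h" where
  "spectral_projection D A l = orthogonal_projection (eigenspace D A (complex_of_real l))"

text \<open>
  For a self-adjoint operator with compact resolvent the spectrum is a set of real eigenvalues and
  the spectral measure is purely atomic, with the projection onto the eigenspace of \<open>l\<close> as
  its atom at \<open>l\<close>.  So the spectral integral of \<open>f\<close> is the (unordered) sum over the
  eigenvalues.
\<close>

definition real_spectrum :: "'h::complex_inner set \<Rightarrow> ('h \<Rightarrow> 'h) \<Rightarrow> real set" where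
  "real_spectrum D A = {l. complex_of_real l \<in> eigenvalues D A}"

definition calculus_dom :: "'h::complex_inner set \<Rightarrow> ('h \<Rightarrow> 'h) \<Rightarrow> (real \<Rightarrow> real) \<Rightarrow> 'h set" where
  "calculus_dom D A f =
     {x. (\<lambda>l. (f l)\<^sup>2 * (norm (spectral_projection D A l x))\<^sup>2) summable_on real_spectrum D A}"

definition calculus :: "'h::complex_inner set \<Rightarrow> ('h \<Rightarrow> 'h) \<Rightarrow> (real \<Rightarrow> real) \<Rightarrow> 'h \<Rightarrow> 'h" where
  "calculus D A f x = (\<Sum>\<^sub>\<infinity>l\<in>real_spectrum D A. f l *\<^sub>R spectral_projection D A l x)"

text \<open>
  The use of \<open>powr\<close> is legitimate because coercivity makes all eigenvalues positive.
\<close>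

definition pow_dom :: "'h::complex_inner set \<Rightarrow> ('h \<Rightarrow> 'h) \<Rightarrow> real \<Rightarrow> 'h set" where
  "pow_dom D A s = calculus_dom D A (\<lambda>l. l powr s)"

definition pow :: "'h::complex_inner set \<Rightarrow> ('h \<Rightarrow> 'h) \<Rightarrow> real \<Rightarrow> 'h \<Rightarrow> 'h" where
  "pow D A s = calculus D A (\<lambda>l. l powr s)"


section \<open>Strongly continuous semigroups\<close>

text \<open>
  Semigroups act on a subspace \<open>X\<close> of an ambient vector space, normed by \<open>N\<close>; this is
  needed because the energy space carries its own norm.  Only \<open>t \<ge> 0\<close> and arguments in
  \<open>X\<close> matter.
\<close>

definition C0_semigroup ::
    "'e::complex_vector set \<Rightarrow> ('e \<Rightarrow> real) \<Rightarrow> (real \<Rightarrow> 'e \<Rightarrow> 'e) \<Rightarrow> bool" where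
  "C0_semigroup X N T \<longleftrightarrow>
     (\<forall>t\<ge>0. T t ` X \<subseteq> X \<and> linear_operator X (T t) \<and> (\<exists>M. \<forall>x\<in>X. N (T t x) \<le> M * N x)) \<and>
     (\<forall>x\<in>X. T 0 x = x) \<and>
     (\<forall>s\<ge>0. \<forall>t\<ge>0. \<forall>x\<in>X. T (s + t) x = T s (T t x)) \<and>
     (\<forall>x\<in>X. ((\<lambda>t. N (T t x - x)) \<longlongrightarrow> 0) (at_right 0))"

definition generator_graph ::
    "'e::complex_vector set \<Rightarrow> ('e \<Rightarrow> real) \<Rightarrow> (real \<Rightarrow> 'e \<Rightarrow> 'e) \<Rightarrow> ('e \<times> 'e) set" where
  "generator_graph X N T =
     {(x, y). x \<in> X \<and> y \<in> X \<and> ((\<lambda>h. N ((T h x - x) /\<^sub>R h - y)) \<longlongrightarrow> 0) (at_right 0)}"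

definition generates ::
    "'e::complex_vector set \<Rightarrow> ('e \<Rightarrow> real) \<Rightarrow> 'e set \<Rightarrow> ('e \<Rightarrow> 'e) \<Rightarrow> (real \<Rightarrow> 'e \<Rightarrow> 'e) \<Rightarrow> bool" where
  "generates X N DG G T \<longleftrightarrow>
     C0_semigroup X N T \<and> generator_graph X N T = {(x, G x) |x. x \<in> DG}"

text \<open>
  A generator determines its semigroup on \<open>X\<close> for \<open>t \<ge> 0\<close>; the choice below only fixes
  the irrelevant remaining values.
\<close>

definition semigroup_of ::
    "'e::complex_vector set \<Rightarrow> ('e \<Rightarrow> real) \<Rightarrow> 'e set \<Rightarrow> ('e \<Rightarrow> 'e) \<Rightarrow> real \<Rightarrow> 'e \<Rightarrow> 'e" where
  "semigroup_of X N DG G = (SOME T. generates X N DG G T)"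


section \<open>The coupled system\<close>

definition energy_space :: "'h::complex_inner set \<Rightarrow> ('h \<Rightarrow> 'h) \<Rightarrow> ('h \<times> 'h \<times> 'h \<times> 'h) set" where
  "energy_space D A = pow_dom D A (1/2) \<times> UNIV \<times> pow_dom D A (1/2) \<times> UNIV"

fun energy_norm ::
    "'h::complex_inner set \<Rightarrow> ('h \<Rightarrow> 'h) \<Rightarrow> real \<Rightarrow> 'h \<times> 'h \<times> 'h \<times> 'h \<Rightarrow> real" where
  "energy_norm D A a (u, v, y, z) =
     sqrt (a * (norm (pow D A (1/2) u))\<^sup>2 + (norm (pow D A (1/2) y))\<^sup>2
           + (norm v)\<^sup>2 + (norm z)\<^sup>2)"

definition system_dom :: "'h::complex_inner set \<Rightarrow> ('h \<Rightarrow> 'h) \<Rightarrow> ('h \<times> 'h \<times> 'h \<times> 'h) set" where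
  "system_dom D A = {(u, v, y, z). (u, v, y, z) \<in> energy_space D A \<and>
     v \<in> pow_dom D A (1/2) \<and> z \<in> pow_dom D A (1/2) \<and> u \<in> D \<and> y \<in> D}"

text \<open>
  With \<open>U = (u, u\<^sub>t, y, y\<^sub>t)\<close> the equation \<open>U\<^sub>t = system_op U\<close> is the first-order form of
  the system with the two equations
  \<open>u\<^sub>t\<^sub>t + a A u + A\<^sup>\<gamma> u\<^sub>t + \<alpha> y\<^sub>t = 0\<close> and
  \<open>y\<^sub>t\<^sub>t + A y - \<alpha> u\<^sub>t = 0\<close>.
\<close>

fun system_op ::
    "'h::complex_inner set \<Rightarrow> ('h \<Rightarrow> 'h) \<Rightarrow> real \<Rightarrow> real \<Rightarrow> real
      \<Rightarrow> 'h \<times> 'h \<times> 'h \<times> 'h \<Rightarrow> 'h \<times> 'h \<times> 'h \<times> 'h" where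
  "system_op D A a \<gamma> \<alpha> (u, v, y, z) =
     (v, - (a *\<^sub>R A u) - pow D A \<gamma> v - \<alpha> *\<^sub>R z, z, - A y + \<alpha> *\<^sub>R v)"

definition system_semigroup ::
    "'h::complex_inner set \<Rightarrow> ('h \<Rightarrow> 'h) \<Rightarrow> real \<Rightarrow> real \<Rightarrow> real
      \<Rightarrow> real \<Rightarrow> 'h \<times> 'h \<times> 'h \<times> 'h \<Rightarrow> 'h \<times> 'h \<times> 'h \<times> 'h" where
  "system_semigroup D A a \<gamma> \<alpha> =
     semigroup_of (energy_space D A) (energy_norm D A a) (system_dom D A) (system_op D A a \<gamma> \<alpha>)"

definition energy ::
    "'h::complex_inner set \<Rightarrow> ('h \<Rightarrow> 'h) \<Rightarrow> real \<Rightarrow> real \<Rightarrow> real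
      \<Rightarrow> 'h \<times> 'h \<times> 'h \<times> 'h \<Rightarrow> real \<Rightarrow> real" where
  "energy D A a \<gamma> \<alpha> U0 t = 1/2 * (energy_norm D A a (system_semigroup D A a \<gamma> \<alpha> t U0))\<^sup>2"

definition decay_rate :: "real \<Rightarrow> real \<Rightarrow> real" where
  "decay_rate a \<gamma> = (if a = 1 then - 1 / \<gamma> else 1 / (1 - \<gamma>))"

end

theory Submission
  imports Defs
begin

text \<open>Expanding in eigenvectors of \<open>A\<close> splits the system into independent linear equations in four
  components, one for each eigenvalue \<open>l\<close>.  Put \<open>s = sqrt l\<close>, \<open>r = sqrt a\<close> and \<open>d = l powr \<gamma>\<close>.
  The components \<open>(r s u, v, s y, z)\<close> of a state, scaled such that the squared energy norm is the sum of
  their squares, evolve by \<open>X' = B X\<close>, where \<open>B\<close> is skew up to the damping \<open>- d\<close> of the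
  second one (\<open>mode_op\<close>, \<open>diagonal_system\<close>).  So everything is a question of how fast these
  equations dissipate, uniformly in \<open>l\<close>.

  A mode dissipates at the rate \<open>l powr (- p)\<close> (up to constants), with \<open>p = - \<gamma>\<close> if \<open>a = 1\<close> and
  \<open>p = 1 - \<gamma>\<close> otherwise.  If \<open>a = 1\<close>, the two oscillators are in resonance, the coupling makes them
  share their energy, and it is dissipated at the rate \<open>d = l powr \<gamma>\<close>.  If \<open>a \<noteq> 1\<close>, the damped oscillator is driven by
  the other one off resonance, its velocity stays of order \<open>1 / s\<close>, and the power lost is of order
  \<open>d / s\<^sup>2 = l powr (\<gamma> - 1)\<close>.  The decay is proved with a Lyapunov function (\<open>mode_decay\<close>).  Since moreover
  \<open>norm (B X) \<ge> const * s * norm X\<close> (\<open>mode_op_bounded_below\<close>), the energy of a mode at time \<open>t\<close> is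
  at most a constant times \<open>exp (- \<omega> * t * l powr (- p)) / l * (norm (B X))\<^sup>2\<close>, and the maximum over \<open>l\<close> of
  the first two factors is of order \<open>t powr (- 1 / p)\<close>.  Summation over the modes gives the upper bound with
  \<open>1 / p = decay_rate a \<gamma>\<close>.

  The rate is optimal because a mode that starts in its last component, the velocity of the undamped oscillator,
  keeps half of its energy up to a time of order \<open>l powr p\<close> (\<open>slow_modes\<close>), whereas \<open>(norm (B X))\<^sup>2\<close> is only of
  order \<open>l\<close>; and there are arbitrarily large eigenvalues, the space being infinite-dimensional.

  Three pieces of theory carry this: the spectral theorem for \<open>A\<close>, obtained from the compact inverse of \<open>A\<close>
  (\<open>has_sum_P\<close>, \<open>dom_iff\<close>); the fact that the direct sum of the exponentials of the modes is a
  semigroup with the required generator (\<open>generates_flow\<close>); and the fact that a semigroup with this generator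
  acts on the modes by these exponentials (\<open>generated_semigroup_coordinate\<close>).  The last two are both
  necessary, since the semigroup is specified by its generator alone.\<close>

section \<open>Complex inner products in terms of real ones\<close>

lemma module_scaleC: "module ((*\<^sub>C) :: complex \<Rightarrow> 'a::complex_vector \<Rightarrow> 'a)"
  by unfold_locales (simp_all add: scaleC_add_right scaleC_add_left scaleC_scaleC scaleC_one)

lemma cinner_scaleC_right:
  fixes x y :: "'a::complex_inner"
  shows "cinner x (c *\<^sub>C y) = cnj c * cinner x y"
  by (metis cinner_commute cinner_scaleC_left complex_cnj_mult)

lemma cinner_eq_Complex_inner:
  fixes x y :: "'a::complex_inner"
  shows "cinner x y = Complex (inner x y) (inner x (\<i> *\<^sub>C y))"
  by (simp add: inner_eq_Re_cinner cinner_scaleC_right complex_eq_iff)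

lemma inner_scaleC_i:
  fixes x y :: "'a::complex_inner"
  shows "inner (\<i> *\<^sub>C x) y = - inner x (\<i> *\<^sub>C y)"
  by (simp add: inner_eq_Re_cinner cinner_scaleC_right cinner_scaleC_left)

lemma norm_scaleC:
  fixes x :: "'a::complex_inner"
  shows "norm (c *\<^sub>C x) = cmod c * norm x"
proof -
  have "Im (cinner x x) = 0"
    using cinner_commute[of x x] by (metis Reals_cnj_iff complex_is_Real_iff)
  moreover have "Re (cinner x x) = (norm x)\<^sup>2"
    by (simp add: inner_eq_Re_cinner[symmetric] power2_norm_eq_inner)
  ultimately have xx: "cinner x x = complex_of_real ((norm x)\<^sup>2)"
    by (simp add: complex_eq_iff)
  have "(norm (c *\<^sub>C x))\<^sup>2 = Re (c * cnj c * cinner x x)"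
    by (simp add: power2_norm_eq_inner inner_eq_Re_cinner cinner_scaleC_right cinner_scaleC_left mult.assoc mult.left_commute)
  also have "\<dots> = (cmod c * norm x)\<^sup>2"
    by (simp add: xx complex_norm_square[symmetric] power_mult_distrib flip: of_real_mult of_real_power)
  finally show ?thesis by (simp add: power2_eq_iff_nonneg)
qed

lemma bounded_linear_scaleC: "bounded_linear (\<lambda>x::'a::complex_inner. c *\<^sub>C x)"
proof (rule bounded_linear_intro[where K = "cmod c"])
  show "c *\<^sub>C (r *\<^sub>R x) = r *\<^sub>R c *\<^sub>C x" for r and x :: 'a
    by (simp add: scaleR_scaleC scaleC_scaleC mult.commute)
qed (simp_all add: scaleC_add_right norm_scaleC mult.commute)

lemmas scaleC_zero = linear_0[OF bounded_linear.linear[OF bounded_linear_scaleC]]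
lemmas scaleC_diff = linear_diff[OF bounded_linear.linear[OF bounded_linear_scaleC]]

lemma norm_add_square_le: "(norm (x + y))\<^sup>2 \<le> 2 * (norm x)\<^sup>2 + 2 * (norm y)\<^sup>2" for x y :: "'a::real_inner"
proof -
  have "(norm (x + y))\<^sup>2 + (norm (x - y))\<^sup>2 = 2 * (norm x)\<^sup>2 + 2 * (norm y)\<^sup>2"
    by (simp add: power2_norm_eq_inner inner_add_left inner_add_right inner_diff_left inner_diff_right)
  then show ?thesis using zero_le_power2[of "norm (x - y)"] by linarith
qed

lemma complex_subspaceD:
  fixes M :: "'a::complex_vector set"
  assumes "module.subspace (*\<^sub>C) M"
  shows "subspace M" "x \<in> M \<Longrightarrow> c *\<^sub>C x \<in> M"
  using assms by (auto simp: module.subspace_def[OF module_scaleC] subspace_def scaleR_scaleC)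

lemma self_adjointD:
  fixes A :: "'h::complex_inner \<Rightarrow> 'h"
  assumes "self_adjoint D A"
  shows "module.subspace (*\<^sub>C) D"
    and "x \<in> D \<Longrightarrow> y \<in> D \<Longrightarrow> A (x + y) = A x + A y"
    and "x \<in> D \<Longrightarrow> A (c *\<^sub>C x) = c *\<^sub>C A x"
  using assms by (auto simp: self_adjoint_def linear_operator_def)

text \<open>Since the domain is invariant under multiplication by \<open>\<i>\<close>, the real parts of the
  inner products already determine the adjoint.\<close>

lemma self_adjoint_real_iff:
  fixes A :: "'h::complex_inner \<Rightarrow> 'h"
  assumes sa: "self_adjoint D A"
  shows "(\<forall>x\<in>D. inner (A x) y = inner x z) \<longleftrightarrow> y \<in> D \<and> z = A y"
proof -
  note D = self_adjointD[OF sa]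
  have "(\<forall>x\<in>D. inner (A x) y = inner x z) \<longleftrightarrow> (\<forall>x\<in>D. cinner (A x) y = cinner x z)"
  proof
    assume *: "\<forall>x\<in>D. inner (A x) y = inner x z"
    show "\<forall>x\<in>D. cinner (A x) y = cinner x z"
    proof
      fix x assume x: "x \<in> D"
      have "inner (A (\<i> *\<^sub>C x)) y = inner (\<i> *\<^sub>C x) z"
        using * complex_subspaceD(2)[OF D(1) x] by blast
      then show "cinner (A x) y = cinner x z"
        using * x by (simp add: cinner_eq_Complex_inner D(3) inner_scaleC_i)
    qed
  qed (auto simp: inner_eq_Re_cinner)
  then show ?thesis
    using sa by (simp add: self_adjoint_def)
qed

section \<open>Orthogonal projections\<close>

text \<open>A minimizing sequence for the distance to the subspace is Cauchy by the parallelogram identity, and at a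
  minimizer the first variation vanishes.\<close>

lemma projection_exists:
  fixes M :: "'a::{real_inner,complete_space} set"
  assumes M: "subspace M" "closed M"
  obtains p where "p \<in> M" "\<And>q. q \<in> M \<Longrightarrow> inner (x - p) q = 0"
proof -
  define d where "d = Inf ((\<lambda>m. (norm (x - m))\<^sup>2) ` M)"
  have ne: "(\<lambda>m. (norm (x - m))\<^sup>2) ` M \<noteq> {}"
    using M subspace_0 by blast
  have bdd: "bdd_below ((\<lambda>m. (norm (x - m))\<^sup>2) ` M)"
    by (rule bdd_belowI[of _ 0]) auto
  have d: "d \<le> (norm (x - m))\<^sup>2" if "m \<in> M" for m
    unfolding d_def using cINF_lower[OF bdd that] .
  have "\<exists>m\<in>M. (norm (x - m))\<^sup>2 < d + e" if "e > 0" for e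
    using cInf_lessD[OF ne, of "d + e"] that by (auto simp: d_def)
  then have "\<forall>n. \<exists>m\<in>M. (norm (x - m))\<^sup>2 < d + inverse (real (Suc n))" by simp
  then obtain f where f: "\<And>n. f n \<in> M" "\<And>n. (norm (x - f n))\<^sup>2 < d + inverse (real (Suc n))"
    by metis
  have par: "(norm (f m - f n))\<^sup>2 \<le> 2 * inverse (real (Suc m)) + 2 * inverse (real (Suc n))" for m n
  proof -
    have "(1/2) *\<^sub>R (f m + f n) \<in> M"
      using M f subspace_add subspace_scale by blast
    note d[OF this]
    moreover have "(norm (f m - f n))\<^sup>2 = 2 * (norm (x - f m))\<^sup>2 + 2 * (norm (x - f n))\<^sup>2
        - 4 * (norm (x - (1/2) *\<^sub>R (f m + f n)))\<^sup>2"
      unfolding power2_norm_eq_inner by (simp add: algebra_simps inner_commute)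
    ultimately show ?thesis using f(2)[of m] f(2)[of n] by linarith
  qed
  have "Cauchy f"
  proof (rule metric_CauchyI)
    fix e :: real assume e: "e > 0"
    obtain k where k: "inverse (real (Suc k)) < e\<^sup>2 / 4"
      using reals_Archimedean[of "e\<^sup>2 / 4"] e by auto
    have "dist (f m) (f n) < e" if "m \<ge> k" "n \<ge> k" for m n
    proof -
      have "inverse (real (Suc m)) \<le> inverse (real (Suc k))" "inverse (real (Suc n)) \<le> inverse (real (Suc k))"
        using that by (simp_all add: field_simps)
      then have "(norm (f m - f n))\<^sup>2 < e\<^sup>2" using par[of m n] k by linarith
      then show ?thesis using e by (simp add: dist_norm power2_less_imp_less)
    qed
    then show "\<exists>M. \<forall>m\<ge>M. \<forall>n\<ge>M. dist (f m) (f n) < e" by blast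
  qed
  then obtain p where p: "f \<longlonglongrightarrow> p"
    using Cauchy_convergent_iff convergent_def by blast
  have pM: "p \<in> M"
    using closed_sequentially[OF M(2)] f(1) p by blast
  have "(norm (x - p))\<^sup>2 \<le> d"
  proof (rule LIMSEQ_le)
    show "(\<lambda>n. (norm (x - f n))\<^sup>2) \<longlonglongrightarrow> (norm (x - p))\<^sup>2"
      by (intro tendsto_intros p)
    show "(\<lambda>n. d + inverse (real (Suc n))) \<longlonglongrightarrow> d"
      using tendsto_add[OF tendsto_const LIMSEQ_inverse_real_of_nat] by simp
  qed (use f(2) less_imp_le in blast)
  then have min: "(norm (x - p))\<^sup>2 \<le> (norm (x - m))\<^sup>2" if "m \<in> M" for m
    using d[OF that] by linarith
  have "inner (x - p) q = 0" if q: "q \<in> M" for q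
  proof (cases "q = 0")
    case False
    define t where "t = inner (x - p) q / inner q q"
    have "p + t *\<^sub>R q \<in> M"
      using M pM q subspace_add subspace_scale by blast
    from min[OF this] have "0 \<le> (norm (x - (p + t *\<^sub>R q)))\<^sup>2 - (norm (x - p))\<^sup>2" by simp
    also have "\<dots> = t * t * inner q q - 2 * t * inner (x - p) q"
      unfolding power2_norm_eq_inner by (simp add: algebra_simps inner_commute)
    also have "\<dots> = - (inner (x - p) q)\<^sup>2 / inner q q"
      using False by (simp add: t_def field_simps power2_eq_square)
    finally have "(inner (x - p) q)\<^sup>2 / inner q q \<le> 0" by simp
    moreover have "inner q q > 0" using False by simp
    ultimately have "(inner (x - p) q)\<^sup>2 \<le> 0"
      by (simp add: divide_le_0_iff)
    then show ?thesis by simp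
  qed simp
  then show ?thesis using that pM by blast
qed

lemma orthogonal_projection_eqI:
  fixes M :: "'a::complex_inner set"
  assumes M: "module.subspace (*\<^sub>C) M" and p: "p \<in> M" "\<And>q. q \<in> M \<Longrightarrow> inner (x - p) q = 0"
  shows "orthogonal_projection M x = p"
  unfolding orthogonal_projection_def
proof (rule the_equality)
  show "p \<in> M \<and> (\<forall>q\<in>M. cinner (x - p) q = 0)"
    using p complex_subspaceD(2)[OF M] by (auto simp: cinner_eq_Complex_inner complex_eq_iff)
next
  fix p' assume p': "p' \<in> M \<and> (\<forall>q\<in>M. cinner (x - p') q = 0)"
  have mem: "p - p' \<in> M"
    using p' p(1) complex_subspaceD(1)[OF M] subspace_diff by blast
  have "inner (x - p') (p - p') = 0" "inner (x - p) (p - p') = 0"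
    using p' mem p(2) by (auto simp: inner_eq_Re_cinner)
  then have "inner (p - p') (p - p') = 0" by (simp add: inner_diff_left)
  then show "p' = p" by simp
qed

lemma orthogonal_projection_props:
  fixes M :: "'a::complex_hilbert set"
  assumes M: "module.subspace (*\<^sub>C) M" "closed M"
  shows "orthogonal_projection M x \<in> M"
    and "q \<in> M \<Longrightarrow> inner (x - orthogonal_projection M x) q = 0"
proof -
  obtain p where p: "p \<in> M" "\<And>q. q \<in> M \<Longrightarrow> inner (x - p) q = 0"
    using projection_exists[OF complex_subspaceD(1)[OF M(1)] M(2)] by blast
  then have "orthogonal_projection M x = p" by (intro orthogonal_projection_eqI M)
  then show "orthogonal_projection M x \<in> M" "q \<in> M \<Longrightarrow> inner (x - orthogonal_projection M x) q = 0"
    using p by auto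
qed

section \<open>The spectral theorem for operators with compact resolvent\<close>

text \<open>Coercivity is stated with the real inner product, which is the real part of the complex one; the constant is a
  parameter because it bounds the spectrum from below.\<close>

locale coercive_operator =
  fixes D :: "'h::complex_hilbert set" and A :: "'h \<Rightarrow> 'h" and c :: real
  assumes self_adj: "self_adjoint D A"
    and c_pos: "c > 0"
    and coerc: "\<And>x. x \<in> D \<Longrightarrow> inner (A x) x \<ge> c * (norm x)\<^sup>2"
    and compact_res: "compact_resolvent D A"
begin

lemma dom_subspace: "module.subspace (*\<^sub>C) D" and subspace_dom: "subspace D"
  using self_adjointD(1)[OF self_adj] complex_subspaceD(1) by auto

lemma A_add: "x \<in> D \<Longrightarrow> y \<in> D \<Longrightarrow> A (x + y) = A x + A y"
  by (rule self_adjointD(2)[OF self_adj])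

lemma A_scaleC: "x \<in> D \<Longrightarrow> A (k *\<^sub>C x) = k *\<^sub>C A x"
  by (rule self_adjointD(3)[OF self_adj])

lemma A_scaleR: "x \<in> D \<Longrightarrow> A (r *\<^sub>R x) = r *\<^sub>R A x"
  by (simp add: scaleR_scaleC A_scaleC)

lemma A_diff: "x \<in> D \<Longrightarrow> y \<in> D \<Longrightarrow> A (x - y) = A x - A y"
  using A_add[of x "(-1) *\<^sub>R y"] A_scaleR[of y "-1"] subspace_scale[OF subspace_dom, of y "-1"]
  by simp

lemma A_0: "A 0 = 0"
  using A_scaleR[OF subspace_0[OF subspace_dom], of 0] by simp

lemma A_symmetric: "x \<in> D \<Longrightarrow> y \<in> D \<Longrightarrow> inner (A x) y = inner x (A y)"
  using self_adjoint_real_iff[OF self_adj, of y "A y"] by blast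

lemma A_maximal: "(\<And>x. x \<in> D \<Longrightarrow> inner (A x) y = inner x z) \<Longrightarrow> y \<in> D \<and> A y = z"
  using self_adjoint_real_iff[OF self_adj, of y z] by blast

lemma norm_le_A: "x \<in> D \<Longrightarrow> c * norm x \<le> norm (A x)"
proof -
  assume x: "x \<in> D"
  have "c * norm x * norm x \<le> norm (A x) * norm x"
    using coerc[OF x] norm_cauchy_schwarz[of "A x" x] by (simp add: power2_eq_square)
  then show ?thesis by (cases "x = 0") (auto simp: A_0)
qed

lemma inj_A: "inj_on A D"
proof (rule inj_onI)
  fix x y assume "x \<in> D" "y \<in> D" "A x = A y"
  then have "c * norm (x - y) \<le> 0"
    using norm_le_A[of "x - y"] A_diff subspace_diff[OF subspace_dom] by auto
  then show "x = y" using c_pos by (simp add: mult_le_0_iff)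
qed

text \<open>The range is closed by coercivity, and a vector orthogonal to it lies in the domain of
  the adjoint and is annihilated by it, hence is zero.\<close>

lemma range_A: "A ` D = UNIV"
proof -
  have sub: "subspace (A ` D)"
  proof (rule subspaceI)
    show "0 \<in> A ` D" using A_0 subspace_0[OF subspace_dom] by force
    show "x + y \<in> A ` D" if "x \<in> A ` D" "y \<in> A ` D" for x y
      using that A_add subspace_add[OF subspace_dom] by (auto simp flip: A_add)
    show "r *\<^sub>R x \<in> A ` D" if "x \<in> A ` D" for r x
      using that subspace_scale[OF subspace_dom] by (auto simp flip: A_scaleR)
  qed
  have "closed (A ` D)"
    unfolding closed_sequential_limits
  proof (intro allI impI; elim conjE)
    fix f l assume f: "\<forall>n. f n \<in> A ` D" "f \<longlonglongrightarrow> l"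
    then obtain g where g: "\<And>n. g n \<in> D" "\<And>n. f n = A (g n)" by (auto simp: image_iff) metis
    have "Cauchy g"
    proof (rule metric_CauchyI)
      fix e :: real assume "e > 0"
      then have "c * e > 0" using c_pos by simp
      then obtain N where N: "\<And>m n. m \<ge> N \<Longrightarrow> n \<ge> N \<Longrightarrow> dist (f m) (f n) < c * e"
        using LIMSEQ_imp_Cauchy[OF f(2)] metric_CauchyD by meson
      have "dist (g m) (g n) < e" if "m \<ge> N" "n \<ge> N" for m n
      proof -
        have "c * norm (g m - g n) \<le> norm (f m - f n)"
          using norm_le_A[of "g m - g n"] g A_diff subspace_diff[OF subspace_dom] by auto
        then have "c * norm (g m - g n) < c * e" using N[OF that] by (simp add: dist_norm)
        then show ?thesis using c_pos by (simp add: dist_norm)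
      qed
      then show "\<exists>N. \<forall>m\<ge>N. \<forall>n\<ge>N. dist (g m) (g n) < e" by blast
    qed
    then obtain x where x: "g \<longlonglongrightarrow> x" using Cauchy_convergent_iff convergent_def by blast
    have "inner (A z) x = inner z l" if z: "z \<in> D" for z
    proof (rule LIMSEQ_unique)
      show "(\<lambda>n. inner (A z) (g n)) \<longlonglongrightarrow> inner (A z) x" by (intro tendsto_intros x)
      have "(\<lambda>n. inner z (f n)) \<longlonglongrightarrow> inner z l" by (intro tendsto_intros f)
      then show "(\<lambda>n. inner (A z) (g n)) \<longlonglongrightarrow> inner z l"
        using g z by (simp add: A_symmetric)
    qed
    then have "x \<in> D \<and> A x = l" by (rule A_maximal)
    then show "l \<in> A ` D" by blast
  qed
  show ?thesis
  proof (intro set_eqI iffI UNIV_I)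
    fix y
    obtain p where p: "p \<in> A ` D" "\<And>q. q \<in> A ` D \<Longrightarrow> inner (y - p) q = 0"
      using projection_exists[OF sub \<open>closed (A ` D)\<close>] by blast
    have "y - p \<in> D \<and> A (y - p) = 0"
      by (rule A_maximal) (use p(2) in \<open>auto simp: inner_commute\<close>)
    then have "y - p = 0" using inj_A A_0 subspace_0[OF subspace_dom] by (metis inj_onD)
    then show "y \<in> A ` D" using p(1) by simp
  qed
qed

text \<open>The bounded inverse of \<open>A\<close>.  It has the same eigenvectors as \<open>A\<close> with reciprocal eigenvalues, and it is
  compact, symmetric and nonnegative.\<close>

definition K :: "'h \<Rightarrow> 'h" where "K = inv_into D A"

lemma K_dom: "K y \<in> D" and A_K: "A (K y) = y" and K_A: "x \<in> D \<Longrightarrow> K (A x) = x"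
  unfolding K_def using range_A inj_A by (auto intro: inv_into_into f_inv_into_f)

lemma K_eqI: "x \<in> D \<Longrightarrow> A x = y \<Longrightarrow> K y = x"
  using K_A by blast

lemma bounded_linear_K: "bounded_linear K"
proof (rule bounded_linear_intro[where K = "inverse c"])
  show "K (x + y) = K x + K y" for x y
    by (rule K_eqI) (simp_all add: A_add K_dom A_K subspace_add[OF subspace_dom])
  show "K (r *\<^sub>R x) = r *\<^sub>R K x" for r x
    by (rule K_eqI) (simp_all add: A_scaleR K_dom A_K subspace_scale[OF subspace_dom])
  show "norm (K x) \<le> norm x * inverse c" for x
    using norm_le_A[OF K_dom, of x] c_pos by (simp add: A_K field_simps)
qed

interpretation K: bounded_linear K by (rule bounded_linear_K)

lemma K_symmetric: "inner (K x) y = inner x (K y)"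
  using A_symmetric[OF K_dom K_dom, of x y] by (simp add: A_K)

lemma K_nonneg: "inner (K x) x \<ge> 0"
  using coerc[OF K_dom, of x] c_pos by (simp add: A_K inner_commute order_trans[rotated])

text \<open>The resolvent identity \<open>K = R (l K - 1)\<close> transfers compactness from a point \<open>l\<close> of
  the resolvent set to \<open>0\<close>.\<close>

lemma compact_K: 
  assumes "bounded B" shows "compact (closure (K ` B))"
proof -
  obtain l where l: "bij_betw (\<lambda>x. l *\<^sub>C x - A x) D UNIV" "compact_operator (resolvent D A l)"
    using compact_res by (auto simp: compact_resolvent_def resolvent_set_def)
  have eq: "K x = resolvent D A l (l *\<^sub>C K x - x)" for x
    unfolding resolvent_def using l(1) K_dom[of x]
    by (metis (no_types, lifting) A_K bij_betw_def inv_into_f_f)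
  have "bounded_linear (\<lambda>x. l *\<^sub>C K x - x)"
    by (intro bounded_linear_sub bounded_linear_ident bounded_linear_compose[OF bounded_linear_scaleC bounded_linear_K])
  then have "bounded ((\<lambda>x. l *\<^sub>C K x - x) ` B)"
    using assms bounded_linear_image by blast
  then have "compact (closure (resolvent D A l ` (\<lambda>x. l *\<^sub>C K x - x) ` B))"
    using l(2) by (auto simp: compact_operator_def)
  moreover have "resolvent D A l ` (\<lambda>x. l *\<^sub>C K x - x) ` B = K ` B"
    using eq by (auto simp: image_image)
  ultimately show ?thesis by simp
qed

lemma K_subseq:
  assumes "bounded (range f)"
  obtains w r where "strict_mono (r :: nat \<Rightarrow> nat)" "(\<lambda>n. K (f (r n))) \<longlonglongrightarrow> w"
proof -
  have "seq_compact (closure (K ` range f))"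
    using compact_K[OF assms] compact_eq_seq_compact_metric by blast
  moreover have "\<forall>n. K (f n) \<in> closure (K ` range f)"
    using closure_subset by fast
  ultimately show ?thesis
    using that by (auto simp: seq_compact_def o_def elim!: allE[of _ "\<lambda>n. K (f n)"])
qed

subsection \<open>Eigenspaces and spectral projections\<close>

abbreviation "S \<equiv> real_spectrum D A"
abbreviation "E l \<equiv> eigenspace D A (complex_of_real l)"
abbreviation "P \<equiv> spectral_projection D A"

lemma E_iff: "x \<in> E l \<longleftrightarrow> x \<in> D \<and> A x = l *\<^sub>R x"
  by (simp add: eigenspace_def scaleR_scaleC)

lemma S_iff: "l \<in> S \<longleftrightarrow> (\<exists>x\<in>E l. x \<noteq> 0)"
  by (simp add: real_spectrum_def eigenvalues_def)

lemma S_ge: "l \<in> S \<Longrightarrow> l \<ge> c"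
proof -
  assume "l \<in> S"
  then obtain x where x: "x \<in> D" "A x = l *\<^sub>R x" "x \<noteq> 0" by (auto simp: S_iff E_iff)
  then show "l \<ge> c" using coerc[OF x(1)] by (simp add: power2_norm_eq_inner)
qed

lemma S_pos: "l \<in> S \<Longrightarrow> l > 0"
  using S_ge c_pos by fastforce

lemma subspace_E: "module.subspace (*\<^sub>C) (E l)"
  unfolding module.subspace_def[OF module_scaleC]
  using dom_subspace[unfolded module.subspace_def[OF module_scaleC]]
  by (auto simp: eigenspace_def A_0 A_add A_scaleC scaleC_add_right scaleC_scaleC mult.commute
      scaleC_zero)

lemmas real_subspace_E = complex_subspaceD(1)[OF subspace_E]

lemma E_eq_K: "l \<noteq> 0 \<Longrightarrow> E l = {x. K x = (1 / l) *\<^sub>R x}"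
proof (intro set_eqI iffI)
  fix x assume l: "l \<noteq> 0" "x \<in> E l"
  then show "x \<in> {x. K x = (1 / l) *\<^sub>R x}"
    using K_A[of x] K.scaleR[of l x] by (auto simp: E_iff dest: arg_cong[of _ x "\<lambda>v. (1 / l) *\<^sub>R v"])
next
  fix x assume l: "l \<noteq> 0" "x \<in> {x. K x = (1 / l) *\<^sub>R x}"
  then have "x = l *\<^sub>R K x" by simp
  moreover have "l *\<^sub>R K x \<in> D" "A (l *\<^sub>R K x) = l *\<^sub>R x"
    using K_dom by (simp_all add: A_scaleR A_K subspace_scale[OF subspace_dom])
  ultimately show "x \<in> E l" by (simp add: E_iff)
qed

lemma closed_E: "l \<noteq> 0 \<Longrightarrow> closed (E l)"
  unfolding E_eq_K
  by (intro closed_Collect_eq continuous_intros K.continuous_on)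

lemma E_orthogonal:
  assumes "x \<in> E l" "y \<in> E m" "l \<noteq> m" shows "inner x y = 0"
proof -
  have "l * inner x y = m * inner x y"
    using A_symmetric[of x y] assms by (simp add: E_iff)
  then show ?thesis using assms by simp
qed

lemma P_in_E: "l \<in> S \<Longrightarrow> P l x \<in> E l"
  and P_orth: "l \<in> S \<Longrightarrow> q \<in> E l \<Longrightarrow> inner (x - P l x) q = 0"
  unfolding spectral_projection_def
  using orthogonal_projection_props[OF subspace_E closed_E] S_pos by force+

lemma P_eqI: "p \<in> E l \<Longrightarrow> (\<And>q. q \<in> E l \<Longrightarrow> inner (x - p) q = 0) \<Longrightarrow> P l x = p"
  unfolding spectral_projection_def by (rule orthogonal_projection_eqI[OF subspace_E])

lemma P_E: "x \<in> E l \<Longrightarrow> P l x = x"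
  by (rule P_eqI) auto

lemma P_E_other: "x \<in> E m \<Longrightarrow> l \<noteq> m \<Longrightarrow> P l x = 0"
  by (rule P_eqI) (use E_orthogonal subspace_0[OF real_subspace_E] in auto)

lemma P_add: "l \<in> S \<Longrightarrow> P l (x + y) = P l x + P l y"
proof (rule P_eqI)
  assume l: "l \<in> S"
  show "P l x + P l y \<in> E l"
    by (rule subspace_add[OF real_subspace_E P_in_E[OF l] P_in_E[OF l]])
  fix q assume q: "q \<in> E l"
  show "inner (x + y - (P l x + P l y)) q = 0"
    using P_orth[OF l q, of x] P_orth[OF l q, of y] by (simp add: inner_diff_left inner_add_left)
qed

lemma P_scaleC: "l \<in> S \<Longrightarrow> P l (k *\<^sub>C x) = k *\<^sub>C P l x"
proof (rule P_eqI)
  assume l: "l \<in> S"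
  show "k *\<^sub>C P l x \<in> E l" using complex_subspaceD(2)[OF subspace_E] P_in_E[OF l] by blast
  fix q assume q: "q \<in> E l"
  have "k *\<^sub>C x - k *\<^sub>C P l x = k *\<^sub>C (x - P l x)"
    by (simp add: scaleC_diff)
  moreover have "inner (k *\<^sub>C (x - P l x)) q = inner (x - P l x) (cnj k *\<^sub>C q)"
    by (simp add: inner_eq_Re_cinner cinner_scaleC_left cinner_scaleC_right)
  ultimately show "inner (k *\<^sub>C x - k *\<^sub>C P l x) q = 0"
    using P_orth[OF l] complex_subspaceD(2)[OF subspace_E q] by simp
qed

lemma P_scaleR: "l \<in> S \<Longrightarrow> P l (r *\<^sub>R x) = r *\<^sub>R P l x"
  by (simp add: scaleR_scaleC P_scaleC)

lemma P_norm_le: "l \<in> S \<Longrightarrow> norm (P l x) \<le> norm x"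
proof -
  assume l: "l \<in> S"
  have "inner (x - P l x) (P l x) = 0" using P_orth[OF l P_in_E[OF l]] .
  then have "(norm (P l x))\<^sup>2 \<le> norm x * norm (P l x)"
    using norm_cauchy_schwarz[of x "P l x"] by (simp add: inner_diff_left power2_norm_eq_inner)
  then show ?thesis by (cases "P l x = 0") (auto simp: power2_eq_square)
qed

lemma bounded_linear_P: "l \<in> S \<Longrightarrow> bounded_linear (P l)"
  by (rule bounded_linear_intro[where K = 1]) (simp_all add: P_add P_scaleR P_norm_le)

lemma K_P: "l \<in> S \<Longrightarrow> P l (K x) = (1 / l) *\<^sub>R P l x"
proof (rule P_eqI)
  assume l: "l \<in> S"
  show "(1 / l) *\<^sub>R P l x \<in> E l" by (rule subspace_scale[OF real_subspace_E P_in_E[OF l]])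
  fix q assume q: "q \<in> E l"
  have "K q = (1 / l) *\<^sub>R q"
    using q S_pos[OF l] by (simp add: E_eq_K)
  then have "inner (K x) q = (1 / l) * inner x q"
    by (simp only: K_symmetric inner_scaleR_right)
  then show "inner (K x - (1 / l) *\<^sub>R P l x) q = 0"
    using P_orth[OF l q, of x] by (simp add: inner_diff_left)
qed

text \<open>The Cauchy--Schwarz inequality for the nonnegative form of \<open>K\<close>, by the usual discriminant.\<close>

lemma K_cauchy_schwarz: "(inner (K x) y)\<^sup>2 \<le> inner (K x) x * inner (K y) y"
proof -
  define a b d where "a = inner (K x) x" and "b = inner (K x) y" and "d = inner (K y) y"
  have q: "0 \<le> a * t\<^sup>2 + 2 * b * t + d" for t
  proof -
    have "inner (K (t *\<^sub>R x + y)) (t *\<^sub>R x + y) = a * t\<^sup>2 + 2 * b * t + d"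
    proof -
      have "inner (K y) x = b"
        using K_symmetric[of y x] by (simp add: b_def inner_commute)
      then show ?thesis
        by (simp add: K.add K.scaleR inner_add_left inner_add_right power2_eq_square distrib_left
            flip: a_def b_def d_def)
    qed
    then show ?thesis using K_nonneg[of "t *\<^sub>R x + y"] by simp
  qed
  show ?thesis
  proof (cases "a = 0")
    case True
    have "b = 0"
    proof (rule ccontr)
      assume "b \<noteq> 0"
      then have "2 * b * (- (d + 1) / (2 * b)) = - (d + 1)" by simp
      then show False using q[of "- (d + 1) / (2 * b)"] True by simp
    qed
    then show ?thesis using True by (simp add: a_def b_def)
  next
    case False
    then have a: "a > 0" using K_nonneg[of x] by (simp add: a_def)
    have "0 \<le> a * (a * (- b / a)\<^sup>2 + 2 * b * (- b / a) + d)"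
      using q[of "- b / a"] a by simp
    also have "\<dots> = a * d - b\<^sup>2" using a by (simp add: field_simps power2_eq_square)
    finally show ?thesis by (simp add: a_def b_def d_def)
  qed
qed

text \<open>On the orthogonal complement \<open>V\<close> of all eigenvectors the Rayleigh quotient of the compact operator \<open>K\<close>
  would attain its supremum \<open>m\<close> at an eigenvector if \<open>m\<close> were positive, and if \<open>m = 0\<close> then \<open>K\<close> would vanish
  on \<open>V\<close>, although it is injective.  So \<open>V\<close> is trivial: the eigenvectors are complete.\<close>

lemma orthogonal_to_eigenvectors_imp_0:
  assumes x0: "\<And>l. l \<in> S \<Longrightarrow> P l x0 = 0"
  shows "x0 = 0"
proof (rule ccontr)
  assume "x0 \<noteq> 0"
  define V where "V = {x. \<forall>l\<in>S. P l x = 0}"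
  have V_K: "K x \<in> V" if "x \<in> V" for x using that by (simp add: V_def K_P)
  have V_sub: "r *\<^sub>R x \<in> V" if "x \<in> V" for r x using that by (simp add: V_def P_scaleR)
  have V_lim: "w \<in> V" if "\<And>n. f n \<in> V" "f \<longlonglongrightarrow> w" for f :: "nat \<Rightarrow> 'h" and w
    unfolding V_def
  proof safe
    fix l assume l: "l \<in> S"
    have "(\<lambda>n. P l (f n)) \<longlonglongrightarrow> P l w"
      by (rule bounded_linear.tendsto[OF bounded_linear_P[OF l] that(2)])
    moreover have "P l (f n) = 0" for n using that(1) l by (auto simp: V_def)
    ultimately show "P l w = 0" by (simp add: LIMSEQ_const_iff)
  qed
  have no_eig: "x = 0" if "x \<in> V" "K x = m *\<^sub>R x" "m \<noteq> 0" for x m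
  proof (rule ccontr)
    assume "x \<noteq> 0"
    have *: "x \<in> E (1 / m)" using that E_eq_K[of "1 / m"] by simp
    then have "1 / m \<in> S" unfolding S_iff using \<open>x \<noteq> 0\<close> by (rule bexI[rotated])
    moreover have "P (1 / m) x = x" using * by (rule P_E)
    ultimately show False using that(1) \<open>x \<noteq> 0\<close> unfolding V_def by auto
  qed
  define Q where "Q = (\<lambda>x. inner (K x) x) ` {x\<in>V. norm x = 1}"
  have "(1 / norm x0) *\<^sub>R x0 \<in> {x\<in>V. norm x = 1}"
    using \<open>x0 \<noteq> 0\<close> x0 V_sub by (simp add: V_def P_scaleR)
  then have ne: "Q \<noteq> {}" by (auto simp: Q_def)
  obtain C where C: "\<And>x. norm (K x) \<le> norm x * C" using K.bounded by blast
  have bdd: "bdd_above Q"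
  proof (rule bdd_aboveI)
    fix q assume "q \<in> Q"
    then obtain x where "norm x = 1" "q = inner (K x) x" by (auto simp: Q_def)
    then show "q \<le> C" using norm_cauchy_schwarz[of "K x" x] C[of x] by simp
  qed
  define m where "m = Sup Q"
  have le: "inner (K x) x \<le> m * (norm x)\<^sup>2" if x: "x \<in> V" for x
  proof (cases "x = 0")
    case False
    define e where "e = (1 / norm x) *\<^sub>R x"
    have "e \<in> V" "norm e = 1" using x False V_sub by (auto simp: e_def)
    then have "inner (K e) e \<in> Q" by (auto simp: Q_def)
    then have "inner (K e) e \<le> m" using bdd by (simp add: m_def cSup_upper)
    moreover have "inner (K e) e = inner (K x) x / (norm x)\<^sup>2"
      by (simp add: e_def K.scaleR power2_eq_square)
    ultimately show ?thesis using False by (simp add: field_simps)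
  qed simp
  have m0: "m \<ge> 0"
  proof -
    obtain q where "q \<in> Q" using ne by blast
    then have "0 \<le> q" "q \<le> m" using K_nonneg bdd by (auto simp: Q_def m_def intro: cSup_upper)
    then show ?thesis by simp
  qed
  have K_le: "(norm (K x))\<^sup>2 \<le> m * inner (K x) x" if x: "x \<in> V" for x
  proof (cases "K x = 0")
    case False
    have "((norm (K x))\<^sup>2)\<^sup>2 \<le> inner (K x) x * inner (K (K x)) (K x)"
      using K_cauchy_schwarz[of x "K x"] by (simp add: power2_norm_eq_inner)
    also have "\<dots> \<le> inner (K x) x * (m * (norm (K x))\<^sup>2)"
      by (intro mult_left_mono le V_K x K_nonneg)
    finally have "(norm (K x))\<^sup>2 * (norm (K x))\<^sup>2 \<le> (m * inner (K x) x) * (norm (K x))\<^sup>2"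
      by (simp add: power2_eq_square mult_ac)
    then show ?thesis by (rule mult_right_le_imp_le) (use False in simp)
  qed (use m0 K_nonneg in simp)
  have "\<exists>x\<in>V. norm x = 1 \<and> m - e < inner (K x) x" if "e > 0" for e
    using less_cSupD[OF ne, of "m - e"] that by (auto simp: m_def Q_def)
  then have "\<forall>n. \<exists>x\<in>V. norm x = 1 \<and> m - inverse (real (Suc n)) < inner (K x) x" by simp
  then obtain f where f: "\<And>n. f n \<in> V" "\<And>n. norm (f n) = 1"
    "\<And>n. m - inverse (real (Suc n)) < inner (K (f n)) (f n)" by metis
  have "bounded (range f)" using f(2) by (auto simp: bounded_iff intro: exI[of _ 1])
  then obtain w r where r: "strict_mono r" and w: "(\<lambda>n. K (f (r n))) \<longlonglongrightarrow> w"
    using K_subseq by blast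
  \<comment> \<open>A maximizing sequence consists of approximate eigenvectors; by compactness a limit of their images is one.\<close>
  have close: "(norm (K (f n) - m *\<^sub>R f n))\<^sup>2 \<le> m * inverse (real (Suc n))" for n
  proof -
    have "(norm (K (f n) - m *\<^sub>R f n))\<^sup>2
        = (norm (K (f n)))\<^sup>2 - 2 * m * inner (K (f n)) (f n) + m\<^sup>2 * (norm (f n))\<^sup>2"
      unfolding power2_norm_eq_inner by (simp add: algebra_simps inner_commute power2_eq_square)
    also have "\<dots> \<le> m * (m - inner (K (f n)) (f n))"
      using K_le[OF f(1)[of n]] f(2)[of n] by (simp add: algebra_simps power2_eq_square)
    also have "\<dots> \<le> m * inverse (real (Suc n))"
      using f(3)[of n] m0 by (intro mult_left_mono) auto
    finally show ?thesis .
  qed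
  have "(\<lambda>n. m * inverse (real (Suc n))) \<longlonglongrightarrow> 0"
    by (rule tendsto_mult_right_zero[OF LIMSEQ_inverse_real_of_nat])
  then have "(\<lambda>n. (norm (K (f n) - m *\<^sub>R f n))\<^sup>2) \<longlonglongrightarrow> 0"
    by (rule Lim_null_comparison[rotated]) (use close in simp)
  then have "(\<lambda>n. sqrt ((norm (K (f n) - m *\<^sub>R f n))\<^sup>2)) \<longlonglongrightarrow> sqrt 0"
    by (rule tendsto_real_sqrt)
  then have "(\<lambda>n. K (f n) - m *\<^sub>R f n) \<longlonglongrightarrow> 0"
    by (simp add: tendsto_norm_zero_iff)
  from LIMSEQ_subseq_LIMSEQ[OF this r] have d: "(\<lambda>n. K (f (r n)) - m *\<^sub>R f (r n)) \<longlonglongrightarrow> 0"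
    by (simp add: o_def)
  have mf: "(\<lambda>n. m *\<^sub>R f (r n)) \<longlonglongrightarrow> w"
    using tendsto_diff[OF w d] by simp
  have "w \<in> V" by (rule V_lim[OF _ w]) (simp add: V_K f)
  have "(\<lambda>n. norm (m *\<^sub>R f (r n))) \<longlonglongrightarrow> norm w" by (intro tendsto_norm mf)
  then have nw: "norm w = m" using f(2) m0 by (simp add: LIMSEQ_const_iff)
  show False
  proof (cases "m = 0")
    case True
    have "K x0 = 0" using K_le[of x0] x0 True by (simp add: V_def)
    then show False using \<open>x0 \<noteq> 0\<close> A_K[of x0] A_0 by simp
  next
    case False
    have "(\<lambda>n. K (m *\<^sub>R f (r n))) \<longlonglongrightarrow> K w" by (intro K.tendsto mf)
    moreover have "(\<lambda>n. m *\<^sub>R K (f (r n))) \<longlonglongrightarrow> m *\<^sub>R w" by (intro tendsto_intros w)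
    ultimately have "K w = m *\<^sub>R w" by (simp add: K.scaleR LIMSEQ_unique)
    then have "w = 0" using no_eig \<open>w \<in> V\<close> False by blast
    then show False using nw False by simp
  qed
qed

end

section \<open>Expansions in eigenvectors\<close>

lemma orthogonal_sum_norm:
  fixes g :: "'i \<Rightarrow> 'a::real_inner"
  assumes "finite F" "\<And>i j. i \<in> F \<Longrightarrow> j \<in> F \<Longrightarrow> i \<noteq> j \<Longrightarrow> inner (g i) (g j) = 0"
  shows "(norm (sum g F))\<^sup>2 = (\<Sum>i\<in>F. (norm (g i))\<^sup>2)"
  using assms norm_sum_Pythagorean[of F g] by (auto simp: pairwise_def orthogonal_def)

lemma orthogonal_has_sum_norm:
  fixes g :: "'i \<Rightarrow> 'a::real_inner"
  assumes orth: "\<And>i j. i \<in> I \<Longrightarrow> j \<in> I \<Longrightarrow> i \<noteq> j \<Longrightarrow> inner (g i) (g j) = 0"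
    and x: "(g has_sum x) I"
  shows "((\<lambda>i. (norm (g i))\<^sup>2) has_sum (norm x)\<^sup>2) I"
proof -
  have "((\<lambda>F. (norm (sum g F))\<^sup>2) \<longlongrightarrow> (norm x)\<^sup>2) (finite_subsets_at_top I)"
    using x unfolding has_sum_def by (intro tendsto_intros)
  moreover have "\<forall>\<^sub>F F in finite_subsets_at_top I. (norm (sum g F))\<^sup>2 = (\<Sum>i\<in>F. (norm (g i))\<^sup>2)"
    by (rule eventually_finite_subsets_at_top_weakI) (use orth in \<open>auto intro!: orthogonal_sum_norm\<close>)
  ultimately show ?thesis
    unfolding has_sum_def by (rule Lim_transform_eventually)
qed

lemma orthogonal_summable:
  fixes g :: "'i \<Rightarrow> 'a::{real_inner,complete_space}"
  assumes orth: "\<And>i j. i \<in> I \<Longrightarrow> j \<in> I \<Longrightarrow> i \<noteq> j \<Longrightarrow> inner (g i) (g j) = 0"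
    and sq: "(\<lambda>i. (norm (g i))\<^sup>2) summable_on I"
  shows "g summable_on I"
proof -
  let ?q = "\<lambda>i. (norm (g i))\<^sup>2"
  have "\<exists>P. eventually P (finite_subsets_at_top I) \<and>
      (\<forall>F G. P F \<and> P G \<longrightarrow> dist (sum g F) (sum g G) < e)" if e: "e > 0" for e
  proof -
    obtain F0 where F0: "finite F0" "F0 \<subseteq> I" "dist (sum ?q F0) (infsum ?q I) \<le> (e / 3)\<^sup>2"
      using infsum_finite_approximation[OF sq, of "(e / 3)\<^sup>2"] e by auto
    have near: "dist (sum g F) (sum g F0) \<le> e / 3" if F: "finite F" "F0 \<subseteq> F" "F \<subseteq> I" for F
    proof -
      have "(norm (sum g F - sum g F0))\<^sup>2 = (norm (sum g (F - F0)))\<^sup>2"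
        using F by (simp add: sum_diff)
      also have "\<dots> = sum ?q (F - F0)"
        using F by (intro orthogonal_sum_norm orth) auto
      also have "\<dots> = sum ?q F - sum ?q F0" using F by (simp add: sum_diff)
      also have "\<dots> \<le> infsum ?q I - sum ?q F0"
        using finite_sum_le_infsum[OF sq F(1,3)] by simp
      also have "\<dots> \<le> (e / 3)\<^sup>2" using F0(3) by (simp add: dist_real_def)
      finally have "norm (sum g F - sum g F0) \<le> e / 3"
        by (rule power2_le_imp_le) (use e in simp)
      then show ?thesis by (simp add: dist_norm)
    qed
    show ?thesis
    proof (intro exI[of _ "\<lambda>F. finite F \<and> F0 \<subseteq> F \<and> F \<subseteq> I"] conjI allI impI)
      show "\<forall>\<^sub>F F in finite_subsets_at_top I. finite F \<and> F0 \<subseteq> F \<and> F \<subseteq> I"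
        using F0 by (auto simp: eventually_finite_subsets_at_top)
      fix F G assume "(finite F \<and> F0 \<subseteq> F \<and> F \<subseteq> I) \<and> finite G \<and> F0 \<subseteq> G \<and> G \<subseteq> I"
      then have "dist (sum g F) (sum g F0) \<le> e / 3" "dist (sum g G) (sum g F0) \<le> e / 3"
        using near by auto
      then show "dist (sum g F) (sum g G) < e"
        using dist_triangle2[of "sum g F" "sum g G" "sum g F0"] e by linarith
    qed
  qed
  then have "cauchy_filter (filtermap (sum g) (finite_subsets_at_top I))"
    by (simp add: cauchy_filter_metric_filtermap)
  then obtain L where "filtermap (sum g) (finite_subsets_at_top I) \<le> nhds L"
    using cauchy_filter_complete_converges[OF _ complete_UNIV_cuspace, of "filtermap (sum g) (finite_subsets_at_top I)"]
    by (auto simp: filtermap_bot_iff)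
  then show ?thesis
    by (auto simp: summable_on_def has_sum_def filterlim_def)
qed

context coercive_operator
begin

text \<open>Riesz--Fischer: square summable families in the eigenspaces are the coordinates of vectors.\<close>

lemma E_synthesis:
  assumes g: "\<And>l. l \<in> S \<Longrightarrow> g l \<in> E l" and sq: "(\<lambda>l. (norm (g l))\<^sup>2) summable_on S"
  obtains x where "(g has_sum x) S" "\<And>l. l \<in> S \<Longrightarrow> P l x = g l"
proof -
  have "g summable_on S"
    by (rule orthogonal_summable[OF _ sq]) (use g E_orthogonal in blast)
  then obtain x where x: "(g has_sum x) S" using has_sum_infsum by blast
  have "P l x = g l" if l: "l \<in> S" for l
  proof -
    have "((\<lambda>m. P l (g m)) has_sum P l x) S"
      using has_sum_bounded_linear[OF bounded_linear_P[OF l] x] by (simp add: o_def)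
    moreover have "((\<lambda>m. P l (g m)) has_sum P l (g l)) S \<longleftrightarrow> ((\<lambda>m. P l (g m)) has_sum P l (g l)) {l}"
    proof (rule has_sum_cong_neutral)
      show "P l (g m) = 0" if "m \<in> S - {l}" for m
        using that P_E_other[OF g, of m l] by auto
    qed (use l in auto)
    moreover have "((\<lambda>m. P l (g m)) has_sum P l (g l)) {l}"
      using has_sum_finite[of "{l}" "\<lambda>m. P l (g m)"] by simp
    ultimately have "P l x = P l (g l)" using has_sum_unique by blast
    then show ?thesis by (simp add: P_E g l)
  qed
  then show ?thesis using that x by blast
qed

lemma P_ext: "(\<And>l. l \<in> S \<Longrightarrow> P l x = P l y) \<Longrightarrow> x = y"
proof -
  assume *: "\<And>l. l \<in> S \<Longrightarrow> P l x = P l y"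
  have "P l (x - y) = 0" if "l \<in> S" for l
    using *[OF that] linear_diff[OF bounded_linear.linear[OF bounded_linear_P[OF that]]] by simp
  then have "x - y = 0" by (rule orthogonal_to_eigenvectors_imp_0)
  then show "x = y" by simp
qed

lemma bessel: "(\<lambda>l. (norm (P l x))\<^sup>2) summable_on S"
proof (rule nonneg_bounded_partial_sums_imp_summable_on)
  show "\<forall>\<^sub>F F in finite_subsets_at_top S. (\<Sum>l\<in>F. (norm (P l x))\<^sup>2) \<le> (norm x)\<^sup>2"
  proof (rule eventually_finite_subsets_at_top_weakI)
    fix F assume F: "finite F" "F \<subseteq> S"
    define y where "y = (\<Sum>l\<in>F. P l x)"
    have y: "(norm y)\<^sup>2 = (\<Sum>l\<in>F. (norm (P l x))\<^sup>2)"
      unfolding y_def using F P_in_E E_orthogonal by (intro orthogonal_sum_norm) blast+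
    have "inner x (P l x) = (norm (P l x))\<^sup>2" if "l \<in> F" for l
      using P_orth[OF _ P_in_E, of l x x] that F by (auto simp: inner_diff_left power2_norm_eq_inner)
    then have "inner x y = (norm y)\<^sup>2" unfolding y by (simp add: y_def inner_sum_right)
    then have "norm y * norm y \<le> norm x * norm y"
      using norm_cauchy_schwarz[of x y] by (simp add: power2_eq_square)
    then have "norm y \<le> norm x" by (cases "y = 0") auto
    then show "(\<Sum>l\<in>F. (norm (P l x))\<^sup>2) \<le> (norm x)\<^sup>2" using y by (metis norm_ge_zero power_mono)
  qed
qed auto

theorem has_sum_P: "((\<lambda>l. P l x) has_sum x) S"
proof -
  obtain y where "((\<lambda>l. P l x) has_sum y) S" "\<And>l. l \<in> S \<Longrightarrow> P l y = P l x"
    using E_synthesis[OF P_in_E bessel] by blast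
  then show ?thesis using P_ext by metis
qed

theorem parseval: "((\<lambda>l. (norm (P l x))\<^sup>2) has_sum (norm x)\<^sup>2) S"
  by (rule orthogonal_has_sum_norm[OF _ has_sum_P]) (use P_in_E E_orthogonal in blast)

lemma P_A: "x \<in> D \<Longrightarrow> l \<in> S \<Longrightarrow> P l (A x) = l *\<^sub>R P l x"
  using K_P[of l "A x"] S_pos[of l] by (simp add: K_A)

text \<open>If the weighted squares are summable, the series of the \<open>l *\<^sub>R P l x\<close> converges to a preimage of \<open>x\<close> under \<open>K\<close>.\<close>

lemma dom_iff: "x \<in> D \<longleftrightarrow> (\<lambda>l. l\<^sup>2 * (norm (P l x))\<^sup>2) summable_on S"
proof
  assume x: "x \<in> D"
  have "(\<lambda>l. (norm (P l (A x)))\<^sup>2) summable_on S" by (rule bessel)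
  then show "(\<lambda>l. l\<^sup>2 * (norm (P l x))\<^sup>2) summable_on S"
    by (rule summable_on_cong[THEN iffD1, rotated]) (simp add: P_A x power_mult_distrib)
next
  assume "(\<lambda>l. l\<^sup>2 * (norm (P l x))\<^sup>2) summable_on S"
  then have "(\<lambda>l. (norm (l *\<^sub>R P l x))\<^sup>2) summable_on S" by (simp add: power_mult_distrib)
  then obtain y where y: "\<And>l. l \<in> S \<Longrightarrow> P l y = l *\<^sub>R P l x"
    by (rule E_synthesis[rotated]) (use P_in_E subspace_scale[OF real_subspace_E] in blast)+
  have "x = K y" by (rule P_ext) (use S_pos in \<open>force simp: K_P y\<close>)
  then show "x \<in> D" by (simp add: K_dom)
qed

lemma P_calculus:
  assumes "x \<in> calculus_dom D A f" "l \<in> S" shows "P l (calculus D A f x) = f l *\<^sub>R P l x"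
proof -
  have "(\<lambda>l. (norm (f l *\<^sub>R P l x))\<^sup>2) summable_on S"
    using assms(1) by (simp add: calculus_dom_def power_mult_distrib)
  then obtain y where "((\<lambda>l. f l *\<^sub>R P l x) has_sum y) S" "\<And>l. l \<in> S \<Longrightarrow> P l y = f l *\<^sub>R P l x"
    by (rule E_synthesis[rotated]) (use P_in_E subspace_scale[OF real_subspace_E] in blast)+
  then show ?thesis using assms(2) by (simp add: calculus_def infsumI)
qed

lemma pow_dom_half_iff: "x \<in> pow_dom D A (1/2) \<longleftrightarrow> (\<lambda>l. l * (norm (P l x))\<^sup>2) summable_on S"
  unfolding pow_dom_def calculus_dom_def mem_Collect_eq
  by (rule summable_on_cong) (simp add: powr_half_sqrt less_imp_le S_pos)

lemma P_pow_half: "x \<in> pow_dom D A (1/2) \<Longrightarrow> l \<in> S \<Longrightarrow> P l (pow D A (1/2) x) = sqrt l *\<^sub>R P l x"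
  using P_calculus[of x "\<lambda>l. l powr (1/2)" l] S_pos[of l]
  by (simp add: pow_dom_def pow_def powr_half_sqrt)

lemma pow_dom_nonpos: "s \<le> 0 \<Longrightarrow> x \<in> pow_dom D A s"
  unfolding pow_dom_def calculus_dom_def mem_Collect_eq
proof (rule summable_on_comparison_test)
  assume s: "s \<le> 0"
  show "(\<lambda>l. (c powr s)\<^sup>2 * (norm (P l x))\<^sup>2) summable_on S"
    by (intro summable_on_cmult_right bessel)
  show "(l powr s)\<^sup>2 * (norm (P l x))\<^sup>2 \<le> (c powr s)\<^sup>2 * (norm (P l x))\<^sup>2" if "l \<in> S" for l
    using S_ge[OF that] c_pos s by (intro mult_right_mono power_mono powr_mono2') auto
qed auto

lemma P_pow_nonpos: "s \<le> 0 \<Longrightarrow> l \<in> S \<Longrightarrow> P l (pow D A s x) = (l powr s) *\<^sub>R P l x"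
  using P_calculus[OF pow_dom_nonpos[unfolded pow_dom_def]] by (simp add: pow_def)

text \<open>If the spectrum were bounded, compactness of \<open>K\<close> would make it finite, and finitely many
  one-dimensional eigenspaces span a finite-dimensional space.\<close>

lemma spectrum_unbounded:
  assumes inf: "infinite_dimensional TYPE('h)" and simple: "simple_spectrum D A"
  shows "\<exists>l\<in>S. l > L"
proof (rule ccontr)
  assume "\<not> (\<exists>l\<in>S. l > L)"
  then have L: "\<And>l. l \<in> S \<Longrightarrow> l \<le> L" by force
  have "finite S"
  proof (rule ccontr)
    assume "infinite S"
    then obtain f :: "nat \<Rightarrow> real" where f: "inj f" "range f \<subseteq> S"
      using infinite_countable_subset by blast
    then have fS: "f n \<in> S" for n by auto
    have "\<exists>e. e \<in> E (f n) \<and> norm e = 1" for n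
    proof -
      obtain x where "x \<in> E (f n)" "x \<noteq> 0" using fS[of n] S_iff by blast
      then have "(1 / norm x) *\<^sub>R x \<in> E (f n)" "norm ((1 / norm x) *\<^sub>R x) = 1"
        using subspace_scale[OF real_subspace_E] by auto
      then show ?thesis by blast
    qed
    then obtain e where e: "\<And>n. e n \<in> E (f n)" "\<And>n. norm (e n) = 1" by metis
    have "bounded (range e)" using e(2) by (auto simp: bounded_iff intro: exI[of _ 1])
    then obtain w r where r: "strict_mono (r :: nat \<Rightarrow> nat)" "(\<lambda>n. K (e (r n))) \<longlonglongrightarrow> w"
      using K_subseq by blast
    have Lpos: "L > 0" using L[OF fS[of 0]] S_pos[OF fS[of 0]] by simp
    obtain N where N: "\<And>m n. m \<ge> N \<Longrightarrow> n \<ge> N \<Longrightarrow> dist (K (e (r m))) (K (e (r n))) < 1 / L"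
      using LIMSEQ_imp_Cauchy[OF r(2)] Lpos metric_CauchyD[of _ "1 / L"] by fastforce
    define i j where "i = r N" and "j = r (Suc N)"
    have "f i \<noteq> f j" using r(1) f(1) by (simp add: i_def j_def strict_mono_eq inj_eq)
    then have o: "inner (e i) (e j) = 0" using E_orthogonal e(1) by blast
    have Ke: "K (e n) = (1 / f n) *\<^sub>R e n" for n
      using e(1)[of n] E_eq_K[of "f n"] S_pos[OF fS[of n]] by auto
    have "(norm (K (e i) - K (e j)))\<^sup>2 = (1 / f i)\<^sup>2 * (norm (e i))\<^sup>2 + (1 / f j)\<^sup>2 * (norm (e j))\<^sup>2"
      unfolding Ke power2_norm_eq_inner using o
      by (simp add: inner_diff_left inner_diff_right inner_commute[of "e j" "e i"] power2_eq_square)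
    also have "\<dots> \<ge> (1 / f i)\<^sup>2" using e(2) by simp
    finally have "(1 / f i)\<^sup>2 \<le> (norm (K (e i) - K (e j)))\<^sup>2" .
    then have "1 / f i \<le> norm (K (e i) - K (e j))" by (rule power2_le_imp_le) simp
    moreover have "1 / L \<le> 1 / f i" using L[OF fS] S_pos[OF fS] by (simp add: frac_le)
    moreover have "dist (K (e i)) (K (e j)) < 1 / L" using N by (simp add: i_def j_def)
    ultimately show False by (simp add: dist_norm)
  qed
  have "\<forall>l\<in>S. \<exists>e. E l = range (\<lambda>k. k *\<^sub>C e)"
    using simple unfolding simple_spectrum_def real_spectrum_def by blast
  then obtain e where e: "\<And>l. l \<in> S \<Longrightarrow> E l = range (\<lambda>k. k *\<^sub>C e l)" by metis
  have "x \<in> module.span (*\<^sub>C) (e ` S)" for x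
  proof -
    have "x = (\<Sum>l\<in>S. P l x)"
      using has_sum_unique[OF has_sum_P has_sum_finite[OF \<open>finite S\<close>]] .
    also have "\<dots> \<in> module.span (*\<^sub>C) (e ` S)"
    proof (rule module.span_sum[OF module_scaleC])
      fix l assume l: "l \<in> S"
      then obtain k where "P l x = k *\<^sub>C e l" using P_in_E e by blast
      then show "P l x \<in> module.span (*\<^sub>C) (e ` S)"
        using l by (simp add: module.span_scale[OF module_scaleC] module.span_base[OF module_scaleC])
    qed
    finally show ?thesis .
  qed
  then have "module.span (*\<^sub>C) (e ` S) = UNIV" by blast
  then show False using inf finite_imageI[OF \<open>finite S\<close>, of e] unfolding infinite_dimensional_def by blast
qed

end

section \<open>Exponentials of bounded dissipative operators\<close>

subclass (in complex_hilbert) banach ..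

definition op_exp :: "('v::real_normed_vector \<Rightarrow> 'v) \<Rightarrow> real \<Rightarrow> 'v \<Rightarrow> 'v" where
  "op_exp B t x = (\<Sum>n. (t ^ n / fact n) *\<^sub>R (B ^^ n) x)"

lemma op_exp_0: "op_exp B 0 x = x"
proof -
  have "(\<lambda>n. (0 ^ n / fact n) *\<^sub>R (B ^^ n) x) sums (\<Sum>n\<in>{0}. (0 ^ n / fact n) *\<^sub>R (B ^^ n) x)"
    by (rule sums_finite) auto
  then show ?thesis by (simp add: op_exp_def sums_iff)
qed

context
  fixes B :: "'v::banach \<Rightarrow> 'v"
  assumes B: "bounded_linear B"
begin

interpretation bounded_linear B by (rule B)

lemma norm_funpow_le:
  obtains k where "k > 0" "\<And>n x. norm ((B ^^ n) x) \<le> k ^ n * norm x"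
proof -
  obtain k where k: "k > 0" "\<And>x. norm (B x) \<le> norm x * k" using pos_bounded by blast
  have "norm ((B ^^ n) x) \<le> k ^ n * norm x" for n x
  proof (induction n)
    case (Suc n)
    have "norm ((B ^^ Suc n) x) \<le> norm ((B ^^ n) x) * k" using k(2) by simp
    also have "\<dots> \<le> (k ^ n * norm x) * k" using Suc k(1) by (intro mult_right_mono) auto
    finally show ?case by (simp add: mult_ac)
  qed simp
  then show ?thesis using that k(1) by blast
qed

lemma op_exp_summable: "summable (\<lambda>n. (t ^ n / fact n) *\<^sub>R (B ^^ n) x)"
proof -
  obtain k where k: "k > 0" "\<And>n x. norm ((B ^^ n) x) \<le> k ^ n * norm x" using norm_funpow_le by blast
  have "summable (\<lambda>n. (inverse (fact n) * (\<bar>t\<bar> * k) ^ n) * norm x)"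
    by (intro summable_mult2 summable_exp)
  then show ?thesis
  proof (rule summable_comparison_test'[where N = 0])
    fix n
    have "norm ((t ^ n / fact n) *\<^sub>R (B ^^ n) x) = \<bar>t\<bar> ^ n / fact n * norm ((B ^^ n) x)"
      by (simp add: power_abs)
    also have "\<dots> \<le> \<bar>t\<bar> ^ n / fact n * (k ^ n * norm x)"
      by (intro mult_left_mono k) auto
    finally show "norm ((t ^ n / fact n) *\<^sub>R (B ^^ n) x) \<le> inverse (fact n) * (\<bar>t\<bar> * k) ^ n * norm x"
      by (simp add: power_mult_distrib field_simps)
  qed
qed

lemma op_exp_commute: "B (op_exp B t x) = op_exp B t (B x)"
  unfolding op_exp_def
  by (subst suminf[OF op_exp_summable]) (simp add: scaleR funpow_swap1)

text \<open>Termwise differentiation: the series of derivatives converges uniformly on bounded intervals by the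
  Weierstrass test, and it is the exponential series again, shifted by one index.\<close>

lemma op_exp_has_vector_derivative:
  "((\<lambda>t. op_exp B t x) has_vector_derivative B (op_exp B t x)) (at t)"
proof -
  define R where "R = \<bar>t\<bar> + 1"
  define d where "d = (\<lambda>n s. (real n * s ^ (n - 1) / fact n) *\<^sub>R (B ^^ n) x)"
  obtain k where k: "k > 0" "\<And>n x. norm ((B ^^ n) x) \<le> k ^ n * norm x" using norm_funpow_le by blast
  define M where "M = (\<lambda>n. (real n * R ^ (n - 1) / fact n) * (k ^ n * norm x))"
  have R: "R > 0" by (simp add: R_def)
  have d_Suc: "d (Suc n) s = (s ^ n / fact n) *\<^sub>R (B ^^ n) (B x)" for n s
    by (simp add: d_def funpow_swap1 divide_simps)
  have "summable (\<lambda>n. M (Suc n))"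
  proof -
    have "summable (\<lambda>n. inverse (fact n) * (R * k) ^ n * (k * norm x))"
      by (intro summable_mult2 summable_exp)
    moreover have "inverse (fact n) * (R * k) ^ n * (k * norm x) = M (Suc n)" for n
    proof -
      have "real (Suc n) * R ^ n / fact (Suc n) = R ^ n / fact n"
        by (simp add: divide_simps)
      then show ?thesis
        by (simp add: M_def power_mult_distrib divide_inverse)
    qed
    ultimately show ?thesis by simp
  qed
  then have "summable M" by (simp add: summable_Suc_iff)
  moreover have "norm (d n s) \<le> M n" if "s \<in> ball 0 R" for n s
  proof -
    have "norm (d n s) = (real n * \<bar>s\<bar> ^ (n - 1) / fact n) * norm ((B ^^ n) x)"
      by (simp add: d_def power_abs abs_mult)
    also have "\<dots> \<le> M n"
      unfolding M_def using that by (intro mult_mono divide_right_mono mult_left_mono power_mono k) auto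
    finally show ?thesis .
  qed
  ultimately have lim: "uniform_limit (ball 0 R) (\<lambda>n s. \<Sum>i<n. d i s) (\<lambda>s. \<Sum>i. d i s) sequentially"
    by (rule Weierstrass_m_test[rotated])
  have d_sum: "(\<Sum>i. d i s) = B (op_exp B s x)" for s
  proof -
    have "summable (\<lambda>n. d (Suc n) s)"
      unfolding d_Suc by (rule op_exp_summable)
    then have "summable (\<lambda>n. d n s)" by (rule summable_Suc_iff[THEN iffD1])
    from suminf_split_head[OF this] have "(\<Sum>i. d i s) = (\<Sum>n. d (Suc n) s) + d 0 s" by simp
    then show ?thesis
      unfolding d_Suc op_exp_commute by (simp add: op_exp_def d_def)
  qed
  have "\<exists>g. \<forall>s\<in>ball 0 R. (\<lambda>n. (s ^ n / fact n) *\<^sub>R (B ^^ n) x) sums (g s) \<and>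
      (g has_derivative (\<lambda>h. h *\<^sub>R B (op_exp B s x))) (at s within ball 0 R)"
  proof (rule has_derivative_series[where f' = "\<lambda>n s h. h *\<^sub>R d n s"])
    show "((\<lambda>s. (s ^ n / fact n) *\<^sub>R (B ^^ n) x) has_derivative (\<lambda>h. h *\<^sub>R d n s)) (at s within ball 0 R)" for n s
      unfolding d_def by (auto intro!: derivative_eq_intros simp: field_simps)
    fix e :: real assume "e > 0"
    then have "\<forall>\<^sub>F n in sequentially. \<forall>s\<in>ball 0 R. dist (\<Sum>i<n. d i s) (\<Sum>i. d i s) < e"
      using lim by (auto simp: uniform_limit_iff)
    then show "\<forall>\<^sub>F n in sequentially. \<forall>s\<in>ball 0 R. \<forall>h. norm ((\<Sum>i<n. h *\<^sub>R d i s) - h *\<^sub>R B (op_exp B s x)) \<le> e * norm h"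
    proof eventually_elim
      case (elim n)
      show ?case
      proof (intro ballI allI)
        fix s h assume "s \<in> ball (0::real) R"
        then have "norm ((\<Sum>i<n. d i s) - B (op_exp B s x)) \<le> e"
          using elim by (fastforce simp: dist_norm d_sum)
        moreover have "(\<Sum>i<n. h *\<^sub>R d i s) - h *\<^sub>R B (op_exp B s x) = h *\<^sub>R ((\<Sum>i<n. d i s) - B (op_exp B s x))"
          by (simp add: scaleR_sum_right scaleR_diff_right)
        ultimately show "norm ((\<Sum>i<n. h *\<^sub>R d i s) - h *\<^sub>R B (op_exp B s x)) \<le> e * norm h"
          by (simp add: mult.commute[of e] mult_left_mono)
      qed
    qed
  next
    show "t \<in> ball 0 R" by (simp add: R_def)
    show "(\<lambda>n. (t ^ n / fact n) *\<^sub>R (B ^^ n) x) sums op_exp B t x"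
      unfolding op_exp_def by (rule summable_sums[OF op_exp_summable])
  qed auto
  then obtain g where g: "\<And>s. s \<in> ball 0 R \<Longrightarrow> (\<lambda>n. (s ^ n / fact n) *\<^sub>R (B ^^ n) x) sums (g s)"
    "\<And>s. s \<in> ball 0 R \<Longrightarrow> (g has_derivative (\<lambda>h. h *\<^sub>R B (op_exp B s x))) (at s within ball 0 R)"
    by blast
  have t: "t \<in> ball 0 R" by (simp add: R_def)
  have eq: "op_exp B s x = g s" if "s \<in> ball 0 R" for s
    using g(1)[OF that] by (simp add: op_exp_def sums_iff)
  have "((\<lambda>s. op_exp B s x) has_derivative (\<lambda>h. h *\<^sub>R B (op_exp B t x))) (at t within ball 0 R)"
    by (rule has_derivative_transform[OF t eq g(2)[OF t]])
  then show ?thesis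
    using t by (simp add: has_vector_derivative_def at_within_open[OF t])
qed

lemma op_exp_mem:
  assumes "subspace M" "closed M" "\<And>y. y \<in> M \<Longrightarrow> B y \<in> M" "x \<in> M"
  shows "op_exp B t x \<in> M"
proof -
  have pow: "(B ^^ n) x \<in> M" for n by (induction n) (use assms in auto)
  show ?thesis
  proof (rule closed_sequentially[OF assms(2)])
    show "(\<lambda>n. \<Sum>i<n. (t ^ i / fact i) *\<^sub>R (B ^^ i) x) \<longlonglongrightarrow> op_exp B t x"
      unfolding op_exp_def using summable_sums[OF op_exp_summable] by (simp add: sums_def)
    show "(\<Sum>i<n. (t ^ i / fact i) *\<^sub>R (B ^^ i) x) \<in> M" for n
      by (intro subspace_sum[OF assms(1)] subspace_scale[OF assms(1)] pow)
  qed
qed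

end

locale dissipative = bounded_linear B for B :: "'v::{real_inner,banach} \<Rightarrow> 'v" +
  assumes diss: "inner (B x) x \<le> 0"
begin

text \<open>Dissipativity makes the norm of every solution nonincreasing, and hence determines solutions by
  their initial value.\<close>

lemma solution_contracts:
  assumes X: "\<And>t. t \<ge> 0 \<Longrightarrow> (X has_vector_derivative B (X t)) (at t)" and t: "0 \<le> t"
  shows "norm (X t) \<le> norm (X 0)"
proof -
  have "(norm (X t))\<^sup>2 \<le> (norm (X 0))\<^sup>2"
  proof (rule DERIV_nonpos_imp_nonincreasing[OF t])
    fix s assume "0 \<le> s" "s \<le> t"
    have "((\<lambda>t. inner (X t) (X t)) has_real_derivative 2 * inner (B (X s)) (X s)) (at s)"
      using has_derivative_inner[OF X[OF \<open>0 \<le> s\<close>, unfolded has_vector_derivative_def] X[OF \<open>0 \<le> s\<close>, unfolded has_vector_derivative_def]]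
      by (simp add: has_field_derivative_def inner_commute algebra_simps mult_commute_abs)
    then show "\<exists>y. ((\<lambda>t. (norm (X t))\<^sup>2) has_real_derivative y) (at s) \<and> y \<le> 0"
      using diss[of "X s"] by (intro exI[of _ "2 * inner (B (X s)) (X s)"]) (simp add: power2_norm_eq_inner)
  qed
  then show ?thesis by (rule power2_le_imp_le) simp
qed

lemma solution_unique:
  assumes X: "\<And>t. t \<ge> 0 \<Longrightarrow> (X has_vector_derivative B (X t)) (at t)"
    and Y: "\<And>t. t \<ge> 0 \<Longrightarrow> (Y has_vector_derivative B (Y t)) (at t)"
    and "X 0 = Y 0" "0 \<le> t"
  shows "X t = Y t"
proof -
  have "norm (X t - Y t) \<le> norm (X 0 - Y 0)"
  proof (rule solution_contracts[of "\<lambda>t. X t - Y t"])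
    show "((\<lambda>t. X t - Y t) has_vector_derivative B (X s - Y s)) (at s)" if "0 \<le> s" for s
      unfolding diff using that by (intro has_vector_derivative_diff X Y)
  qed fact
  then show ?thesis using assms by simp
qed

lemmas exp_deriv = op_exp_has_vector_derivative[OF bounded_linear_axioms]

lemma exp_contracts: "0 \<le> t \<Longrightarrow> norm (op_exp B t x) \<le> norm x"
  using solution_contracts[of "\<lambda>t. op_exp B t x"] exp_deriv by (simp add: op_exp_0)

lemma exp_semigroup: "0 \<le> s \<Longrightarrow> op_exp B (s + t) x = op_exp B s (op_exp B t x)"
proof (rule solution_unique[where X = "\<lambda>s. op_exp B (s + t) x"])
  show "((\<lambda>s. op_exp B (s + t) x) has_vector_derivative B (op_exp B (s + t) x)) (at s)" for s
  proof -
    have "((\<lambda>s. s + t) has_vector_derivative 1) (at s)"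
      by (auto intro!: derivative_eq_intros)
    from vector_diff_chain_at[OF this exp_deriv[of x]] show ?thesis by (simp add: o_def)
  qed
qed (auto simp: op_exp_0 exp_deriv)

lemma exp_commutes:
  assumes L: "bounded_linear L" "\<And>x. B (L x) = L (B x)" and t: "0 \<le> t"
  shows "op_exp B t (L x) = L (op_exp B t x)"
proof (rule solution_unique[OF _ _ _ t])
  show "((\<lambda>t. L (op_exp B t x)) has_vector_derivative B (L (op_exp B t x))) (at t)" for t
    unfolding L(2) by (rule bounded_linear.has_vector_derivative[OF L(1) exp_deriv])
qed (auto simp: op_exp_0 exp_deriv)

lemma exp_add: "0 \<le> t \<Longrightarrow> op_exp B t (x + y) = op_exp B t x + op_exp B t y"
proof (rule solution_unique[where Y = "\<lambda>t. op_exp B t x + op_exp B t y"])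
  show "((\<lambda>t. op_exp B t x + op_exp B t y) has_vector_derivative B (op_exp B t x + op_exp B t y)) (at t)" for t
    unfolding add by (intro has_vector_derivative_add exp_deriv)
qed (auto simp: op_exp_0 exp_deriv)

lemma exp_diff_le: "0 \<le> h \<Longrightarrow> norm (op_exp B h x - x) \<le> h * norm (B x)"
proof -
  assume h: "0 \<le> h"
  have "norm (op_exp B h x - op_exp B 0 x) \<le> norm (B x) * norm (h - 0)"
  proof (rule differentiable_bound[where S = "{0..h}" and f = "\<lambda>t. op_exp B t x"])
    fix s assume s: "s \<in> {0..h}"
    show "((\<lambda>t. op_exp B t x) has_derivative (\<lambda>r. r *\<^sub>R B (op_exp B s x))) (at s within {0..h})"
      using has_vector_derivative_at_within[OF exp_deriv] by (simp add: has_vector_derivative_def)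
    have "norm (B (op_exp B s x)) \<le> norm (B x)"
      unfolding op_exp_commute[OF bounded_linear_axioms] using s by (intro exp_contracts) auto
    then show "onorm (\<lambda>r. r *\<^sub>R B (op_exp B s x)) \<le> norm (B x)"
      by (intro onorm_le) (simp add: mult.commute mult_left_mono)
  qed (use h in auto)
  then show ?thesis using h by (simp add: op_exp_0 mult.commute)
qed

lemma exp_difference_quotient:
  "((\<lambda>h. (op_exp B h x - x) /\<^sub>R h) \<longlongrightarrow> B x) (at_right 0)"
proof -
  have "((\<lambda>h. (1 / norm (h - 0)) *\<^sub>R (op_exp B h x - (op_exp B 0 x + (h - 0) *\<^sub>R B (op_exp B 0 x)))) \<longlongrightarrow> 0) (at_right 0)"
    using has_vector_derivative_at_within[OF exp_deriv[of x 0], of "{0<..}"]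
    unfolding has_vector_derivative_def has_derivative_within by blast
  from tendsto_add[OF this tendsto_const[of "B x"]]
  have "((\<lambda>h. (1 / \<bar>h\<bar>) *\<^sub>R (op_exp B h x - (x + h *\<^sub>R B x)) + B x) \<longlongrightarrow> B x) (at_right 0)"
    by (simp add: op_exp_0)
  then show ?thesis
  proof (rule Lim_transform_eventually)
    show "\<forall>\<^sub>F h in at_right 0. (1 / \<bar>h\<bar>) *\<^sub>R (op_exp B h x - (x + h *\<^sub>R B x)) + B x = (op_exp B h x - x) /\<^sub>R h"
      using eventually_at_right_less[of 0]
      by eventually_elim (simp add: scaleR_diff_right scaleR_add_right divide_inverse)
  qed
qed

end

section \<open>Diagonal semigroups\<close>

text \<open>Dominated convergence for unordered sums: outside a finite set the majorant has small sum, and inside it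
  there are only finitely many limits to take.\<close>

lemma infsum_dominated_tendsto_0:
  fixes f :: "'t \<Rightarrow> 'i \<Rightarrow> real"
  assumes lim: "\<And>i. i \<in> S \<Longrightarrow> ((\<lambda>t. f t i) \<longlongrightarrow> 0) F"
    and dom: "\<forall>\<^sub>F t in F. \<forall>i\<in>S. 0 \<le> f t i \<and> f t i \<le> g i" and g: "g summable_on S"
  shows "((\<lambda>t. infsum (f t) S) \<longlongrightarrow> 0) F"
proof (rule tendstoI)
  fix e :: real assume e: "e > 0"
  obtain A where A: "finite A" "A \<subseteq> S" "dist (sum g A) (infsum g S) \<le> e / 3"
    using infsum_finite_approximation[OF g, of "e / 3"] e by auto
  have gA: "g summable_on A" and gR: "g summable_on (S - A)"
    using g A by (auto intro: summable_on_subset)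
  have "infsum g S = sum g A + infsum g (S - A)"
    using infsum_Un_disjoint[OF gA gR] A by (simp add: Un_absorb1)
  then have tail: "infsum g (S - A) \<le> e / 3" using A(3) by (simp add: dist_real_def)
  have "((\<lambda>t. sum (f t) A) \<longlongrightarrow> (\<Sum>i\<in>A. 0)) F"
    using A(2) by (intro tendsto_sum lim) auto
  then have "\<forall>\<^sub>F t in F. dist (sum (f t) A) 0 < e / 3"
    using e by (intro tendstoD) auto
  with dom show "\<forall>\<^sub>F t in F. dist (infsum (f t) S) 0 < e"
  proof eventually_elim
    case (elim t)
    have s: "f t summable_on S"
      by (rule summable_on_comparison_test[OF g]) (use elim in auto)
    then have sA: "f t summable_on A" and sR: "f t summable_on (S - A)"
      using A by (auto intro: summable_on_subset)
    have "infsum (f t) S = sum (f t) A + infsum (f t) (S - A)"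
      using infsum_Un_disjoint[OF sA sR] A by (simp add: Un_absorb1)
    moreover have "infsum (f t) (S - A) \<le> infsum g (S - A)"
      by (rule infsum_mono[OF sR gR]) (use elim in auto)
    moreover have "0 \<le> infsum (f t) S" by (rule infsum_nonneg) (use elim in auto)
    ultimately show ?case using elim tail e by (simp add: dist_real_def)
  qed
qed

text \<open>A one-sided monotonicity criterion.  Only right derivatives of the orbits of a semigroup are directly
  available, since the generator is a limit from the right.  The last point up to which
  \<open>f t \<le> f 0 + e * t\<close> holds can be moved to the right unless it is the end point.\<close>

lemma right_derivative_nonpos_imp_le:
  fixes f :: "real \<Rightarrow> real"
  assumes T: "0 \<le> T" and cont: "continuous_on {0..T} f"
    and deriv: "\<And>t. 0 \<le> t \<Longrightarrow> t < T \<Longrightarrow> (f has_real_derivative d t) (at_right t)"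
    and d: "\<And>t. 0 \<le> t \<Longrightarrow> t < T \<Longrightarrow> d t \<le> 0"
  shows "f T \<le> f 0"
proof -
  have "f T \<le> f 0 + e * T" if e: "e > 0" for e
  proof -
    define Z where "Z = {0..T} \<inter> (\<lambda>t. f t - e * t) -` {..f 0}"
    have "closed Z" unfolding Z_def
      by (intro continuous_closed_preimage continuous_intros cont closed_atLeastAtMost closed_atMost)
    have "0 \<in> Z" using T by (simp add: Z_def)
    have bdd: "bdd_above Z" by (rule bdd_aboveI[of _ T]) (simp add: Z_def)
    define s where "s = Sup Z"
    have "s \<in> Z"
      unfolding s_def using closed_contains_Sup[OF _ bdd \<open>closed Z\<close>] \<open>0 \<in> Z\<close> by blast
    then have s: "0 \<le> s" "s \<le> T" "f s - e * s \<le> f 0" by (auto simp: Z_def)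
    have "s = T"
    proof (rule ccontr)
      assume "s \<noteq> T"
      then have sT: "s < T" using s by simp
      have "((\<lambda>y. (f y - f s) / (y - s)) \<longlongrightarrow> d s) (at_right s)"
        using deriv[OF s(1) sT] by (simp add: has_field_derivative_iff)
      then have "\<forall>\<^sub>F y in at_right s. (f y - f s) / (y - s) < e"
        by (rule order_tendstoD) (use d[OF s(1) sT] e in linarith)
      moreover have "\<forall>\<^sub>F y in at_right s. s < y \<and> y < T"
        using eventually_at_right_real[OF sT] by (auto elim: eventually_mono)
      ultimately have "\<forall>\<^sub>F y in at_right s. (f y - f s) / (y - s) < e \<and> s < y \<and> y < T"
        by (rule eventually_conj)
      then obtain y where y: "(f y - f s) / (y - s) < e" "s < y" "y < T"
        using eventually_happens'[of "at_right s"] by (auto simp: trivial_limit_at_right_real)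
      have "f y - f s \<le> e * (y - s)" using y by (simp add: divide_less_eq)
      then have "y \<in> Z" using y s by (simp add: Z_def algebra_simps)
      then have "y \<le> s" unfolding s_def using bdd by (rule cSup_upper)
      then show False using y by simp
    qed
    then show ?thesis using s by simp
  qed
  note * = this
  show ?thesis
  proof (cases "T = 0")
    case False
    then have "T > 0" using T by simp
    show ?thesis
    proof (rule field_le_epsilon)
      fix e :: real assume "e > 0"
      then show "f T \<le> f 0 + e" using *[of "e / T"] \<open>T > 0\<close> by simp
    qed
  qed simp
qed

text \<open>A Hilbert space, given as a subspace \<open>X\<close> with a norm \<open>N\<close>, that is the direct sum of closed subspaces \<open>F i\<close>
  of one space of values; \<open>W i\<close> is the \<open>i\<close>-th coordinate.\<close>

locale fibred_space =
  fixes X :: "'e::complex_vector set" and N :: "'e \<Rightarrow> real" and S :: "'i set"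
    and W :: "'i \<Rightarrow> 'e \<Rightarrow> 'v::{complex_vector,real_inner,banach}" and F :: "'i \<Rightarrow> 'v set"
  assumes X_subspace: "module.subspace (*\<^sub>C) X"
    and W_add: "\<And>i x y. i \<in> S \<Longrightarrow> x \<in> X \<Longrightarrow> y \<in> X \<Longrightarrow> W i (x + y) = W i x + W i y"
    and W_scaleC: "\<And>i k x. i \<in> S \<Longrightarrow> x \<in> X \<Longrightarrow> W i (k *\<^sub>C x) = k *\<^sub>C W i x"
    and W_fibre: "\<And>i x. i \<in> S \<Longrightarrow> x \<in> X \<Longrightarrow> W i x \<in> F i"
    and N_nonneg: "\<And>x. x \<in> X \<Longrightarrow> 0 \<le> N x"
    and W_norm: "\<And>x. x \<in> X \<Longrightarrow> ((\<lambda>i. (norm (W i x))\<^sup>2) has_sum (N x)\<^sup>2) S"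
    and W_ext: "\<And>x y. x \<in> X \<Longrightarrow> y \<in> X \<Longrightarrow> (\<And>i. i \<in> S \<Longrightarrow> W i x = W i y) \<Longrightarrow> x = y"
    and W_surj: "\<And>g. (\<And>i. i \<in> S \<Longrightarrow> g i \<in> F i) \<Longrightarrow> (\<lambda>i. (norm (g i))\<^sup>2) summable_on S
        \<Longrightarrow> \<exists>x\<in>X. \<forall>i\<in>S. W i x = g i"
    and F_subspace: "\<And>i. i \<in> S \<Longrightarrow> subspace (F i)" and F_closed: "\<And>i. i \<in> S \<Longrightarrow> closed (F i)"
    and scaleC_bounded: "\<And>k. bounded_linear (\<lambda>v::'v. k *\<^sub>C v)"
begin

lemmas X_real = complex_subspaceD(1)[OF X_subspace]
lemmas X_closed = subspace_add[OF X_real] subspace_diff[OF X_real] subspace_scale[OF X_real]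
  complex_subspaceD(2)[OF X_subspace]

lemma W_scaleR: "i \<in> S \<Longrightarrow> x \<in> X \<Longrightarrow> W i (r *\<^sub>R x) = r *\<^sub>R W i x"
  by (simp add: scaleR_scaleC W_scaleC)

lemma W_diff: "i \<in> S \<Longrightarrow> x \<in> X \<Longrightarrow> y \<in> X \<Longrightarrow> W i (x - y) = W i x - W i y"
  using W_add[of i x "(-1) *\<^sub>R y"] W_scaleR[of i y "-1"] X_closed(3)[of y "-1"] by simp

lemma N_eq_sqrt: "x \<in> X \<Longrightarrow> N x = sqrt (\<Sum>\<^sub>\<infinity>i\<in>S. (norm (W i x))\<^sup>2)"
  using infsumI[OF W_norm] N_nonneg by (simp add: real_sqrt_abs)

lemma norm_W_le: "i \<in> S \<Longrightarrow> x \<in> X \<Longrightarrow> norm (W i x) \<le> N x"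
proof (rule power2_le_imp_le)
  assume "i \<in> S" "x \<in> X"
  then show "(norm (W i x))\<^sup>2 \<le> (N x)\<^sup>2"
    using finite_sum_le_has_sum[OF W_norm, of x "{i}"] by simp
  show "0 \<le> N x" using \<open>x \<in> X\<close> by (rule N_nonneg)
qed

lemma N_mono:
  assumes "x \<in> X" "y \<in> X" "0 \<le> k" "\<And>i. i \<in> S \<Longrightarrow> norm (W i x) \<le> k * norm (W i y)"
  shows "N x \<le> k * N y"
proof (rule power2_le_imp_le)
  have "(N x)\<^sup>2 \<le> k\<^sup>2 * (N y)\<^sup>2"
  proof (rule has_sum_mono[OF W_norm has_sum_cmult_right[OF W_norm]])
    show "(norm (W i x))\<^sup>2 \<le> k\<^sup>2 * (norm (W i y))\<^sup>2" if "i \<in> S" for i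
      using power_mono[OF assms(4)[OF that], of 2] by (simp add: power_mult_distrib)
  qed fact+
  then show "(N x)\<^sup>2 \<le> (k * N y)\<^sup>2" by (simp add: power_mult_distrib)
  show "0 \<le> k * N y" using assms N_nonneg by simp
qed

text \<open>The factor \<open>2\<close> is immaterial for the topological arguments below, and it allows a termwise proof by the
  parallelogram identity.\<close>

lemma N_add_le: "x \<in> X \<Longrightarrow> y \<in> X \<Longrightarrow> N (x + y) \<le> 2 * (N x + N y)"
proof (rule power2_le_imp_le)
  assume x: "x \<in> X" and y: "y \<in> X"
  have "(N (x + y))\<^sup>2 \<le> 2 * (N x)\<^sup>2 + 2 * (N y)\<^sup>2"
  proof (rule has_sum_mono)
    show "((\<lambda>i. (norm (W i (x + y)))\<^sup>2) has_sum (N (x + y))\<^sup>2) S"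
      by (rule W_norm) (use x y X_closed in blast)
    show "((\<lambda>i. 2 * (norm (W i x))\<^sup>2 + 2 * (norm (W i y))\<^sup>2) has_sum 2 * (N x)\<^sup>2 + 2 * (N y)\<^sup>2) S"
      by (intro has_sum_add has_sum_cmult_right W_norm x y)
    fix i assume i: "i \<in> S"
    show "(norm (W i (x + y)))\<^sup>2 \<le> 2 * (norm (W i x))\<^sup>2 + 2 * (norm (W i y))\<^sup>2"
      unfolding W_add[OF i x y] by (rule norm_add_square_le)
  qed
  also have "\<dots> \<le> (2 * (N x + N y))\<^sup>2"
    using N_nonneg[OF x] N_nonneg[OF y] by (simp add: power2_eq_square algebra_simps)
  finally show "(N (x + y))\<^sup>2 \<le> (2 * (N x + N y))\<^sup>2" .
  show "0 \<le> 2 * (N x + N y)" using N_nonneg[OF x] N_nonneg[OF y] by simp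
qed

lemma N_commute: "x \<in> X \<Longrightarrow> y \<in> X \<Longrightarrow> N (x - y) = N (y - x)"
  using N_eq_sqrt[of "x - y"] N_eq_sqrt[of "y - x"] X_closed
  by (simp add: W_diff norm_minus_commute cong: infsum_cong)

lemma N_dist_le: "x \<in> X \<Longrightarrow> y \<in> X \<Longrightarrow> z \<in> X \<Longrightarrow> N (x - y) \<le> 2 * (N (x - z) + N (y - z))"
  using N_add_le[of "x - z" "z - y"] N_commute[of y z] X_closed by simp

lemma N_tendsto_0:
  assumes z: "\<forall>\<^sub>F t in Fi. z t \<in> X \<and> (\<forall>i\<in>S. norm (W i (z t)) \<le> b i)"
    and lim: "\<And>i. i \<in> S \<Longrightarrow> ((\<lambda>t. W i (z t)) \<longlongrightarrow> 0) Fi"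
    and b: "(\<lambda>i. (b i)\<^sup>2) summable_on S"
  shows "((\<lambda>t. N (z t)) \<longlongrightarrow> 0) Fi"
proof -
  have "((\<lambda>t. \<Sum>\<^sub>\<infinity>i\<in>S. (norm (W i (z t)))\<^sup>2) \<longlongrightarrow> 0) Fi"
  proof (rule infsum_dominated_tendsto_0[OF _ _ b])
    show "((\<lambda>t. (norm (W i (z t)))\<^sup>2) \<longlongrightarrow> 0) Fi" if "i \<in> S" for i
      using tendsto_power[OF tendsto_norm[OF lim[OF that]], of 2] by simp
    show "\<forall>\<^sub>F t in Fi. \<forall>i\<in>S. 0 \<le> (norm (W i (z t)))\<^sup>2 \<and> (norm (W i (z t)))\<^sup>2 \<le> (b i)\<^sup>2"
      using z by eventually_elim (auto intro: power_mono)
  qed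
  from tendsto_real_sqrt[OF this] have "((\<lambda>t. sqrt (\<Sum>\<^sub>\<infinity>i\<in>S. (norm (W i (z t)))\<^sup>2)) \<longlongrightarrow> 0) Fi" by simp
  then show ?thesis
    by (rule Lim_transform_eventually) (use z in \<open>eventually_elim, simp add: N_eq_sqrt\<close>)
qed

end

text \<open>An operator \<open>G\<close> with domain \<open>DG\<close> that acts on the coordinates by bounded dissipative operators \<open>B i\<close>.
  The last assumption makes the domain the largest possible one: it consists of the \<open>x\<close> for which the family
  of the \<open>B i (W i x)\<close> is again the family of coordinates of some point of \<open>X\<close>.\<close>

locale diagonal_generator = fibred_space X N S W F
  for X :: "'e::complex_vector set" and N :: "'e \<Rightarrow> real" and S :: "'i set"
    and W :: "'i \<Rightarrow> 'e \<Rightarrow> 'v::{complex_vector,real_inner,banach}" and F :: "'i \<Rightarrow> 'v set" +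
  fixes B :: "'i \<Rightarrow> 'v \<Rightarrow> 'v" and DG :: "'e set" and G :: "'e \<Rightarrow> 'e"
  assumes B_diss: "\<And>i. i \<in> S \<Longrightarrow> dissipative (B i)"
    and B_scaleC: "\<And>i k v. i \<in> S \<Longrightarrow> B i (k *\<^sub>C v) = k *\<^sub>C B i v"
    and B_fibre: "\<And>i v. i \<in> S \<Longrightarrow> v \<in> F i \<Longrightarrow> B i v \<in> F i"
    and DG_X: "DG \<subseteq> X" and G_X: "\<And>x. x \<in> DG \<Longrightarrow> G x \<in> X"
    and G_iff: "\<And>x y. x \<in> X \<Longrightarrow> y \<in> X \<Longrightarrow> x \<in> DG \<and> y = G x \<longleftrightarrow> (\<forall>i\<in>S. W i y = B i (W i x))"
begin

lemmas B_bounded = dissipative.axioms(1)[OF B_diss]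
lemmas exp_contracts = dissipative.exp_contracts[OF B_diss]

definition flow :: "real \<Rightarrow> 'e \<Rightarrow> 'e" where
  "flow t x = (THE y. y \<in> X \<and> (\<forall>i\<in>S. W i y = op_exp (B i) t (W i x)))"

lemma flow:
  assumes x: "x \<in> X" and t: "0 \<le> t"
  shows flow_X: "flow t x \<in> X" and W_flow: "i \<in> S \<Longrightarrow> W i (flow t x) = op_exp (B i) t (W i x)"
proof -
  have "\<exists>y\<in>X. \<forall>i\<in>S. W i y = op_exp (B i) t (W i x)"
  proof (rule W_surj)
    show "op_exp (B i) t (W i x) \<in> F i" if "i \<in> S" for i
      using that x by (intro op_exp_mem B_bounded F_subspace F_closed B_fibre W_fibre)
    show "(\<lambda>i. (norm (op_exp (B i) t (W i x)))\<^sup>2) summable_on S"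
      by (rule summable_on_comparison_test[OF has_sum_imp_summable[OF W_norm[OF x]]])
        (use t in \<open>auto intro!: power_mono exp_contracts\<close>)
  qed
  then have "\<exists>!y. y \<in> X \<and> (\<forall>i\<in>S. W i y = op_exp (B i) t (W i x))"
    using W_ext by (metis (no_types, lifting))
  then have "flow t x \<in> X \<and> (\<forall>i\<in>S. W i (flow t x) = op_exp (B i) t (W i x))"
    unfolding flow_def by (rule theI')
  then show "flow t x \<in> X" "i \<in> S \<Longrightarrow> W i (flow t x) = op_exp (B i) t (W i x)" by auto
qed

text \<open>Algebraic laws hold coordinatewise by uniqueness of solutions; strong continuity follows by dominated
  convergence, as all exponentials are contractions.\<close>

lemma flow_C0_semigroup: "C0_semigroup X N flow"
  unfolding C0_semigroup_def
proof (intro conjI allI impI ballI)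
  fix t :: real assume t: "0 \<le> t"
  show "flow t ` X \<subseteq> X" using flow_X t by auto
  show "linear_operator X (flow t)"
    unfolding linear_operator_def
  proof (intro conjI ballI allI X_subspace)
    fix x y assume xy: "x \<in> X" "y \<in> X"
    show "flow t (x + y) = flow t x + flow t y"
    proof (rule W_ext)
      show "flow t (x + y) \<in> X" "flow t x + flow t y \<in> X"
        using xy t by (auto intro: flow_X X_closed)
      show "W i (flow t (x + y)) = W i (flow t x + flow t y)" if "i \<in> S" for i
        using xy t that by (simp add: W_add W_flow flow_X X_closed dissipative.exp_add[OF B_diss])
    qed
  next
    fix k x assume x: "x \<in> X"
    show "flow t (k *\<^sub>C x) = k *\<^sub>C flow t x"
    proof (rule W_ext)
      show "flow t (k *\<^sub>C x) \<in> X" "k *\<^sub>C flow t x \<in> X"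
        using x t by (auto intro: flow_X X_closed)
      show "W i (flow t (k *\<^sub>C x)) = W i (k *\<^sub>C flow t x)" if "i \<in> S" for i
      proof -
        have "op_exp (B i) t (k *\<^sub>C W i x) = k *\<^sub>C op_exp (B i) t (W i x)"
        proof (rule dissipative.exp_commutes[where L = "\<lambda>v. k *\<^sub>C v"])
          show "dissipative (B i)" by (rule B_diss[OF that])
          show "bounded_linear (\<lambda>v::'v. k *\<^sub>C v)" by (rule scaleC_bounded)
          show "B i (k *\<^sub>C v) = k *\<^sub>C B i v" for v by (rule B_scaleC[OF that])
        qed (rule t)
        moreover have "W i (flow t (k *\<^sub>C x)) = op_exp (B i) t (W i (k *\<^sub>C x))"
          using x t that X_closed(4)[OF x] by (simp only: W_flow)
        moreover have "W i (k *\<^sub>C flow t x) = k *\<^sub>C op_exp (B i) t (W i x)"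
          using x t that by (simp only: W_flow W_scaleC flow_X)
        ultimately show ?thesis using x that by (simp only: W_scaleC)
      qed
    qed
  qed
  show "\<exists>M. \<forall>x\<in>X. N (flow t x) \<le> M * N x"
    using t by (intro exI[of _ 1] ballI N_mono) (auto simp: flow_X W_flow exp_contracts)
next
  fix x assume x: "x \<in> X"
  show "flow 0 x = x"
    by (rule W_ext) (use x in \<open>auto simp: flow_X W_flow op_exp_0\<close>)
  show "flow (s + t) x = flow s (flow t x)" if "0 \<le> s" "0 \<le> t" for s t
    by (rule W_ext)
      (use x that in \<open>auto simp: flow_X W_flow dissipative.exp_semigroup[OF B_diss]\<close>)
  show "((\<lambda>t. N (flow t x - x)) \<longlongrightarrow> 0) (at_right 0)"
  proof (rule N_tendsto_0[where b = "\<lambda>i. 2 * norm (W i x)"])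
    show "(\<lambda>i. (2 * norm (W i x))\<^sup>2) summable_on S"
      using summable_on_cmult_right[OF has_sum_imp_summable[OF W_norm[OF x]], of 4]
      by (simp add: power_mult_distrib)
    show "\<forall>\<^sub>F t in at_right 0. flow t x - x \<in> X \<and> (\<forall>i\<in>S. norm (W i (flow t x - x)) \<le> 2 * norm (W i x))"
      using eventually_at_right_less[of 0]
    proof eventually_elim
      case (elim t)
      have "norm (W i (flow t x) - W i x) \<le> 2 * norm (W i x)" if "i \<in> S" for i
        using norm_triangle_ineq4[of "W i (flow t x)" "W i x"] exp_contracts[OF that, of t "W i x"] elim x that
        by (simp add: W_flow)
      then show ?case using x elim by (auto simp: flow_X X_closed W_diff)
    qed
    fix i assume i: "i \<in> S"
    interpret dissipative "B i" by (rule B_diss[OF i])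
    have "((\<lambda>t. op_exp (B i) t (W i x) - W i x) \<longlongrightarrow> 0) (at_right 0)"
    proof (rule Lim_null_comparison)
      show "\<forall>\<^sub>F t in at_right 0. norm (op_exp (B i) t (W i x) - W i x) \<le> t * norm (B i (W i x))"
        using eventually_at_right_less[of 0] by eventually_elim (simp add: exp_diff_le)
      show "((\<lambda>t. t * norm (B i (W i x))) \<longlongrightarrow> 0) (at_right 0)"
        by (intro tendsto_mult_left_zero) simp
    qed
    then show "((\<lambda>t. W i (flow t x - x)) \<longlongrightarrow> 0) (at_right 0)"
      by (rule Lim_transform_eventually)
        (rule eventually_mono[OF eventually_at_right_less[of 0]], use x i in \<open>simp add: W_diff flow_X W_flow\<close>)
  qed
qed

lemma W_quotient:
  assumes "i \<in> S" "x \<in> X" "y \<in> X" "z \<in> X"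
  shows "(z - x) /\<^sub>R h - y \<in> X" "W i ((z - x) /\<^sub>R h - y) = (W i z - W i x) /\<^sub>R h - W i y"
  using assms by (simp_all add: X_closed W_diff W_scaleR)

text \<open>The difference quotients converge in each coordinate, which identifies limits.  Conversely, they are bounded
  by \<open>norm (B i (W i x))\<close>, hence converge in norm as soon as these numbers are square summable.\<close>

lemma flow_generator: "generator_graph X N flow = {(x, G x) |x. x \<in> DG}"
proof (intro set_eqI iffI)
  fix p assume "p \<in> generator_graph X N flow"
  then obtain x y where p: "p = (x, y)" and x: "x \<in> X" and y: "y \<in> X"
    and lim: "((\<lambda>h. N ((flow h x - x) /\<^sub>R h - y)) \<longlongrightarrow> 0) (at_right 0)"
    by (auto simp: generator_graph_def)
  have "W i y = B i (W i x)" if i: "i \<in> S" for i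
  proof -
    interpret dissipative "B i" by (rule B_diss[OF i])
    have "((\<lambda>h. (op_exp (B i) h (W i x) - W i x) /\<^sub>R h - W i y) \<longlongrightarrow> 0) (at_right 0)"
      using _ lim
    proof (rule Lim_null_comparison)
      show "\<forall>\<^sub>F h in at_right 0. norm ((op_exp (B i) h (W i x) - W i x) /\<^sub>R h - W i y) \<le> N ((flow h x - x) /\<^sub>R h - y)"
        using eventually_at_right_less[of 0]
      proof eventually_elim
        case (elim h)
        have "norm (W i ((flow h x - x) /\<^sub>R h - y)) \<le> N ((flow h x - x) /\<^sub>R h - y)"
          using elim i x y by (intro norm_W_le W_quotient flow_X) auto
        then show ?case
          using elim i x y by (simp add: W_quotient flow_X W_flow)
      qed
    qed
    moreover have "((\<lambda>h. (op_exp (B i) h (W i x) - W i x) /\<^sub>R h - W i y) \<longlongrightarrow> B i (W i x) - W i y) (at_right 0)"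
      by (intro tendsto_intros exp_difference_quotient)
    ultimately have "B i (W i x) - W i y = 0"
      using tendsto_unique[OF trivial_limit_at_right_real] by metis
    then show ?thesis by simp
  qed
  then show "p \<in> {(x, G x) |x. x \<in> DG}" using G_iff[OF x y] p by auto
next
  fix p assume "p \<in> {(x, G x) |x. x \<in> DG}"
  then obtain x where p: "p = (x, G x)" and "x \<in> DG" by blast
  then have x: "x \<in> X" and y: "G x \<in> X" using DG_X G_X by auto
  have WG: "W i (G x) = B i (W i x)" if "i \<in> S" for i
    using G_iff[OF x y] that \<open>x \<in> DG\<close> by blast
  have "((\<lambda>h. N ((flow h x - x) /\<^sub>R h - G x)) \<longlongrightarrow> 0) (at_right 0)"
  proof (rule N_tendsto_0[where b = "\<lambda>i. 2 * norm (W i (G x))"])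
    show "(\<lambda>i. (2 * norm (W i (G x)))\<^sup>2) summable_on S"
      using summable_on_cmult_right[OF has_sum_imp_summable[OF W_norm[OF y]], of 4]
      by (simp add: power_mult_distrib)
    show "\<forall>\<^sub>F h in at_right 0. (flow h x - x) /\<^sub>R h - G x \<in> X \<and>
        (\<forall>i\<in>S. norm (W i ((flow h x - x) /\<^sub>R h - G x)) \<le> 2 * norm (W i (G x)))"
      using eventually_at_right_less[of 0]
    proof eventually_elim
      case (elim h)
      have "norm ((op_exp (B i) h (W i x) - W i x) /\<^sub>R h - W i (G x)) \<le> 2 * norm (W i (G x))" if i: "i \<in> S" for i
      proof -
        interpret dissipative "B i" by (rule B_diss[OF i])
        have "norm ((op_exp (B i) h (W i x) - W i x) /\<^sub>R h) \<le> norm (W i (G x))"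
          using exp_diff_le[of h "W i x"] elim by (simp add: WG[OF i] divide_inverse_commute[symmetric] pos_divide_le_eq mult.commute)
        then show ?thesis
          using norm_triangle_ineq4[of "(op_exp (B i) h (W i x) - W i x) /\<^sub>R h" "W i (G x)"] by linarith
      qed
      then show ?case
        using x y elim by (auto simp: flow_X W_flow W_diff W_scaleR X_closed)
    qed
    fix i assume i: "i \<in> S"
    interpret dissipative "B i" by (rule B_diss[OF i])
    have "((\<lambda>h. (op_exp (B i) h (W i x) - W i x) /\<^sub>R h - B i (W i x)) \<longlongrightarrow> B i (W i x) - B i (W i x)) (at_right 0)"
      by (intro tendsto_intros exp_difference_quotient)
    then have "((\<lambda>h. (op_exp (B i) h (W i x) - W i x) /\<^sub>R h - B i (W i x)) \<longlongrightarrow> 0) (at_right 0)" by simp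
    then show "((\<lambda>h. W i ((flow h x - x) /\<^sub>R h - G x)) \<longlongrightarrow> 0) (at_right 0)"
      by (rule Lim_transform_eventually)
        (rule eventually_mono[OF eventually_at_right_less[of 0]], use x y i in \<open>simp add: W_quotient flow_X W_flow WG\<close>)
  qed
  then show "p \<in> generator_graph X N flow" using x y p by (simp add: generator_graph_def)
qed

lemma generates_flow: "generates X N DG G flow"
  by (simp add: generates_def flow_C0_semigroup flow_generator)

end

section \<open>Uniqueness of the generated semigroup\<close>

context fibred_space
begin

text \<open>A right-continuous function into a metric space has a point of continuity in every interval: nested
  intervals on which it oscillates less and less shrink to one.\<close>

lemma right_continuous_imp_continuous_somewhere:
  fixes g :: "real \<Rightarrow> 'e"
  assumes gX: "\<And>t. t \<ge> 0 \<Longrightarrow> g t \<in> X"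
    and right: "\<And>t e. t \<ge> 0 \<Longrightarrow> e > 0 \<Longrightarrow> \<exists>d>0. \<forall>s. t \<le> s \<and> s < t + d \<longrightarrow> N (g s - g t) \<le> e"
    and T: "T > 0"
  shows "\<exists>t. 0 < t \<and> t < T \<and> (\<forall>e>0. \<exists>d>0. \<forall>s. \<bar>s - t\<bar> < d \<longrightarrow> 0 \<le> s \<and> N (g s - g t) \<le> e)"
proof -
  define R where "R = (\<lambda>n (p :: real \<times> real). 0 < fst p \<and> fst p < snd p \<and> snd p < T \<and>
    (\<forall>s\<in>{fst p..snd p}. \<forall>r\<in>{fst p..snd p}. N (g s - g r) \<le> inverse (real (Suc n))))"
  have step: "\<exists>q. R n q \<and> a < fst q \<and> snd q < b" if ab: "0 \<le> a" "a < b" "b \<le> T" for n a b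
  proof -
    define k where "k = inverse (real (Suc n))"
    have "k > 0" by (simp add: k_def)
    define t where "t = (a + b) / 2"
    have t: "a < t" "t < b" "0 \<le> t" using ab by (auto simp: t_def)
    obtain d where d: "d > 0" "\<And>s. t \<le> s \<Longrightarrow> s < t + d \<Longrightarrow> N (g s - g t) \<le> k / 4"
      using right[OF t(3), of "k / 4"] \<open>k > 0\<close> by auto
    define u where "u = min (t + d / 2) ((t + b) / 2)"
    have u: "t < u" "u < b" "u < t + d" using d t by (auto simp: u_def min_def)
    have "N (g s - g r) \<le> k" if "s \<in> {t..u}" "r \<in> {t..u}" for s r
    proof -
      have "N (g s - g r) \<le> 2 * (N (g s - g t) + N (g r - g t))"
        by (rule N_dist_le) (use gX t that in auto)
      moreover have "N (g s - g t) \<le> k / 4" "N (g r - g t) \<le> k / 4"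
        using d(2) that u by auto
      ultimately show ?thesis by simp
    qed
    then have "R n (t, u)" using t u ab by (auto simp: R_def k_def)
    then show ?thesis using t u by (intro exI[of _ "(t, u)"]) auto
  qed
  have "\<exists>f. \<forall>n. R n (f n) \<and> (fst (f n) < fst (f (Suc n)) \<and> snd (f (Suc n)) < snd (f n))"
  proof (rule dependent_nat_choice)
    show "\<exists>p. R 0 p" using step[of 0 T 0] T by auto
    show "\<exists>q. R (Suc n) q \<and> fst p < fst q \<and> snd q < snd p" if "R n p" for p n
      using step[of "fst p" "snd p" "Suc n"] that by (auto simp: R_def)
  qed
  then obtain f where f: "\<And>n. R n (f n)" "\<And>n. fst (f n) < fst (f (Suc n))" "\<And>n. snd (f (Suc n)) < snd (f n)"
    by blast
  have inc: "fst (f m) \<le> fst (f n)" and dec: "snd (f n) \<le> snd (f m)" if "m \<le> n" for m n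
    using lift_Suc_mono_le[of "\<lambda>n. fst (f n)", OF _ that] lift_Suc_antimono_le[of "\<lambda>n. snd (f n)", OF _ that]
      f(2,3) by (auto intro: less_imp_le)
  have cross: "fst (f m) \<le> snd (f n)" for m n
  proof -
    have "fst (f m) \<le> fst (f (max m n))" "snd (f (max m n)) \<le> snd (f n)" using inc dec by auto
    then show ?thesis using f(1)[of "max m n"] by (simp add: R_def)
  qed
  define t where "t = Sup (range (\<lambda>n. fst (f n)))"
  have bdd: "bdd_above (range (\<lambda>n. fst (f n)))" using cross[of _ 0] by (intro bdd_aboveI[of _ "snd (f 0)"]) auto
  have lower: "fst (f n) \<le> t" for n unfolding t_def using bdd by (intro cSup_upper) auto
  have upper: "t \<le> snd (f n)" for n unfolding t_def using cross by (intro cSup_least) auto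
  have t: "fst (f n) < t" "t < snd (f n)" for n
    using lower[of "Suc n"] upper[of "Suc n"] f(2,3)[of n] by linarith+
  show ?thesis
  proof (rule exI[of _ t], intro conjI allI impI)
    show "0 < t" "t < T" using t[of 0] f(1)[of 0] by (auto simp: R_def)
    fix e :: real assume "e > 0"
    then obtain n where n: "inverse (real (Suc n)) < e" using reals_Archimedean by blast
    define d where "d = min (t - fst (f n)) (snd (f n) - t)"
    have "0 \<le> s \<and> N (g s - g t) \<le> e" if "\<bar>s - t\<bar> < d" for s
    proof -
      have "s \<in> {fst (f n)..snd (f n)}" "t \<in> {fst (f n)..snd (f n)}"
        using that t[of n] by (auto simp: d_def)
      then have "N (g s - g t) \<le> inverse (real (Suc n))" "0 \<le> s" using f(1)[of n] by (auto simp: R_def)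
      then show ?thesis using n by linarith
    qed
    moreover have "d > 0" using t[of n] by (simp add: d_def)
    ultimately show "\<exists>d>0. \<forall>s. \<bar>s - t\<bar> < d \<longrightarrow> 0 \<le> s \<and> N (g s - g t) \<le> e" by blast
  qed
qed

lemma C0_semigroup_mem: "C0_semigroup X N T \<Longrightarrow> 0 \<le> t \<Longrightarrow> x \<in> X \<Longrightarrow> T t x \<in> X"
  unfolding C0_semigroup_def by blast

lemma C0_semigroup_operator:
  assumes T: "C0_semigroup X N T" and t: "0 \<le> t"
  obtains M where "M > 0" "\<And>x. x \<in> X \<Longrightarrow> N (T t x) \<le> M * N x"
    "\<And>x y. x \<in> X \<Longrightarrow> y \<in> X \<Longrightarrow> T t (x - y) = T t x - T t y"
    "\<And>r x. x \<in> X \<Longrightarrow> T t (r *\<^sub>R x) = r *\<^sub>R T t x"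
proof -
  have lin: "linear_operator X (T t)" and ex: "\<exists>M. \<forall>x\<in>X. N (T t x) \<le> M * N x"
    using T t unfolding C0_semigroup_def by blast+
  obtain M where M: "\<forall>x\<in>X. N (T t x) \<le> M * N x" using ex by blast
  have scaleR: "T t (r *\<^sub>R x) = r *\<^sub>R T t x" if "x \<in> X" for r x
    using lin that by (simp add: linear_operator_def scaleR_scaleC)
  moreover have "T t (x - y) = T t x - T t y" if "x \<in> X" "y \<in> X" for x y
  proof -
    have "T t (x + (-1) *\<^sub>R y) = T t x + T t ((-1) *\<^sub>R y)"
      using lin that X_closed(3)[of y "-1"] unfolding linear_operator_def by blast
    then show ?thesis using scaleR[OF that(2), of "-1"] by simp
  qed
  moreover have "N (T t x) \<le> max M 1 * N x" if "x \<in> X" for x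
    using M that mult_right_mono[of M "max M 1" "N x"] N_nonneg[OF that] by force
  ultimately show ?thesis using that[of "max M 1"] by simp
qed

lemma C0_semigroup_orbit_right_continuous:
  assumes T: "C0_semigroup X N T" and x: "x \<in> X" and t: "0 \<le> t" and e: "e > 0"
  shows "\<exists>d>0. \<forall>s. t \<le> s \<and> s < t + d \<longrightarrow> N (T s x - T t x) \<le> e"
proof -
  note TX = C0_semigroup_mem[OF T]
  obtain M where M: "M > 0" "\<And>x. x \<in> X \<Longrightarrow> N (T t x) \<le> M * N x"
    and diff: "\<And>x y. x \<in> X \<Longrightarrow> y \<in> X \<Longrightarrow> T t (x - y) = T t x - T t y"
    by (rule C0_semigroup_operator[OF T t]) blast
  have "((\<lambda>t. N (T t x - x)) \<longlongrightarrow> 0) (at_right 0)"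
    using T x by (auto simp: C0_semigroup_def)
  then have "\<forall>\<^sub>F h in at_right 0. N (T h x - x) < e / M"
    using e by (intro order_tendstoD) (auto simp: M)
  then obtain d where d: "d > 0" "\<And>h. 0 < h \<Longrightarrow> h < d \<Longrightarrow> N (T h x - x) < e / M"
    by (auto simp: eventually_at_right_field)
  have "N (T s x - T t x) \<le> e" if s: "t \<le> s" "s < t + d" for s
  proof (cases "s = t")
    case True
    have "N 0 = 0" using N_eq_sqrt[of 0] W_diff[of _ 0 0] subspace_0[OF X_real]
      by (simp cong: infsum_cong)
    then show ?thesis using True e by simp
  next
    case False
    define h where "h = s - t"
    have h: "0 < h" "h < d" "s = t + h" using s False by (auto simp: h_def)
    have "T s x = T t (T h x)"
      using T t h x by (simp add: C0_semigroup_def)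
    moreover have "T t (T h x - x) = T t (T h x) - T t x"
      using TX[of h x] h x by (intro diff) auto
    ultimately have "N (T s x - T t x) \<le> M * N (T h x - x)"
      using M(2)[of "T h x - x"] TX[of h x] h x X_closed(2) by simp
    also have "\<dots> \<le> M * (e / M)"
      using d(2)[OF h(1,2)] by (intro mult_left_mono) (use M(1) in auto)
    also have "\<dots> = e" using M(1) by simp
    finally show ?thesis .
  qed
  then show ?thesis using d(1) by blast
qed

text \<open>Orbits are right continuous, so they are continuous at points arbitrarily close to \<open>0\<close>, and the bounded
  operator \<open>T r\<close> transports continuity at \<open>t0\<close> to \<open>t0 + r\<close>.  This replaces the usual appeal to the
  uniform boundedness principle.\<close>

lemma C0_semigroup_orbit_continuous:
  assumes T: "C0_semigroup X N T" and x: "x \<in> X" and i: "i \<in> S"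
  shows "continuous_on {0..b} (\<lambda>t. W i (T t x))"
proof -
  note TX = C0_semigroup_mem[OF T]
  note right = C0_semigroup_orbit_right_continuous[OF T x]
  have ev: "\<exists>d>0. \<forall>s\<in>{0..b}. dist s t < d \<longrightarrow> N (T s x - T t x) \<le> e" if te: "t \<in> {0..b}" "e > 0" for t e
  proof (cases "t = 0")
    case True
    then show ?thesis using right[of 0 e] te by (fastforce simp: dist_real_def)
  next
    case False
    then have "t > 0" using te by simp
    obtain t0 where t0: "0 < t0" "t0 < t"
      "\<And>e. e > 0 \<Longrightarrow> \<exists>d>0. \<forall>s. \<bar>s - t0\<bar> < d \<longrightarrow> 0 \<le> s \<and> N (T s x - T t0 x) \<le> e"
      using right_continuous_imp_continuous_somewhere[of "\<lambda>t. T t x", OF TX[OF _ x] right \<open>t > 0\<close>] by blast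
    define r where "r = t - t0"
    have r: "0 \<le> r" "t = r + t0" using t0 by (auto simp: r_def)
    obtain M where M: "M > 0" "\<And>x. x \<in> X \<Longrightarrow> N (T r x) \<le> M * N x"
      and diff: "\<And>x y. x \<in> X \<Longrightarrow> y \<in> X \<Longrightarrow> T r (x - y) = T r x - T r y"
      by (rule C0_semigroup_operator[OF T r(1)]) blast
    obtain d where d: "d > 0" "\<And>s. \<bar>s - t0\<bar> < d \<Longrightarrow> 0 \<le> s \<and> N (T s x - T t0 x) \<le> e / M"
      using t0(3)[of "e / M"] te(2) M(1) by auto
    have "N (T s x - T t x) \<le> e" if s: "dist s t < d" for s
    proof -
      have s': "0 \<le> s - r" "N (T (s - r) x - T t0 x) \<le> e / M"
        using d(2)[of "s - r"] s r by (auto simp: dist_real_def)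
      have "T s x = T r (T (s - r) x)" "T t x = T r (T t0 x)"
        using T r(1) s'(1) x t0 r(2) unfolding C0_semigroup_def
        by (metis add.commute diff_add_cancel, metis less_imp_le)
      moreover have "T r (T (s - r) x - T t0 x) = T r (T (s - r) x) - T r (T t0 x)"
        using TX[OF s'(1) x] TX[of t0 x] t0 x by (intro diff) auto
      ultimately have "N (T s x - T t x) \<le> M * N (T (s - r) x - T t0 x)"
        using M(2)[of "T (s - r) x - T t0 x"] TX[OF s'(1) x] TX[of t0 x] t0 x X_closed(2) by simp
      also have "\<dots> \<le> M * (e / M)"
        using s'(2) by (intro mult_left_mono) (use M(1) in auto)
      also have "\<dots> = e" using M(1) by simp
      finally show ?thesis .
    qed
    then show ?thesis using d(1) by blast
  qed
  show ?thesis
    unfolding continuous_on_iff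
  proof (intro ballI allI impI)
    fix t e :: real assume te: "t \<in> {0..b}" "0 < e"
    obtain d where d: "d > 0" "\<And>s. s \<in> {0..b} \<Longrightarrow> dist s t < d \<Longrightarrow> N (T s x - T t x) \<le> e / 2"
      using ev[OF te(1), of "e / 2"] te(2) by auto
    have "dist (W i (T s x)) (W i (T t x)) < e" if s: "s \<in> {0..b}" "dist s t < d" for s
    proof -
      have X: "T s x \<in> X" "T t x \<in> X" using TX s te x by auto
      then have "norm (W i (T s x - T t x)) \<le> N (T s x - T t x)"
        using i X_closed(2) by (intro norm_W_le)
      then show ?thesis using d(2)[OF s] te(2) X i by (simp add: dist_norm W_diff)
    qed
    then show "\<exists>d>0. \<forall>s\<in>{0..b}. dist s t < d \<longrightarrow> dist (W i (T s x)) (W i (T t x)) < e"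
      using d(1) by blast
  qed
qed

end

context diagonal_generator
begin

text \<open>The \<open>i\<close>-th coordinate \<open>w\<close> of an orbit that starts in the domain is continuous with right derivative
  \<open>B i w\<close>.  So the squared distance from the exponential has nonpositive right derivative, and it vanishes at
  \<open>0\<close>.\<close>

lemma generated_semigroup_coordinate:
  assumes gen: "generates X N DG G T" and x: "x \<in> DG" and t: "0 \<le> t" and i: "i \<in> S"
  shows "W i (T t x) = op_exp (B i) t (W i x)"
proof -
  interpret dissipative "B i" by (rule B_diss[OF i])
  have T: "C0_semigroup X N T" and graph: "generator_graph X N T = {(x, G x) |x. x \<in> DG}"
    using gen by (auto simp: generates_def)
  have xX: "x \<in> X" and GX: "G x \<in> X" using x DG_X G_X by auto
  note TX = C0_semigroup_mem[OF T]
  define w where "w = (\<lambda>t. W i (T t x))"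
  have deriv: "(w has_vector_derivative B i (w t)) (at_right t)" if t: "0 \<le> t" for t
  proof -
    obtain M where M: "\<And>x. x \<in> X \<Longrightarrow> N (T t x) \<le> M * N x"
      and diff: "\<And>x y. x \<in> X \<Longrightarrow> y \<in> X \<Longrightarrow> T t (x - y) = T t x - T t y"
      and scaleR: "\<And>r x. x \<in> X \<Longrightarrow> T t (r *\<^sub>R x) = r *\<^sub>R T t x"
      by (rule C0_semigroup_operator[OF T t]) blast
    have lim: "((\<lambda>h. N ((T h x - x) /\<^sub>R h - G x)) \<longlongrightarrow> 0) (at_right 0)"
      using graph x by (auto simp: generator_graph_def set_eq_iff)
    \<comment> \<open>The domain is invariant, and the operators of the semigroup commute with the generator.\<close>
    have "((\<lambda>h. N ((T h (T t x) - T t x) /\<^sub>R h - T t (G x))) \<longlongrightarrow> 0) (at_right 0)"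
    proof (rule Lim_null_comparison)
      show "((\<lambda>h. M * N ((T h x - x) /\<^sub>R h - G x)) \<longlongrightarrow> 0) (at_right 0)"
        by (rule tendsto_mult_right_zero[OF lim])
      show "\<forall>\<^sub>F h in at_right 0. norm (N ((T h (T t x) - T t x) /\<^sub>R h - T t (G x))) \<le> M * N ((T h x - x) /\<^sub>R h - G x)"
        using eventually_at_right_less[of 0]
      proof eventually_elim
        case (elim h)
        have "T h (T t x) = T t (T h x)"
          using T t elim xX unfolding C0_semigroup_def by (metis add.commute less_imp_le)
        moreover have m: "T h x \<in> X" "T h x - x \<in> X" "(T h x - x) /\<^sub>R h \<in> X" "(T h x - x) /\<^sub>R h - G x \<in> X"
          using TX[of h x] elim xX GX by (simp_all add: X_closed)
        ultimately have eq: "(T h (T t x) - T t x) /\<^sub>R h - T t (G x) = T t ((T h x - x) /\<^sub>R h - G x)"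
          using xX GX by (simp only: diff scaleR)
        show ?case unfolding eq using M[OF m(4)] N_nonneg[OF TX[OF t m(4)]] by simp
      qed
    qed
    then have "(T t x, T t (G x)) \<in> generator_graph X N T"
      using TX t xX GX by (simp add: generator_graph_def)
    then have mem: "T t x \<in> DG \<and> T t (G x) = G (T t x)" unfolding graph by blast
    have X2: "T t x \<in> X" "G (T t x) \<in> X" using TX t xX mem G_X by auto
    have WG: "W i (G (T t x)) = B i (w t)"
      using G_iff[OF X2] mem i by (auto simp: w_def)
    have "((\<lambda>h. N ((T h (T t x) - T t x) /\<^sub>R h - G (T t x))) \<longlongrightarrow> 0) (at_right 0)"
      using mem graph by (auto simp: generator_graph_def set_eq_iff)
    then have "((\<lambda>h. (w (t + h) - w t) /\<^sub>R h - B i (w t)) \<longlongrightarrow> 0) (at_right 0)"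
    proof (rule Lim_null_comparison[rotated])
      show "\<forall>\<^sub>F h in at_right 0. norm ((w (t + h) - w t) /\<^sub>R h - B i (w t)) \<le> N ((T h (T t x) - T t x) /\<^sub>R h - G (T t x))"
        using eventually_at_right_less[of 0]
      proof eventually_elim
        case (elim h)
        have "T (t + h) x = T h (T t x)"
          using T t elim xX unfolding C0_semigroup_def by (metis add.commute less_imp_le)
        moreover have "T h (T t x) \<in> X" using TX elim X2 by simp
        moreover have "norm (W i ((T h (T t x) - T t x) /\<^sub>R h - G (T t x))) \<le> N ((T h (T t x) - T t x) /\<^sub>R h - G (T t x))"
          using i calculation X2 by (intro norm_W_le W_quotient) auto
        ultimately show ?case using i X2 by (simp add: W_quotient WG w_def)
      qed
    qed
    then have "((\<lambda>h. (w (t + h) - w t) /\<^sub>R h) \<longlongrightarrow> B i (w t)) (at_right 0)"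
      by (simp add: LIM_zero_iff)
    then have "((\<lambda>s. (w s - w t) /\<^sub>R (s - t)) \<longlongrightarrow> B i (w t)) (at_right t)"
      by (subst filterlim_at_right_to_0) (simp add: add.commute)
    then have lim2: "((\<lambda>s. (w s - w t) /\<^sub>R (s - t) - B i (w t)) \<longlongrightarrow> 0) (at_right t)"
      by (simp add: LIM_zero_iff)
    have "((\<lambda>s. (1 / norm (s - t)) *\<^sub>R (w s - (w t + (s - t) *\<^sub>R B i (w t)))) \<longlongrightarrow> 0) (at_right t)"
      using lim2
    proof (rule Lim_transform_eventually)
      show "\<forall>\<^sub>F s in at_right t. (w s - w t) /\<^sub>R (s - t) - B i (w t) = (1 / norm (s - t)) *\<^sub>R (w s - (w t + (s - t) *\<^sub>R B i (w t)))"
        using eventually_at_right_less[of t]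
        by eventually_elim (simp add: scaleR_diff_right scaleR_add_right divide_inverse)
    qed
    then show ?thesis
      unfolding has_vector_derivative_def has_derivative_within
      by (simp add: bounded_linear_scaleR_left)
  qed
  define \<delta> where "\<delta> = (\<lambda>t. w t - op_exp (B i) t (W i x))"
  have "(norm (\<delta> t))\<^sup>2 \<le> (norm (\<delta> 0))\<^sup>2"
  proof (rule right_derivative_nonpos_imp_le[OF t, where d = "\<lambda>s. 2 * inner (B i (\<delta> s)) (\<delta> s)"])
    have "continuous_on {0..t} (\<lambda>s. op_exp (B i) s (W i x))"
      by (rule continuous_on_vector_derivative) (rule has_vector_derivative_at_within[OF exp_deriv])
    then show "continuous_on {0..t} (\<lambda>s. (norm (\<delta> s))\<^sup>2)"
      unfolding \<delta>_def w_def by (intro continuous_intros C0_semigroup_orbit_continuous T xX i)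
    fix s assume s: "0 \<le> s" "s < t"
    show "2 * inner (B i (\<delta> s)) (\<delta> s) \<le> 0" using diss[of "\<delta> s"] by simp
    have "(\<delta> has_vector_derivative B i (\<delta> s)) (at_right s)"
      unfolding \<delta>_def local.diff
      by (intro has_vector_derivative_diff deriv s has_vector_derivative_at_within[OF exp_deriv])
    then have "(\<delta> has_derivative (\<lambda>h. h *\<^sub>R B i (\<delta> s))) (at_right s)"
      by (simp add: has_vector_derivative_def)
    from has_derivative_inner[OF this this]
    show "((\<lambda>s. (norm (\<delta> s))\<^sup>2) has_real_derivative 2 * inner (B i (\<delta> s)) (\<delta> s)) (at_right s)"
      by (simp add: has_field_derivative_def power2_norm_eq_inner inner_commute algebra_simps mult_commute_abs)
  qed
  moreover have "T 0 x = x" using T xX by (simp add: C0_semigroup_def)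
  then have "\<delta> 0 = 0" by (simp add: \<delta>_def w_def op_exp_0)
  ultimately show ?thesis by (simp add: \<delta>_def w_def)
qed

text \<open>Existence makes the choice of a generated semigroup meaningful, and uniqueness computes it.\<close>

theorem norm_semigroup_of:
  assumes x: "x \<in> DG" and t: "0 \<le> t"
  shows "((\<lambda>i. (norm (op_exp (B i) t (W i x)))\<^sup>2) has_sum (N (semigroup_of X N DG G t x))\<^sup>2) S"
proof -
  have gen: "generates X N DG G (semigroup_of X N DG G)"
    unfolding semigroup_of_def by (rule someI[of "generates X N DG G", OF generates_flow])
  then have "semigroup_of X N DG G t x \<in> X"
    using x t DG_X C0_semigroup_mem by (auto simp: generates_def)
  from W_norm[OF this] show ?thesis
    by (rule has_sum_cong[THEN iffD1, rotated]) (simp add: generated_semigroup_coordinate[OF gen x t])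
qed

end

section \<open>The modes of the coupled system\<close>

text \<open>The system on the eigenspace of \<open>s\<^sup>2\<close> in the components \<open>(r s u, v, s y, z)\<close>, with \<open>a = r\<^sup>2\<close> and the
  damping \<open>d\<close>.\<close>

definition mode_op :: "real \<Rightarrow> real \<Rightarrow> real \<Rightarrow> real \<Rightarrow> 'h \<times> 'h \<times> 'h \<times> 'h \<Rightarrow> 'h \<times> 'h \<times> 'h \<times> 'h::real_inner" where
  "mode_op r s d \<alpha> = (\<lambda>(x1, x2, x3, x4).
     ((r * s) *\<^sub>R x2, - ((r * s) *\<^sub>R x1) - d *\<^sub>R x2 - \<alpha> *\<^sub>R x4, s *\<^sub>R x4, - (s *\<^sub>R x3) + \<alpha> *\<^sub>R x2))"

lemma norm4: "(norm (x1, x2, x3, x4))\<^sup>2 = (norm x1)\<^sup>2 + (norm x2)\<^sup>2 + (norm x3)\<^sup>2 + (norm x4)\<^sup>2"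
  by (simp add: norm_prod_def)

lemma bounded_linear_mode_op: "bounded_linear (mode_op r s d \<alpha>)"
proof -
  have scaleR: "bounded_linear (\<lambda>x. k *\<^sub>R f x)" if "bounded_linear f" for k and f :: "'a \<times> 'a \<times> 'a \<times> 'a \<Rightarrow> 'a"
    by (rule bounded_linear_compose[OF bounded_linear_scaleR_right that])
  have "bounded_linear (\<lambda>x :: 'a \<times> 'a \<times> 'a \<times> 'a. ((r * s) *\<^sub>R fst (snd x),
      - ((r * s) *\<^sub>R fst x) - d *\<^sub>R fst (snd x) - \<alpha> *\<^sub>R snd (snd (snd x)),
      s *\<^sub>R snd (snd (snd x)), - (s *\<^sub>R fst (snd (snd x))) + \<alpha> *\<^sub>R fst (snd x)))"
    by (intro bounded_linear_Pair bounded_linear_sub bounded_linear_add bounded_linear_minus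
        scaleR bounded_linear_fst_comp bounded_linear_snd_comp
        bounded_linear_fst bounded_linear_snd bounded_linear_ident)
  then show ?thesis unfolding mode_op_def case_prod_beta .
qed

lemma dissipative_mode_op:
  assumes "0 \<le> d"
  shows "dissipative (mode_op r s d \<alpha> :: 'h \<times> 'h \<times> 'h \<times> 'h \<Rightarrow> 'h \<times> 'h \<times> 'h \<times> 'h::{real_inner,banach})"
proof (intro dissipative.intro bounded_linear_mode_op dissipative_axioms.intro)
  fix x :: "'h \<times> 'h \<times> 'h \<times> 'h"
  obtain x1 x2 x3 x4 where x: "x = (x1, x2, x3, x4)" by (cases x) auto
  have "inner (mode_op r s d \<alpha> x) x = - d * inner x2 x2"
    by (simp add: x mode_op_def inner_diff_left inner_add_left inner_commute[of x2 x1]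
        inner_commute[of x4 x2] inner_commute[of x4 x3])
  then show "inner (mode_op r s d \<alpha> x) x \<le> 0" using assms by simp
qed

lemma has_real_derivative_inner:
  assumes "(x has_vector_derivative x') (at t)" "(y has_vector_derivative y') (at t)"
  shows "((\<lambda>t. inner (x t) (y t)) has_real_derivative inner x' (y t) + inner (x t) y') (at t)"
  unfolding has_field_derivative_def
  by (rule has_derivative_eq_rhs[OF has_derivative_inner[OF assms[unfolded has_vector_derivative_def]]])
    (simp add: fun_eq_iff algebra_simps)

lemma young: "c * inner x y \<le> e * (norm x)\<^sup>2 + c\<^sup>2 / (4 * e) * (norm y)\<^sup>2" if "e > 0" for x y :: "'a::real_inner"
proof -
  have "0 \<le> (norm ((2 * e) *\<^sub>R x - c *\<^sub>R y))\<^sup>2" by simp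
  also have "\<dots> = 4 * e * (e * (norm x)\<^sup>2 - c * inner x y + c\<^sup>2 / (4 * e) * (norm y)\<^sup>2)"
    using that unfolding power2_norm_eq_inner
    by (simp add: inner_diff_left inner_diff_right inner_commute[of y x] power2_eq_square field_simps)
  finally show ?thesis using that by (simp add: zero_le_mult_iff)
qed

lemma abs_inner_le: "\<bar>inner x y\<bar> \<le> (norm x)\<^sup>2 / 2 + (norm y)\<^sup>2 / 2" for x y :: "'a::real_inner"
  using young[of "1/2" 1 x y] young[of "1/2" "-1" x y] by (simp add: power2_eq_square abs_le_iff)

locale mode_solution =
  fixes r s d \<alpha> :: real and x1 x2 x3 x4 :: "real \<Rightarrow> 'h::real_inner"
  assumes s_pos: "0 < s" and d_pos: "0 < d"
    and x1': "\<And>t. (x1 has_vector_derivative (r * s) *\<^sub>R x2 t) (at t)"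
    and x2': "\<And>t. (x2 has_vector_derivative - ((r * s) *\<^sub>R x1 t) - d *\<^sub>R x2 t - \<alpha> *\<^sub>R x4 t) (at t)"
    and x3': "\<And>t. (x3 has_vector_derivative s *\<^sub>R x4 t) (at t)"
    and x4': "\<And>t. (x4 has_vector_derivative - (s *\<^sub>R x3 t) + \<alpha> *\<^sub>R x2 t) (at t)"
begin

definition En where "En t = (norm (x1 t))\<^sup>2 + (norm (x2 t))\<^sup>2 + (norm (x3 t))\<^sup>2 + (norm (x4 t))\<^sup>2"

lemma En_nonneg: "0 \<le> En t" and x2_le_En: "(norm (x2 t))\<^sup>2 \<le> En t" and x3_le_En: "(norm (x3 t))\<^sup>2 \<le> En t"
  by (simp_all add: En_def)

lemmas inner_derivs =
  has_real_derivative_inner[OF x1' x1'] has_real_derivative_inner[OF x2' x2']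
  has_real_derivative_inner[OF x3' x3'] has_real_derivative_inner[OF x4' x4']
  has_real_derivative_inner[OF x1' x2'] has_real_derivative_inner[OF x1' x3']
  has_real_derivative_inner[OF x1' x4'] has_real_derivative_inner[OF x2' x3']
  has_real_derivative_inner[OF x2' x4'] has_real_derivative_inner[OF x3' x4']

lemmas inner_normal = inner_diff_left inner_add_left inner_diff_right inner_add_right
  inner_commute[of "x2 t" "x1 t" for t] inner_commute[of "x3 t" "x1 t" for t]
  inner_commute[of "x4 t" "x1 t" for t] inner_commute[of "x3 t" "x2 t" for t]
  inner_commute[of "x4 t" "x2 t" for t] inner_commute[of "x4 t" "x3 t" for t]

lemma En': "(En has_real_derivative - 2 * d * (norm (x2 t))\<^sup>2) (at t)"
  unfolding En_def[abs_def] power2_norm_eq_inner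
  by (rule derivative_eq_intros inner_derivs refl)+ (simp add: inner_normal algebra_simps)

lemma En_antimono: "0 \<le> t \<Longrightarrow> En t \<le> En 0"
  by (rule DERIV_nonpos_imp_nonincreasing) (use En' d_pos in \<open>auto intro!: exI[of _ "- 2 * d * (norm (x2 _))\<^sup>2"]\<close>)

subsection \<open>Lower bounds\<close>

lemma En_lower_damping:
  assumes t: "0 \<le> t" shows "(1 - 2 * d * t) * En 0 \<le> En t"
proof -
  have "En 0 + 2 * d * En 0 * 0 \<le> En t + 2 * d * En 0 * t"
  proof (rule DERIV_nonneg_imp_nondecreasing[OF t, of "\<lambda>t. En t + 2 * d * En 0 * t"])
    fix u assume u: "0 \<le> u" "u \<le> t"
    have "((\<lambda>t. En t + 2 * d * En 0 * t) has_real_derivative - 2 * d * (norm (x2 u))\<^sup>2 + 2 * d * En 0) (at u)"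
      by (rule derivative_eq_intros En' refl)+ simp
    moreover have "(norm (x2 u))\<^sup>2 \<le> En 0" using order_trans[OF x2_le_En En_antimono[OF u(1)]] .
    then have "d * (norm (x2 u))\<^sup>2 \<le> d * En 0" using d_pos by simp
    then have "0 \<le> - 2 * d * (norm (x2 u))\<^sup>2 + 2 * d * En 0" by simp
    ultimately show "\<exists>y. ((\<lambda>t. En t + 2 * d * En 0 * t) has_real_derivative y) (at u) \<and> 0 \<le> y"
      by blast
  qed
  then show ?thesis by (simp add: algebra_simps)
qed

text \<open>Let \<open>g = r \<langle>x1, x4\<rangle> - \<langle>x2, x3\<rangle>\<close>.  Up to total derivatives and damping terms, its derivative is
  \<open>(r\<^sup>2 - 1) s \<langle>x2, x4\<rangle>\<close>, and \<open>- 2 \<alpha> \<langle>x2, x4\<rangle>\<close> is the power that the damped oscillator receives through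
  the coupling.  So adding \<open>k g\<close> and the correction by \<open>\<alpha> / (2 s)\<close> to the energy of that oscillator gives a
  function \<open>F\<close> that only changes by damping.  As \<open>k\<close> is of order \<open>1 / s\<close>, the combination \<open>En - 2 F\<close> loses energy at
  most at the rate \<open>k\<^sup>2 d / 2\<close>, of order \<open>d / s\<^sup>2\<close>, while \<open>F\<close> vanishes initially and remains above
  \<open>- const / s\<close>.\<close>

lemma En_lower_detuned:
  assumes t: "0 \<le> t" and r: "r\<^sup>2 \<noteq> 1" "0 < r" and init: "x1 0 = 0" "x2 0 = 0" "x3 0 = 0"
  defines "k \<equiv> 2 * \<alpha> / ((r\<^sup>2 - 1) * s)"
  shows "(1 - 2 * \<bar>k\<bar> * (r + 1 + \<bar>\<alpha>\<bar> / s) - k\<^sup>2 / 2 * d * t) * En 0 \<le> En t"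
proof -
  define F where "F = (\<lambda>t. inner (x1 t) (x1 t) + inner (x2 t) (x2 t) + k * (r * inner (x1 t) (x4 t) - inner (x2 t) (x3 t)
      - \<alpha> / (2 * s) * (inner (x1 t) (x1 t) + inner (x3 t) (x3 t))))"
  have k: "k * ((r\<^sup>2 - 1) * s) = 2 * \<alpha>" using r s_pos by (simp add: k_def)
  have F': "(F has_real_derivative - 2 * d * (norm (x2 u))\<^sup>2 + k * d * inner (x2 u) (x3 u)) (at u)" for u
  proof -
    have "(F has_real_derivative - 2 * d * (norm (x2 u))\<^sup>2 + k * d * inner (x2 u) (x3 u)
        + (k * ((r\<^sup>2 - 1) * s) - 2 * \<alpha>) * inner (x2 u) (x4 u)) (at u)"
      unfolding F_def power2_norm_eq_inner
      by (rule derivative_eq_intros inner_derivs refl)+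
        (use s_pos in \<open>simp add: inner_normal power2_eq_square field_simps\<close>)
    then show ?thesis by (simp add: k)
  qed
  have F_ge: "- (\<bar>k\<bar> * (r + 1 + \<bar>\<alpha>\<bar> / s)) * En 0 \<le> F t"
  proof -
    define g where "g = r * inner (x1 t) (x4 t) - inner (x2 t) (x3 t) - \<alpha> / (2 * s) * (inner (x1 t) (x1 t) + inner (x3 t) (x3 t))"
    have "\<bar>inner (x1 t) (x4 t)\<bar> \<le> En t" "\<bar>inner (x2 t) (x3 t)\<bar> \<le> En t"
      using abs_inner_le[of "x1 t" "x4 t"] abs_inner_le[of "x2 t" "x3 t"]
      by (auto simp: En_def intro: order_trans)
    then have "\<bar>r * inner (x1 t) (x4 t)\<bar> \<le> r * En t" "\<bar>inner (x2 t) (x3 t)\<bar> \<le> En t"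
      using r by (simp_all add: abs_mult)
    moreover have "\<bar>\<alpha> / (2 * s) * (inner (x1 t) (x1 t) + inner (x3 t) (x3 t))\<bar> \<le> \<bar>\<alpha>\<bar> / s * En t"
    proof -
      have "\<bar>\<alpha> / (2 * s) * (inner (x1 t) (x1 t) + inner (x3 t) (x3 t))\<bar>
          = \<bar>\<alpha>\<bar> / s * ((inner (x1 t) (x1 t) + inner (x3 t) (x3 t)) / 2)"
        using s_pos by (simp add: abs_mult)
      also have "\<dots> \<le> \<bar>\<alpha>\<bar> / s * En t"
        using s_pos by (intro mult_left_mono) (auto simp: En_def power2_norm_eq_inner)
      finally show ?thesis .
    qed
    ultimately have "\<bar>g\<bar> \<le> r * En t + En t + \<bar>\<alpha>\<bar> / s * En t" unfolding g_def by linarith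
    also have "\<dots> = (r + 1 + \<bar>\<alpha>\<bar> / s) * En t" by (simp add: algebra_simps)
    also have "\<dots> \<le> (r + 1 + \<bar>\<alpha>\<bar> / s) * En 0"
      using En_antimono[OF t] r s_pos by (intro mult_left_mono) auto
    finally have "\<bar>k * g\<bar> \<le> \<bar>k\<bar> * ((r + 1 + \<bar>\<alpha>\<bar> / s) * En 0)"
      unfolding abs_mult by (rule mult_left_mono) simp
    moreover have "k * g \<le> F t" by (simp add: F_def g_def)
    ultimately show ?thesis by (simp add: mult.assoc) 
  qed
  have "En 0 - 2 * F 0 + k\<^sup>2 / 2 * d * En 0 * 0 \<le> En t - 2 * F t + k\<^sup>2 / 2 * d * En 0 * t"
  proof (rule DERIV_nonneg_imp_nondecreasing[OF t, of "\<lambda>t. En t - 2 * F t + k\<^sup>2 / 2 * d * En 0 * t"])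
    fix u assume u: "0 \<le> u" "u \<le> t"
    let ?y = "2 * d * (norm (x2 u))\<^sup>2 - 2 * k * d * inner (x2 u) (x3 u) + k\<^sup>2 / 2 * d * En 0"
    have "((\<lambda>t. En t - 2 * F t + k\<^sup>2 / 2 * d * En 0 * t) has_real_derivative ?y) (at u)"
      by (rule derivative_eq_intros En' F' refl)+ simp
    moreover have "0 \<le> ?y"
    proof -
      have "(2 * k) * inner (x2 u) (x3 u) \<le> 2 * (norm (x2 u))\<^sup>2 + (2 * k)\<^sup>2 / (4 * 2) * (norm (x3 u))\<^sup>2"
        by (rule young) simp
      also have "\<dots> \<le> 2 * (norm (x2 u))\<^sup>2 + k\<^sup>2 / 2 * En 0"
      proof -
        have "(norm (x3 u))\<^sup>2 \<le> En 0" using order_trans[OF x3_le_En En_antimono[OF u(1)]] .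
        then have "k\<^sup>2 / 2 * (norm (x3 u))\<^sup>2 \<le> k\<^sup>2 / 2 * En 0" by (intro mult_left_mono) auto
        then show ?thesis by (simp add: power_mult_distrib)
      qed
      finally have "d * ((2 * k) * inner (x2 u) (x3 u)) \<le> d * (2 * (norm (x2 u))\<^sup>2 + k\<^sup>2 / 2 * En 0)"
        using d_pos by simp
      then show ?thesis by (simp add: algebra_simps)
    qed
    ultimately show "\<exists>y. ((\<lambda>t. En t - 2 * F t + k\<^sup>2 / 2 * d * En 0 * t) has_real_derivative y) (at u) \<and> 0 \<le> y"
      by blast
  qed
  moreover have "F 0 = 0" by (simp add: F_def init)
  ultimately show ?thesis using F_ge by (simp add: algebra_simps)
qed

subsection \<open>A Lyapunov function\<close>

text \<open>The energy itself only dissipates \<open>x2\<close>.  The first bracket of \<open>Q\<close> has derivative \<open>- \<alpha> (norm x4)\<^sup>2\<close>, up to terms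
  containing \<open>x2\<close>; the factor \<open>r\<close> in it cancels the terms \<open>s \<langle>x1, x4\<rangle>\<close>.  The second one trades \<open>x4\<close> for \<open>x3\<close> and
  \<open>x2\<close> for \<open>x1\<close>, with a weight that keeps its positive terms small against \<open>\<alpha>\<^sup>2\<close>.  The worst remaining term is
  \<open>(r\<^sup>2 - 1) s \<langle>x2, x3\<rangle>\<close>, which is absent at resonance.\<close>

definition Q where
  "Q \<beta> t = \<alpha> * (inner (x2 t) (x4 t) + r * inner (x1 t) (x3 t)) + \<beta> / s * (inner (x1 t) (x2 t) + inner (x3 t) (x4 t))"

definition Q_rate where
  "Q_rate \<beta> t = \<alpha> * (r\<^sup>2 - 1) * s * inner (x2 t) (x3 t) + (- \<alpha> * d) * inner (x2 t) (x4 t)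
     - \<alpha>\<^sup>2 * (norm (x4 t))\<^sup>2 + \<alpha>\<^sup>2 * (norm (x2 t))\<^sup>2
     + \<beta> * r * (norm (x2 t))\<^sup>2 - \<beta> * r * (norm (x1 t))\<^sup>2
     + (- \<beta> * d / s) * inner (x1 t) (x2 t) + (- \<beta> * \<alpha> / s) * inner (x1 t) (x4 t)
     + \<beta> * (norm (x4 t))\<^sup>2 - \<beta> * (norm (x3 t))\<^sup>2 + (\<beta> * \<alpha> / s) * inner (x2 t) (x3 t)"

lemma Q': "(Q \<beta> has_real_derivative Q_rate \<beta> t) (at t)"
  unfolding Q_def[abs_def] Q_rate_def power2_norm_eq_inner
  by (rule derivative_eq_intros inner_derivs refl)+
    (use s_pos in \<open>simp add: inner_normal power2_eq_square field_simps\<close>)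

text \<open>Each mixed product is split by Young's inequality so that the parts with \<open>x1\<close>, \<open>x3\<close>, \<open>x4\<close> use up only a
  fixed fraction of the available negative squares; the whole remainder is charged to \<open>x2\<close>.\<close>

lemma Q_rate_le:
  assumes r: "0 < r" and s: "0 < s0" "s0 \<le> s" and d: "d \<le> d1"
    and b: "0 < \<beta>" "\<beta> \<le> \<alpha>\<^sup>2 / 4" "\<beta> \<le> r * s0\<^sup>2 / 4"
    and m: "m \<le> \<alpha>\<^sup>2 / 4" "m \<le> \<beta> * r / 2" "m \<le> \<beta> / 2" "0 \<le> m"
    and K: "\<alpha>\<^sup>2 + \<beta> * r + d1\<^sup>2 + \<beta> * \<alpha>\<^sup>2 / s0\<^sup>2 + \<beta> * d1\<^sup>2 / (r * s0\<^sup>2) + \<alpha>\<^sup>2 / \<beta> + m \<le> K"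
  shows "Q_rate \<beta> t \<le> K * (1 + (r\<^sup>2 - 1)\<^sup>2 * s\<^sup>2) * (norm (x2 t))\<^sup>2 - m * En t"
proof -
  define n1 n2 n3 n4 where "n1 = (norm (x1 t))\<^sup>2" and "n2 = (norm (x2 t))\<^sup>2"
    and "n3 = (norm (x3 t))\<^sup>2" and "n4 = (norm (x4 t))\<^sup>2"
  have n: "0 \<le> n1" "0 \<le> n2" "0 \<le> n3" "0 \<le> n4" by (simp_all add: n1_def n2_def n3_def n4_def)
  define z where "z = (r\<^sup>2 - 1)\<^sup>2 * s\<^sup>2"
  have y1: "\<alpha> * (r\<^sup>2 - 1) * s * inner (x2 t) (x3 t) \<le> \<beta> / 4 * n3 + \<alpha>\<^sup>2 / \<beta> * z * n2"
  proof -
    have "\<alpha> * (r\<^sup>2 - 1) * s * inner (x3 t) (x2 t)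
        \<le> \<beta> / 4 * n3 + (\<alpha> * (r\<^sup>2 - 1) * s)\<^sup>2 / (4 * (\<beta> / 4)) * n2"
      unfolding n2_def n3_def by (rule young) (use b in simp)
    also have "(\<alpha> * (r\<^sup>2 - 1) * s)\<^sup>2 / (4 * (\<beta> / 4)) = \<alpha>\<^sup>2 / \<beta> * z"
      using b(1) by (simp add: z_def power_mult_distrib)
    finally show ?thesis by (simp only: inner_commute[of "x3 t"])
  qed
  have y2: "(- \<alpha> * d) * inner (x2 t) (x4 t) \<le> \<alpha>\<^sup>2 / 4 * n4 + d1\<^sup>2 * n2"
  proof -
    have "(- \<alpha> * d) * inner (x2 t) (x4 t) \<le> d\<^sup>2 * n2 + (\<alpha> * d)\<^sup>2 / (4 * d\<^sup>2) * n4"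
      using young[of "d\<^sup>2" "- \<alpha> * d" "x2 t" "x4 t"] d_pos by (simp add: n2_def n4_def)
    also have "\<dots> = d\<^sup>2 * n2 + \<alpha>\<^sup>2 / 4 * n4" using d_pos by (simp add: power_mult_distrib)
    also have "d\<^sup>2 * n2 \<le> d1\<^sup>2 * n2" using n d d_pos by (intro mult_right_mono power_mono) auto
    finally show ?thesis by simp
  qed
  have y3: "(\<beta> * \<alpha> / s) * inner (x2 t) (x3 t) \<le> \<beta> / 4 * n3 + \<beta> * \<alpha>\<^sup>2 / s0\<^sup>2 * n2"
  proof -
    have "(\<beta> * \<alpha> / s) * inner (x3 t) (x2 t) \<le> \<beta> / 4 * n3 + (\<beta> * \<alpha> / s)\<^sup>2 / (4 * (\<beta> / 4)) * n2"
      unfolding n2_def n3_def by (rule young) (use b in simp)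
    also have "(\<beta> * \<alpha> / s)\<^sup>2 / (4 * (\<beta> / 4)) = \<beta> * \<alpha>\<^sup>2 / s\<^sup>2"
      using b(1) by (simp add: power_mult_distrib power_divide power2_eq_square)
    also have "\<beta> * \<alpha>\<^sup>2 / s\<^sup>2 * n2 \<le> \<beta> * \<alpha>\<^sup>2 / s0\<^sup>2 * n2"
      using b s n by (intro mult_right_mono divide_left_mono power_mono) auto
    finally show ?thesis by (simp add: inner_commute)
  qed
  have y4: "(- \<beta> * d / s) * inner (x1 t) (x2 t) \<le> \<beta> * r / 4 * n1 + \<beta> * d1\<^sup>2 / (r * s0\<^sup>2) * n2"
  proof -
    have "(- \<beta> * d / s) * inner (x1 t) (x2 t) \<le> \<beta> * r / 4 * n1 + (- \<beta> * d / s)\<^sup>2 / (4 * (\<beta> * r / 4)) * n2"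
      unfolding n1_def n2_def by (rule young) (use b r in simp)
    also have "(- \<beta> * d / s)\<^sup>2 / (4 * (\<beta> * r / 4)) = \<beta> * d\<^sup>2 / (r * s\<^sup>2)"
      using b(1) by (simp add: power_mult_distrib power_divide power2_eq_square mult_ac)
    also have "\<beta> * d\<^sup>2 / (r * s\<^sup>2) * n2 \<le> \<beta> * d1\<^sup>2 / (r * s0\<^sup>2) * n2"
      using b s n r d d_pos by (intro mult_right_mono frac_le mult_left_mono power_mono) auto
    finally show ?thesis by simp
  qed
  have y5: "(- \<beta> * \<alpha> / s) * inner (x1 t) (x4 t) \<le> \<beta> * r / 4 * n1 + \<alpha>\<^sup>2 / 4 * n4"
  proof -
    have "(- \<beta> * \<alpha> / s) * inner (x1 t) (x4 t) \<le> \<beta> * r / 4 * n1 + (- \<beta> * \<alpha> / s)\<^sup>2 / (4 * (\<beta> * r / 4)) * n4"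
      unfolding n1_def n4_def by (rule young) (use b r in simp)
    also have "(- \<beta> * \<alpha> / s)\<^sup>2 / (4 * (\<beta> * r / 4)) = \<beta> / (r * s\<^sup>2) * \<alpha>\<^sup>2"
      using b(1) by (simp add: power_mult_distrib power_divide power2_eq_square mult_ac)
    also have "\<beta> / (r * s\<^sup>2) * \<alpha>\<^sup>2 * n4 \<le> 1 / 4 * \<alpha>\<^sup>2 * n4"
    proof -
      have "\<beta> \<le> r * s\<^sup>2 / 4"
      proof -
        have "r * s0\<^sup>2 \<le> r * s\<^sup>2" using s r by (intro mult_left_mono power_mono) auto
        then show ?thesis using b(3) by linarith
      qed
      then have "\<beta> / (r * s\<^sup>2) \<le> 1 / 4" using r s_pos by (simp add: divide_le_eq)
      then show ?thesis using n by (intro mult_right_mono) auto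
    qed
    finally show ?thesis by simp
  qed
  have "Q_rate \<beta> t \<le> (\<alpha>\<^sup>2 + \<beta> * r + d1\<^sup>2 + \<beta> * \<alpha>\<^sup>2 / s0\<^sup>2 + \<beta> * d1\<^sup>2 / (r * s0\<^sup>2)) * n2 + \<alpha>\<^sup>2 / \<beta> * z * n2
      - \<beta> * r / 2 * n1 - \<beta> / 2 * n3 - (\<alpha>\<^sup>2 / 2 - \<beta>) * n4"
  proof -
    note y = y1 y2 y3 y4 y5
    have "Q_rate \<beta> t \<le> (\<beta> / 4 * n3 + \<alpha>\<^sup>2 / \<beta> * z * n2) + (\<alpha>\<^sup>2 / 4 * n4 + d1\<^sup>2 * n2)
        - \<alpha>\<^sup>2 * n4 + \<alpha>\<^sup>2 * n2 + \<beta> * r * n2 - \<beta> * r * n1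
        + (\<beta> * r / 4 * n1 + \<beta> * d1\<^sup>2 / (r * s0\<^sup>2) * n2) + (\<beta> * r / 4 * n1 + \<alpha>\<^sup>2 / 4 * n4)
        + \<beta> * n4 - \<beta> * n3 + (\<beta> / 4 * n3 + \<beta> * \<alpha>\<^sup>2 / s0\<^sup>2 * n2)"
      unfolding Q_rate_def n1_def[symmetric] n2_def[symmetric] n3_def[symmetric] n4_def[symmetric]
      by (intro add_mono diff_mono y order_refl)
    then show ?thesis by (simp add: algebra_simps)
  qed
  also have "\<dots> \<le> K * (1 + z) * n2 - m * n2 - m * n1 - m * n3 - m * n4"
  proof -
    have "m * n1 \<le> \<beta> * r / 2 * n1" "m * n3 \<le> \<beta> / 2 * n3" by (rule mult_right_mono[OF m(2) n(1)], rule mult_right_mono[OF m(3) n(3)])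
    moreover have "m * n4 \<le> (\<alpha>\<^sup>2 / 2 - \<beta>) * n4" using m b n by (intro mult_right_mono) auto
    moreover have "(\<alpha>\<^sup>2 + \<beta> * r + d1\<^sup>2 + \<beta> * \<alpha>\<^sup>2 / s0\<^sup>2 + \<beta> * d1\<^sup>2 / (r * s0\<^sup>2)) * n2 + \<alpha>\<^sup>2 / \<beta> * z * n2 + m * n2 \<le> K * (1 + z) * n2"
    proof -
      define q where "q = \<alpha>\<^sup>2 + \<beta> * r + d1\<^sup>2 + \<beta> * \<alpha>\<^sup>2 / s0\<^sup>2 + \<beta> * d1\<^sup>2 / (r * s0\<^sup>2)"
      have q: "0 \<le> q" "0 \<le> \<alpha>\<^sup>2 / \<beta>" "0 \<le> z" using b r by (auto simp: q_def z_def)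
      have K': "q + \<alpha>\<^sup>2 / \<beta> + m \<le> K" using K by (simp add: q_def)
      have "\<alpha>\<^sup>2 / \<beta> * z \<le> K * z" using K' q m by (intro mult_right_mono) auto
      then have "(q + \<alpha>\<^sup>2 / \<beta> * z + m) * n2 \<le> (K * (1 + z)) * n2"
        using K' q n by (intro mult_right_mono) (auto simp: algebra_simps)
      then show ?thesis unfolding q_def[symmetric] by (simp add: algebra_simps)
    qed
    ultimately show ?thesis by linarith
  qed
  also have "\<dots> = K * (1 + (r\<^sup>2 - 1)\<^sup>2 * s\<^sup>2) * (norm (x2 t))\<^sup>2 - m * En t"
    by (simp add: En_def z_def n1_def n2_def n3_def n4_def algebra_simps)
  finally show ?thesis .
qed

lemma Q_abs_le:
  assumes r: "0 < r" and s: "0 < s0" "s0 \<le> s" and b: "0 < \<beta>"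
  shows "\<bar>Q \<beta> t\<bar> \<le> (\<bar>\<alpha>\<bar> * (1 + r) + 2 * \<beta> / s0) * En t"
proof -
  have i: "\<bar>inner (x2 t) (x4 t)\<bar> \<le> En t" "\<bar>inner (x1 t) (x3 t)\<bar> \<le> En t"
      "\<bar>inner (x1 t) (x2 t)\<bar> \<le> En t" "\<bar>inner (x3 t) (x4 t)\<bar> \<le> En t"
    using abs_inner_le[of "x2 t" "x4 t"] abs_inner_le[of "x1 t" "x3 t"]
      abs_inner_le[of "x1 t" "x2 t"] abs_inner_le[of "x3 t" "x4 t"]
    by (auto simp: En_def intro: order_trans)
  have "\<bar>inner (x2 t) (x4 t) + r * inner (x1 t) (x3 t)\<bar> \<le> En t + r * En t"
  proof -
    have "\<bar>r * inner (x1 t) (x3 t)\<bar> \<le> r * En t"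
      using i(2) r by (simp add: abs_mult)
    then show ?thesis
      using i(1) abs_triangle_ineq[of "inner (x2 t) (x4 t)" "r * inner (x1 t) (x3 t)"] by linarith
  qed
  then have a: "\<bar>\<alpha> * (inner (x2 t) (x4 t) + r * inner (x1 t) (x3 t))\<bar> \<le> \<bar>\<alpha>\<bar> * (En t + r * En t)"
    unfolding abs_mult by (rule mult_left_mono) simp
  have "\<bar>\<beta> / s * (inner (x1 t) (x2 t) + inner (x3 t) (x4 t))\<bar> = \<beta> / s * \<bar>inner (x1 t) (x2 t) + inner (x3 t) (x4 t)\<bar>"
    using b s_pos by (simp add: abs_mult)
  also have "\<dots> \<le> \<beta> / s0 * (En t + En t)"
    using b s i(3,4) by (intro mult_mono frac_le) auto
  finally show ?thesis using a unfolding Q_def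
    by (simp add: algebra_simps)
qed

text \<open>Adding a multiple \<open>\<eta> Q\<close> small enough for the damping \<open>- 2 d (norm x2)\<^sup>2\<close> to absorb the \<open>x2\<close> term of
  \<open>Q_rate\<close> gives a function equivalent to the energy that decays at a rate proportional to \<open>\<eta>\<close>.\<close>

lemma En_decay:
  assumes rate: "\<And>t. Q_rate \<beta> t \<le> K * (1 + (r\<^sup>2 - 1)\<^sup>2 * s\<^sup>2) * (norm (x2 t))\<^sup>2 - m * En t"
    and q: "\<And>t. \<bar>Q \<beta> t\<bar> \<le> q * En t"
    and \<eta>: "0 < \<eta>" "\<eta> * (K * (1 + (r\<^sup>2 - 1)\<^sup>2 * s\<^sup>2)) \<le> d" "\<eta> * q \<le> 1 / 2"
    and m: "0 < m" and t: "0 \<le> t"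
  shows "En t \<le> 3 * exp (- (2 / 3 * m * \<eta> * t)) * En 0"
proof -
  define P where "P = (\<lambda>t. En t + \<eta> * Q \<beta> t)"
  define w where "w = 2 / 3 * m * \<eta>"
  have "0 < w" using m \<eta> by (simp add: w_def)
  have \<eta>Q: "\<bar>\<eta> * Q \<beta> u\<bar> \<le> 1 / 2 * En u" for u
  proof -
    have "\<bar>\<eta> * Q \<beta> u\<bar> \<le> \<eta> * (q * En u)"
      using q[of u] \<eta>(1) by (simp add: abs_mult)
    also have "\<dots> \<le> 1 / 2 * En u"
      using mult_right_mono[OF \<eta>(3) En_nonneg[of u]] by (simp add: mult.assoc)
    finally show ?thesis .
  qed
  then have P: "1 / 2 * En u \<le> P u" "P u \<le> 3 / 2 * En u" for u
    unfolding P_def using \<eta>Q[of u] by linarith+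
  have "P t * exp (w * t) \<le> P 0 * exp (w * 0)"
  proof (rule DERIV_nonpos_imp_nonincreasing[OF t, of "\<lambda>t. P t * exp (w * t)"])
    fix u assume "0 \<le> u" "u \<le> t"
    let ?p = "- 2 * d * (norm (x2 u))\<^sup>2 + \<eta> * Q_rate \<beta> u"
    have P': "(P has_real_derivative ?p) (at u)"
      unfolding P_def by (rule derivative_eq_intros En' Q' refl)+ simp
    have "((\<lambda>t. P t * exp (w * t)) has_real_derivative (?p + w * P u) * exp (w * u)) (at u)"
      by (rule derivative_eq_intros P' refl)+ (simp add: algebra_simps)
    moreover have "?p + w * P u \<le> 0"
    proof -
      have "\<eta> * Q_rate \<beta> u \<le> \<eta> * (K * (1 + (r\<^sup>2 - 1)\<^sup>2 * s\<^sup>2) * (norm (x2 u))\<^sup>2 - m * En u)"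
        using rate[of u] \<eta>(1) by (intro mult_left_mono) auto
      also have "\<dots> \<le> d * (norm (x2 u))\<^sup>2 - \<eta> * m * En u"
        using mult_right_mono[OF \<eta>(2), of "(norm (x2 u))\<^sup>2"] by (simp add: algebra_simps)
      finally have 1: "\<eta> * Q_rate \<beta> u \<le> d * (norm (x2 u))\<^sup>2 - \<eta> * m * En u" .
      have 2: "w * P u \<le> \<eta> * m * En u"
        using mult_left_mono[OF P(2)[of u], of w] \<open>0 < w\<close> by (simp add: w_def algebra_simps)
      have 3: "0 \<le> d * (norm (x2 u))\<^sup>2" using d_pos by simp
      show ?thesis using 1 2 3 by linarith
    qed
    ultimately show "\<exists>y. ((\<lambda>t. P t * exp (w * t)) has_real_derivative y) (at u) \<and> y \<le> 0"
      by (intro exI[of _ "(?p + w * P u) * exp (w * u)"] conjI mult_nonpos_nonneg) auto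
  qed
  then have "P t \<le> P 0 * exp (- (w * t))"
    by (simp add: exp_minus field_simps)
  also have "\<dots> \<le> 3 / 2 * En 0 * exp (- (w * t))"
    using P(2)[of 0] by (intro mult_right_mono) auto
  finally have "1 / 2 * En t \<le> 3 / 2 * En 0 * exp (- (w * t))"
    using P(1)[of t] by linarith
  then show ?thesis by (simp add: w_def mult_ac)
qed

end

section \<open>Decay of the modes, uniformly in the eigenvalue\<close>

lemma mode_solution_op_exp:
  fixes r s d \<alpha> :: real and x :: "'h \<times> 'h \<times> 'h \<times> 'h::{real_inner,banach}"
  assumes "0 < s" "0 < d"
  defines "X \<equiv> \<lambda>t. op_exp (mode_op r s d \<alpha>) t x"
  shows "mode_solution r s d \<alpha> (\<lambda>t. fst (X t)) (\<lambda>t. fst (snd (X t))) (\<lambda>t. fst (snd (snd (X t)))) (\<lambda>t. snd (snd (snd (X t))))"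
proof
  have X: "(X has_vector_derivative mode_op r s d \<alpha> (X t)) (at t)" for t
    unfolding X_def by (rule op_exp_has_vector_derivative[OF bounded_linear_mode_op])
  note X1 = bounded_linear.has_vector_derivative[OF bounded_linear_fst X]
  note XS = bounded_linear.has_vector_derivative[OF bounded_linear_snd X]
  note X2 = bounded_linear.has_vector_derivative[OF bounded_linear_fst XS]
  note XSS = bounded_linear.has_vector_derivative[OF bounded_linear_snd XS]
  note X3 = bounded_linear.has_vector_derivative[OF bounded_linear_fst XSS]
  note X4 = bounded_linear.has_vector_derivative[OF bounded_linear_snd XSS]
  fix t
  show "((\<lambda>t. fst (X t)) has_vector_derivative (r * s) *\<^sub>R fst (snd (X t))) (at t)"
    using X1[of t] by (simp add: mode_op_def case_prod_beta)
  show "((\<lambda>t. fst (snd (X t))) has_vector_derivative - ((r * s) *\<^sub>R fst (X t)) - d *\<^sub>R fst (snd (X t))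
      - \<alpha> *\<^sub>R snd (snd (snd (X t)))) (at t)"
    using X2[of t] by (simp add: mode_op_def case_prod_beta)
  show "((\<lambda>t. fst (snd (snd (X t)))) has_vector_derivative s *\<^sub>R snd (snd (snd (X t)))) (at t)"
    using X3[of t] by (simp add: mode_op_def case_prod_beta)
  show "((\<lambda>t. snd (snd (snd (X t)))) has_vector_derivative - (s *\<^sub>R fst (snd (snd (X t)))) + \<alpha> *\<^sub>R fst (snd (X t))) (at t)"
    using X4[of t] by (simp add: mode_op_def case_prod_beta)
qed (use assms in auto)

text \<open>The constants depend on the frequency \<open>s\<close> and the damping \<open>d\<close> only through a lower bound for \<open>s\<close> and an upper
  bound for \<open>d\<close>; the two conditions on \<open>\<eta>\<close> determine the decay rate.\<close>

lemma mode_decay: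
  fixes r s0 d1 \<alpha> :: real
  assumes r: "0 < r" and s0: "0 < s0" and \<alpha>: "\<alpha> \<noteq> 0"
  obtains C \<omega> where "0 < C" "0 < \<omega>"
    "\<And>s d \<eta> t (x :: 'h \<times> 'h \<times> 'h \<times> 'h::{real_inner,banach}).
      s0 \<le> s \<Longrightarrow> 0 < d \<Longrightarrow> d \<le> d1 \<Longrightarrow> 0 < \<eta> \<Longrightarrow> \<eta> * (C * (1 + (r\<^sup>2 - 1)\<^sup>2 * s\<^sup>2)) \<le> d \<Longrightarrow> \<eta> * C \<le> 1 / 2
      \<Longrightarrow> 0 \<le> t \<Longrightarrow> (norm (op_exp (mode_op r s d \<alpha>) t x))\<^sup>2 \<le> 3 * exp (- (\<omega> * \<eta> * t)) * (norm x)\<^sup>2"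
proof -
  define \<beta> where "\<beta> = min (\<alpha>\<^sup>2 / 4) (r * s0\<^sup>2 / 4)"
  define m where "m = min (\<alpha>\<^sup>2 / 4) (min (\<beta> * r / 2) (\<beta> / 2))"
  define K where "K = \<alpha>\<^sup>2 + \<beta> * r + d1\<^sup>2 + \<beta> * \<alpha>\<^sup>2 / s0\<^sup>2 + \<beta> * d1\<^sup>2 / (r * s0\<^sup>2) + \<alpha>\<^sup>2 / \<beta> + m"
  define q where "q = \<bar>\<alpha>\<bar> * (1 + r) + 2 * \<beta> / s0"
  have \<beta>: "0 < \<beta>" "\<beta> \<le> \<alpha>\<^sup>2 / 4" "\<beta> \<le> r * s0\<^sup>2 / 4" using r s0 \<alpha> by (auto simp: \<beta>_def)
  have m: "0 < m" "m \<le> \<alpha>\<^sup>2 / 4" "m \<le> \<beta> * r / 2" "m \<le> \<beta> / 2" using r \<alpha> \<beta>(1) by (auto simp: m_def)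
  have q: "0 < q" using r s0 \<alpha> \<beta>(1) by (simp add: q_def add_pos_pos)
  show ?thesis
  proof (rule that[of "max K q" "2 / 3 * m"])
    show "0 < max K q" using q by simp
    show "0 < 2 / 3 * m" using m by simp
    fix s d \<eta> t :: real and x :: "'h \<times> 'h \<times> 'h \<times> 'h"
    assume a: "s0 \<le> s" "0 < d" "d \<le> d1" "0 < \<eta>" "\<eta> * (max K q * (1 + (r\<^sup>2 - 1)\<^sup>2 * s\<^sup>2)) \<le> d"
      "\<eta> * max K q \<le> 1 / 2" "0 \<le> t"
    define X where "X = (\<lambda>t. op_exp (mode_op r s d \<alpha>) t x)"
    interpret mode_solution r s d \<alpha> "\<lambda>t. fst (X t)" "\<lambda>t. fst (snd (X t))" "\<lambda>t. fst (snd (snd (X t)))" "\<lambda>t. snd (snd (snd (X t)))"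
      unfolding X_def by (rule mode_solution_op_exp) (use a s0 in auto)
    have En: "En t = (norm (X t))\<^sup>2" for t
      using norm4[of "fst (X t)" "fst (snd (X t))" "fst (snd (snd (X t)))" "snd (snd (snd (X t)))"]
      by (simp add: En_def)
    have "En t \<le> 3 * exp (- (2 / 3 * m * \<eta> * t)) * En 0"
    proof (rule En_decay[where \<beta> = \<beta> and K = K and q = q])
      show "Q_rate \<beta> t \<le> K * (1 + (r\<^sup>2 - 1)\<^sup>2 * s\<^sup>2) * (norm (fst (snd (X t))))\<^sup>2 - m * En t" for t
        by (rule Q_rate_le[OF r s0 a(1) a(3) \<beta> m(2-4)]) (use m(1) in \<open>auto simp: K_def\<close>)
      show "\<bar>Q \<beta> t\<bar> \<le> q * En t" for t
        unfolding q_def by (rule Q_abs_le[OF r s0 a(1) \<beta>(1)])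
      have "K * (1 + (r\<^sup>2 - 1)\<^sup>2 * s\<^sup>2) \<le> max K q * (1 + (r\<^sup>2 - 1)\<^sup>2 * s\<^sup>2)"
        by (intro mult_right_mono) auto
      then have "\<eta> * (K * (1 + (r\<^sup>2 - 1)\<^sup>2 * s\<^sup>2)) \<le> \<eta> * (max K q * (1 + (r\<^sup>2 - 1)\<^sup>2 * s\<^sup>2))"
        using a(4) by simp
      then show "\<eta> * (K * (1 + (r\<^sup>2 - 1)\<^sup>2 * s\<^sup>2)) \<le> d" using a(5) by linarith
      have "\<eta> * q \<le> \<eta> * max K q" using a(4) by simp
      then show "\<eta> * q \<le> 1 / 2" using a(6) by linarith
    qed (use a m in auto)
    then show "(norm (op_exp (mode_op r s d \<alpha>) t x))\<^sup>2 \<le> 3 * exp (- (2 / 3 * m * \<eta> * t)) * (norm x)\<^sup>2"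
      by (simp only: En) (simp add: X_def op_exp_0)
  qed
qed

text \<open>The skew part of order \<open>s\<close> is invertible; solving for the components one after the other, velocities first,
  keeps the terms of lower order under control.\<close>

lemma mode_op_bounded_below:
  fixes r s0 d1 \<alpha> :: real
  assumes r: "0 < r" and s0: "0 < s0"
  obtains k where "0 < k"
    "\<And>s d (x :: 'h \<times> 'h \<times> 'h \<times> 'h::real_inner). s0 \<le> s \<Longrightarrow> 0 < d \<Longrightarrow> d \<le> d1 \<Longrightarrow>
      s\<^sup>2 * (norm x)\<^sup>2 \<le> k * (norm (mode_op r s d \<alpha> x))\<^sup>2"
proof -
  define k1 k2 k3 where "k1 = (1 + d1 / (r * s0) + \<bar>\<alpha>\<bar> / s0) / r" and "k2 = 1 / r" and "k3 = 1 + \<bar>\<alpha>\<bar> / (r * s0)"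
  define k where "k = k1\<^sup>2 + k2\<^sup>2 + k3\<^sup>2 + 1"
  have "s\<^sup>2 * (norm x)\<^sup>2 \<le> k * (norm (mode_op r s d \<alpha> x))\<^sup>2"
    if s: "s0 \<le> s" and d: "0 < d" "d \<le> d1" for s d and x :: "'h \<times> 'h \<times> 'h \<times> 'h"
  proof -
    obtain x1 x2 x3 x4 where x: "x = (x1, x2, x3, x4)" by (cases x) auto
    define y1 y2 y3 y4 where "y1 = (r * s) *\<^sub>R x2" and "y2 = - ((r * s) *\<^sub>R x1) - d *\<^sub>R x2 - \<alpha> *\<^sub>R x4"
      and "y3 = s *\<^sub>R x4" and "y4 = - (s *\<^sub>R x3) + \<alpha> *\<^sub>R x2"
    define b where "b = norm (mode_op r s d \<alpha> x)"
    have b2: "b\<^sup>2 = (norm y1)\<^sup>2 + (norm y2)\<^sup>2 + (norm y3)\<^sup>2 + (norm y4)\<^sup>2"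
      unfolding b_def norm4[symmetric] by (simp add: x mode_op_def y1_def y2_def y3_def y4_def)
    have b0: "0 \<le> b" by (simp add: b_def)
    have y: "norm y1 \<le> b" "norm y2 \<le> b" "norm y3 \<le> b" "norm y4 \<le> b"
      by (rule power2_le_imp_le; simp add: b2 b0)+
    have sp: "0 < s" "0 < r * s" using s s0 r by auto
    have x2: "norm x2 \<le> b / (r * s)" using y(1) sp r by (simp add: y1_def field_simps)
    have x4: "norm x4 \<le> b / s" using y(3) sp by (simp add: y3_def field_simps)
    have x2': "norm x2 \<le> b / (r * s0)"
      using x2 divide_left_mono[of "r * s0" "r * s" b] s s0 r b0 by (smt (verit) mult_left_mono mult_pos_pos)
    have x4': "norm x4 \<le> b / s0"
      using x4 divide_left_mono[of s0 s b] s s0 b0 by (smt (verit) mult_pos_pos)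
    have X4: "s * norm x4 \<le> b" using y(3) sp by (simp add: y3_def)
    have X2: "s * norm x2 \<le> k2 * b" using y(1) sp r by (simp add: y1_def k2_def field_simps)
    have X3: "s * norm x3 \<le> k3 * b"
    proof -
      have "s *\<^sub>R x3 = \<alpha> *\<^sub>R x2 - y4" by (simp add: y4_def)
      then have "norm (s *\<^sub>R x3) \<le> norm (\<alpha> *\<^sub>R x2) + norm y4" by (metis norm_triangle_ineq4)
      also have "\<dots> \<le> \<bar>\<alpha>\<bar> * (b / (r * s0)) + b" unfolding norm_scaleR using x2' y(4) by (intro add_mono mult_left_mono) auto
      finally show ?thesis using sp by (simp add: k3_def algebra_simps)
    qed
    have X1: "s * norm x1 \<le> k1 * b"
    proof -
      have "(r * s) *\<^sub>R x1 = - (d *\<^sub>R x2) - \<alpha> *\<^sub>R x4 - y2" by (simp add: y2_def)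
      then have "norm ((r * s) *\<^sub>R x1) \<le> norm (d *\<^sub>R x2) + norm (\<alpha> *\<^sub>R x4) + norm y2"
        using norm_triangle_ineq4[of "- (d *\<^sub>R x2) - \<alpha> *\<^sub>R x4" y2] norm_triangle_ineq4[of "- (d *\<^sub>R x2)" "\<alpha> *\<^sub>R x4"]
        by simp
      also have "norm (d *\<^sub>R x2) \<le> d1 * (b / (r * s0))"
        using d x2' by (simp add: mult_mono del: times_divide_eq_right)
      also have "norm (\<alpha> *\<^sub>R x4) \<le> \<bar>\<alpha>\<bar> * (b / s0)" using x4' by (simp add: mult_left_mono del: times_divide_eq_right)
      finally have "r * (s * norm x1) \<le> (1 + d1 / (r * s0) + \<bar>\<alpha>\<bar> / s0) * b"
        using sp r y(2) by (simp add: algebra_simps)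
      then show ?thesis using r by (simp add: k1_def field_simps)
    qed
    have "(s * norm x1)\<^sup>2 \<le> (k1 * b)\<^sup>2" "(s * norm x2)\<^sup>2 \<le> (k2 * b)\<^sup>2" "(s * norm x3)\<^sup>2 \<le> (k3 * b)\<^sup>2" "(s * norm x4)\<^sup>2 \<le> b\<^sup>2"
      using X1 X2 X3 X4 sp by (auto intro!: power_mono)
    then have "s\<^sup>2 * (norm x)\<^sup>2 \<le> k * b\<^sup>2"
      by (simp add: x norm4 k_def algebra_simps power_mult_distrib)
    then show ?thesis by (simp add: b_def)
  qed
  moreover have "0 < k" by (simp add: k_def add_nonneg_pos)
  ultimately show ?thesis using that by blast
qed

lemma powr_times_exp_le:
  fixes q w :: real
  assumes "0 < q" "0 < w" "0 < y"
  shows "y powr q * exp (- (w * y)) \<le> (q / w) powr q"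
proof -
  have "ln (w * y / q) \<le> w * y / q" using assms ln_le_minus_one[of "w * y / q"] by simp
  moreover have "ln (w * y / q) = ln y - ln (q / w)" using assms by (simp add: ln_mult ln_div)
  ultimately have "q * ln y \<le> w * y + q * ln (q / w)"
    using assms by (simp add: field_simps)
  then have "exp (q * ln y + - (w * y)) \<le> exp (q * ln (q / w))" by simp
  then show ?thesis using assms by (simp add: powr_def exp_add[symmetric])
qed

text \<open>The mode of the eigenvalue \<open>l\<close> decays at a rate proportional to \<open>l powr (- p)\<close>, where \<open>p\<close> is this exponent.\<close>

definition damping_exponent :: "real \<Rightarrow> real \<Rightarrow> real" where
  "damping_exponent a \<gamma> = (if a = 1 then - \<gamma> else 1 - \<gamma>)"

abbreviation eigenmode_op :: "real \<Rightarrow> real \<Rightarrow> real \<Rightarrow> real \<Rightarrow> 'h \<times> 'h \<times> 'h \<times> 'h \<Rightarrow> 'h \<times> 'h \<times> 'h \<times> 'h::real_inner" where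
  "eigenmode_op r \<gamma> \<alpha> l \<equiv> mode_op r (sqrt l) (l powr \<gamma>) \<alpha>"

lemma decay_rate_eq: "decay_rate a \<gamma> = 1 / damping_exponent a \<gamma>"
  by (simp add: decay_rate_def damping_exponent_def divide_minus_left[symmetric] del: divide_minus_left)

text \<open>With \<open>\<eta> = \<kappa> * l powr (- p)\<close> the conditions of the decay estimate hold for all \<open>l \<ge> c\<close>.  Writing
  \<open>y = t * l powr (- p)\<close>, the factor \<open>1 / l\<close> gained from the lower bound for \<open>mode_op\<close> is
  \<open>(y / t) powr (1 / p)\<close>, and \<open>y powr (1 / p) * exp (- (w * y))\<close> is bounded.\<close>

lemma uniform_mode_decay:
  fixes r c \<gamma> \<alpha> :: real
  assumes r: "0 < r" and c: "0 < c" and \<alpha>: "\<alpha> \<noteq> 0" and \<gamma>: "\<gamma> \<le> 0"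
    and p: "0 < damping_exponent (r\<^sup>2) \<gamma>"
  obtains C where "0 < C" "\<And>l t (x :: 'h \<times> 'h \<times> 'h \<times> 'h::{real_inner,banach}). c \<le> l \<Longrightarrow> 0 < t \<Longrightarrow>
    (norm (op_exp (eigenmode_op r \<gamma> \<alpha> l) t x))\<^sup>2
      \<le> C / t powr decay_rate (r\<^sup>2) \<gamma> * (norm (eigenmode_op r \<gamma> \<alpha> l x))\<^sup>2"
proof -
  define p where "p = damping_exponent (r\<^sup>2) \<gamma>"
  have p: "0 < p" using assms(5) by (simp add: p_def)
  have s0: "0 < sqrt c" using c by simp
  obtain C \<omega> where C: "0 < C" "0 < \<omega>"
    "\<And>s d \<eta> t (x :: 'h \<times> 'h \<times> 'h \<times> 'h).
      sqrt c \<le> s \<Longrightarrow> 0 < d \<Longrightarrow> d \<le> c powr \<gamma> \<Longrightarrow> 0 < \<eta> \<Longrightarrow> \<eta> * (C * (1 + (r\<^sup>2 - 1)\<^sup>2 * s\<^sup>2)) \<le> d \<Longrightarrow> \<eta> * C \<le> 1 / 2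
      \<Longrightarrow> 0 \<le> t \<Longrightarrow> (norm (op_exp (mode_op r s d \<alpha>) t x))\<^sup>2 \<le> 3 * exp (- (\<omega> * \<eta> * t)) * (norm x)\<^sup>2"
    by (rule mode_decay[OF r s0 \<alpha>]) blast
  obtain k where k: "0 < k"
    "\<And>s d (x :: 'h \<times> 'h \<times> 'h \<times> 'h). sqrt c \<le> s \<Longrightarrow> 0 < d \<Longrightarrow> d \<le> c powr \<gamma> \<Longrightarrow>
      s\<^sup>2 * (norm x)\<^sup>2 \<le> k * (norm (mode_op r s d \<alpha> x))\<^sup>2"
    by (rule mode_op_bounded_below[OF r s0]) blast
  \<comment> \<open>A bound for the left-hand side of the first condition on the rate, divided by the damping and the constant factors.\<close>
  define D where "D = 1 / c + (r\<^sup>2 - 1)\<^sup>2 + 1"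
  have D: "0 < D" using c by (simp add: D_def add_pos_nonneg)
  define \<kappa> where "\<kappa> = min (1 / (C * D)) (c powr p / (2 * C))"
  have \<kappa>: "0 < \<kappa>" using C(1) D c by (simp add: \<kappa>_def)
  define w where "w = \<omega> * \<kappa>"
  have w: "0 < w" using C \<kappa> by (simp add: w_def)
  define M where "M = 3 * k * ((1 / p) / w) powr (1 / p)"
  have M: "0 < M" using k p w by (simp add: M_def)
  show ?thesis
  proof (rule that[OF M])
    fix l t :: real and x :: "'h \<times> 'h \<times> 'h \<times> 'h"
    assume l: "c \<le> l" and t: "0 < t"
    have l0: "0 < l" using l c by simp
    define d where "d = l powr \<gamma>"
    define \<eta> where "\<eta> = \<kappa> * l powr (- p)"
    have d: "0 < d" "d \<le> c powr \<gamma>" using l l0 c \<gamma> by (auto simp: d_def intro: powr_mono2')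
    have s: "sqrt c \<le> sqrt l" "(sqrt l)\<^sup>2 = l" using l l0 by auto
    have \<eta>: "0 < \<eta>" using \<kappa> l0 by (simp add: \<eta>_def)
    have "l powr (- p) * (1 + (r\<^sup>2 - 1)\<^sup>2 * l) \<le> D * d"
    proof (cases "r\<^sup>2 = 1")
      case True
      then have "p = - \<gamma>" by (simp add: p_def damping_exponent_def)
      then have "l powr (- p) * (1 + (r\<^sup>2 - 1)\<^sup>2 * l) = 1 * d" using True by (simp add: d_def)
      also have "\<dots> \<le> D * d" using d c by (intro mult_right_mono) (auto simp: D_def)
      finally show ?thesis .
    next
      case False
      then have "l powr (- p) = d / l" using l0
        by (simp add: p_def damping_exponent_def d_def powr_diff)
      then have "l powr (- p) * (1 + (r\<^sup>2 - 1)\<^sup>2 * l) = (1 / l + (r\<^sup>2 - 1)\<^sup>2) * d"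
        using l0 by (simp add: field_simps)
      also have "\<dots> \<le> D * d"
        using d l c l0 frac_le[of 1 1 c l] by (intro mult_right_mono) (auto simp: D_def)
      finally show ?thesis .
    qed
    then have "\<kappa> * C * (l powr (- p) * (1 + (r\<^sup>2 - 1)\<^sup>2 * l)) \<le> \<kappa> * C * (D * d)"
      using \<kappa> C(1) by simp
    also have "\<dots> = (\<kappa> * (C * D)) * d" by simp
    also have "\<dots> \<le> 1 * d"
    proof (rule mult_right_mono)
      have "\<kappa> \<le> 1 / (C * D)" by (simp add: \<kappa>_def)
      then show "\<kappa> * (C * D) \<le> 1" using C(1) D by (simp add: pos_le_divide_eq)
    qed (use d in simp)
    finally have \<eta>1: "\<eta> * (C * (1 + (r\<^sup>2 - 1)\<^sup>2 * (sqrt l)\<^sup>2)) \<le> d"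
      using s by (simp add: \<eta>_def mult_ac)
    have \<eta>2: "\<eta> * C \<le> 1 / 2"
    proof -
      have "\<eta> * C \<le> c powr p / (2 * C) * c powr (- p) * C"
        unfolding \<eta>_def using l c p C(1) \<kappa> by (intro mult_right_mono mult_mono powr_mono2') (auto simp: \<kappa>_def)
      also have "\<dots> = 1 / 2" using C(1) c by (simp add: powr_minus)
      finally show ?thesis .
    qed
    have b: "l * (norm x)\<^sup>2 \<le> k * (norm (mode_op r (sqrt l) d \<alpha> x))\<^sup>2"
      using k(2)[OF s(1) d] s(2) by simp
    define y where "y = l powr (- p) * t"
    have y: "0 < y" using l0 t by (simp add: y_def)
    have "y powr (1 / p) = t powr (1 / p) / l"
    proof -
      have "(l powr (- p)) powr (1 / p) = l powr (- 1)" using p by (simp only: powr_powr) simp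
      also have "\<dots> = 1 / l" using l0 by (simp add: powr_minus_divide)
      finally show ?thesis using l0 t by (simp add: y_def powr_mult)
    qed
    then have "t powr (1 / p) / l * exp (- (w * y)) \<le> ((1 / p) / w) powr (1 / p)"
      using powr_times_exp_le[of "1 / p" w y] p w y by simp
    then have e: "exp (- (w * y)) \<le> ((1 / p) / w) powr (1 / p) / t powr (1 / p) * l"
      using l0 t by (simp add: field_simps)
    have "(norm (op_exp (mode_op r (sqrt l) d \<alpha>) t x))\<^sup>2 \<le> 3 * exp (- (w * y)) * (norm x)\<^sup>2"
      using C(3)[OF s(1) d \<eta> \<eta>1 \<eta>2, of t x] t by (simp add: w_def y_def \<eta>_def mult_ac)
    also have "\<dots> \<le> 3 * (((1 / p) / w) powr (1 / p) / t powr (1 / p) * l) * (norm x)\<^sup>2"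
      using e by (intro mult_right_mono mult_left_mono) auto
    also have "\<dots> = 3 * (((1 / p) / w) powr (1 / p) / t powr (1 / p)) * (l * (norm x)\<^sup>2)"
      by simp
    also have "\<dots> \<le> 3 * (((1 / p) / w) powr (1 / p) / t powr (1 / p)) * (k * (norm (mode_op r (sqrt l) d \<alpha> x))\<^sup>2)"
      using b by (intro mult_left_mono) auto
    also have "\<dots> = M / t powr (1 / p) * (norm (mode_op r (sqrt l) d \<alpha> x))\<^sup>2"
      by (simp add: M_def)
    finally show "(norm (op_exp (eigenmode_op r \<gamma> \<alpha> l) t x))\<^sup>2
      \<le> M / t powr decay_rate (r\<^sup>2) \<gamma> * (norm (eigenmode_op r \<gamma> \<alpha> l x))\<^sup>2"
      by (simp add: d_def decay_rate_eq p_def)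
  qed
qed

text \<open>At resonance the damping cannot remove energy faster than at the rate \<open>2 d\<close>; off resonance the bound for
  detuned oscillators applies, and \<open>L\<close> makes its initial loss, which is of order \<open>1 / s\<close>, at most \<open>1 / 4\<close>.\<close>

lemma slow_modes:
  fixes r \<gamma> \<alpha> :: real
  assumes r: "0 < r"
  obtains \<kappa> L where "0 < \<kappa>" "0 < L"
    "\<And>l (e :: 'h::{real_inner,banach}). L \<le> l \<Longrightarrow>
      (norm e)\<^sup>2 / 2 \<le> (norm (op_exp (eigenmode_op r \<gamma> \<alpha> l) (\<kappa> * l powr damping_exponent (r\<^sup>2) \<gamma>) (0, 0, 0, e)))\<^sup>2"
proof -
  define k where "k = 2 * \<alpha> / (r\<^sup>2 - 1)"
  define q where "q = 2 * \<bar>k\<bar> * (r + 1 + \<bar>\<alpha>\<bar>)"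
  define \<kappa> where "\<kappa> = 1 / (4 + 2 * k\<^sup>2)"
  define L where "L = max 1 ((4 * q)\<^sup>2)"
  have \<kappa>: "0 < \<kappa>" "\<kappa> \<le> 1 / 4" "\<kappa> * k\<^sup>2 \<le> 1 / 2"
    by (auto simp: \<kappa>_def add_pos_nonneg field_simps)
  have q: "0 \<le> q" using r by (simp add: q_def)
  show ?thesis
  proof (rule that[of \<kappa> L])
    show "0 < \<kappa>" "0 < L" using \<kappa> by (auto simp: L_def)
    fix l and e :: 'h
    assume l: "L \<le> l"
    have l1: "1 \<le> l" "0 < l" using l by (auto simp: L_def)
    define s d t where "s = sqrt l" and "d = l powr \<gamma>" and "t = \<kappa> * l powr damping_exponent (r\<^sup>2) \<gamma>"
    have s: "1 \<le> s" "0 < s" "s\<^sup>2 = l" using l1 by (auto simp: s_def)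
    have d: "0 < d" using l1 by (simp add: d_def)
    have t: "0 \<le> t" using \<kappa> by (simp add: t_def)
    define X where "X = (\<lambda>t. op_exp (mode_op r s d \<alpha>) t (0, 0, 0, e))"
    interpret mode_solution r s d \<alpha> "\<lambda>t. fst (X t)" "\<lambda>t. fst (snd (X t))" "\<lambda>t. fst (snd (snd (X t)))" "\<lambda>t. snd (snd (snd (X t)))"
      unfolding X_def by (rule mode_solution_op_exp) (use s d in auto)
    have En: "En t = (norm (X t))\<^sup>2" for t
      using norm4[of "fst (X t)" "fst (snd (X t))" "fst (snd (snd (X t)))" "snd (snd (snd (X t)))"]
      by (simp add: En_def)
    have X0: "X 0 = (0, 0, 0, e)" by (simp add: X_def op_exp_0)
    then have En0: "En 0 = (norm e)\<^sup>2" by (simp add: En norm4)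
    have "1 / 2 * En 0 \<le> En t"
    proof (cases "r\<^sup>2 = 1")
      case True
      have "d * t = \<kappa>" using l1 True by (simp add: t_def d_def damping_exponent_def powr_minus)
      then have "1 / 2 \<le> 1 - 2 * d * t" using \<kappa> by simp
      then have "1 / 2 * En 0 \<le> (1 - 2 * d * t) * En 0" using En_nonneg by (intro mult_right_mono)
      also have "\<dots> \<le> En t" by (rule En_lower_damping[OF t])
      finally show ?thesis .
    next
      case False
      have "d * t = \<kappa> * l" using l1 False
        by (simp add: t_def d_def damping_exponent_def powr_diff)
      define k' where "k' = 2 * \<alpha> / ((r\<^sup>2 - 1) * s)"
      have k': "k' = k / s" by (simp add: k'_def k_def)
      have "k'\<^sup>2 / 2 * d * t = k\<^sup>2 / s\<^sup>2 / 2 * (d * t)" by (simp add: k' power_divide)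
      also have "\<dots> = \<kappa> * k\<^sup>2 / 2" using l1 \<open>d * t = \<kappa> * l\<close> s by simp
      finally have 1: "k'\<^sup>2 / 2 * d * t \<le> 1 / 4" using \<kappa> by simp
      have "2 * \<bar>k'\<bar> * (r + 1 + \<bar>\<alpha>\<bar> / s) \<le> 2 * \<bar>k'\<bar> * (r + 1 + \<bar>\<alpha>\<bar>)"
        using s by (intro mult_left_mono add_left_mono) (auto simp: divide_le_eq mult_le_cancel_left1)
      also have "\<dots> = q / s" using s by (simp add: k' q_def)
      also have "\<dots> \<le> 1 / 4"
      proof -
        have "(4 * q)\<^sup>2 \<le> s\<^sup>2" using l s by (simp add: L_def)
        then have "4 * q \<le> s" by (rule power2_le_imp_le) (use s in simp)
        then show ?thesis using s by (simp add: divide_le_eq)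
      qed
      finally have 2: "2 * \<bar>k'\<bar> * (r + 1 + \<bar>\<alpha>\<bar> / s) \<le> 1 / 4" .
      have "1 / 2 \<le> 1 - 2 * \<bar>k'\<bar> * (r + 1 + \<bar>\<alpha>\<bar> / s) - k'\<^sup>2 / 2 * d * t" using 1 2 by linarith
      then have "1 / 2 * En 0 \<le> (1 - 2 * \<bar>k'\<bar> * (r + 1 + \<bar>\<alpha>\<bar> / s) - k'\<^sup>2 / 2 * d * t) * En 0"
        using En_nonneg by (rule mult_right_mono)
      also have "\<dots> \<le> En t"
        unfolding k'_def by (rule En_lower_detuned[OF t False r]) (simp_all add: X0)
      finally show ?thesis .
    qed
    then have "(norm e)\<^sup>2 / 2 \<le> (norm (X t))\<^sup>2" by (simp only: En X0) (simp add: norm4)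
    then show "(norm e)\<^sup>2 / 2 \<le> (norm (op_exp (eigenmode_op r \<gamma> \<alpha> l) (\<kappa> * l powr damping_exponent (r\<^sup>2) \<gamma>) (0, 0, 0, e)))\<^sup>2"
      by (simp only: X_def s_def d_def t_def)
  qed
qed

section \<open>The coupled system as a diagonal semigroup\<close>

context coercive_operator
begin

text \<open>The scaling turns the squared energy norm into the sum of the squared norms of the coordinates.\<close>

definition coord :: "real \<Rightarrow> real \<Rightarrow> 'h \<times> 'h \<times> 'h \<times> 'h \<Rightarrow> 'h \<times> 'h \<times> 'h \<times> 'h" where
  "coord a l = (\<lambda>(u, v, y, z). (sqrt (a * l) *\<^sub>R P l u, P l v, sqrt l *\<^sub>R P l y, P l z))"

lemma calculus_norm_has_sum:
  assumes "x \<in> pow_dom D A (1/2)"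
  shows "((\<lambda>l. l * (norm (P l x))\<^sup>2) has_sum (norm (pow D A (1/2) x))\<^sup>2) S"
  using parseval[of "pow D A (1/2) x"]
  by (rule has_sum_cong[THEN iffD1, rotated])
    (simp add: P_pow_half assms power_mult_distrib less_imp_le[OF S_pos])

lemma norm_coord: "a > 0 \<Longrightarrow> l \<in> S \<Longrightarrow> (norm (coord a l (u, v, y, z)))\<^sup>2
    = a * (l * (norm (P l u))\<^sup>2) + (norm (P l v))\<^sup>2 + l * (norm (P l y))\<^sup>2 + (norm (P l z))\<^sup>2"
  using S_pos[of l] by (simp add: coord_def norm4 power_mult_distrib)

lemma zero_in_E: "0 \<in> E l"
  by (rule subspace_0[OF real_subspace_E])

text \<open>Parseval's identity computes the norm, and synthesis of vectors from their eigencomponents gives all square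
  summable families as coordinates; the first and third component must be divided by square roots of the
  eigenvalues, which are bounded away from \<open>0\<close>.\<close>

lemma fibred_energy_space:
  assumes a: "a > 0"
  shows "fibred_space (energy_space D A) (energy_norm D A a) S (coord a) (\<lambda>l. E l \<times> E l \<times> E l \<times> E l)"
proof (rule fibred_space.intro)
  show "module.subspace (*\<^sub>C) (energy_space D A)"
  proof -
    have half: "module.subspace (*\<^sub>C) (pow_dom D A (1/2))"
      unfolding module.subspace_def[OF module_scaleC]
    proof (intro conjI ballI allI)
      have "P l 0 = 0" if "l \<in> S" for l by (rule P_E[OF zero_in_E])
      then show "0 \<in> pow_dom D A (1/2)" by (simp add: pow_dom_half_iff cong: summable_on_cong)
    next
      fix x y assume xy: "x \<in> pow_dom D A (1/2)" "y \<in> pow_dom D A (1/2)"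
      have "(\<lambda>l. 2 * (l * (norm (P l x))\<^sup>2) + 2 * (l * (norm (P l y))\<^sup>2)) summable_on S"
        using xy by (intro summable_on_add summable_on_cmult_right) (simp_all add: pow_dom_half_iff)
      then show "x + y \<in> pow_dom D A (1/2)"
        unfolding pow_dom_half_iff
      proof (rule summable_on_comparison_test)
        fix l assume l: "l \<in> S"
        have "(norm (P l (x + y)))\<^sup>2 \<le> 2 * (norm (P l x))\<^sup>2 + 2 * (norm (P l y))\<^sup>2"
          unfolding P_add[OF l] by (rule norm_add_square_le)
        then have "l * (norm (P l (x + y)))\<^sup>2 \<le> l * (2 * (norm (P l x))\<^sup>2 + 2 * (norm (P l y))\<^sup>2)"
          using S_pos[OF l] by (intro mult_left_mono) auto
        then show "l * (norm (P l (x + y)))\<^sup>2 \<le> 2 * (l * (norm (P l x))\<^sup>2) + 2 * (l * (norm (P l y))\<^sup>2)"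
          by (simp add: algebra_simps)
        show "0 \<le> l * (norm (P l (x + y)))\<^sup>2" using S_pos[OF l] by simp
      qed
    next
      fix k x assume x: "x \<in> pow_dom D A (1/2)"
      have "(\<lambda>l. (cmod k)\<^sup>2 * (l * (norm (P l x))\<^sup>2)) summable_on S"
        using x by (intro summable_on_cmult_right) (simp add: pow_dom_half_iff)
      then show "k *\<^sub>C x \<in> pow_dom D A (1/2)"
        unfolding pow_dom_half_iff
        by (rule summable_on_cong[THEN iffD1, rotated])
          (simp add: P_scaleC norm_scaleC power_mult_distrib)
    qed
    then show ?thesis
      unfolding module.subspace_def[OF module_scaleC] energy_space_def
      by (auto simp: scaleC_prod_def zero_prod_def)
  qed
  show "coord a l (x + y) = coord a l x + coord a l y" if "l \<in> S" for l x y
    using that by (auto simp: coord_def P_add scaleR_add_right split: prod.splits)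
  show "coord a l (k *\<^sub>C x) = k *\<^sub>C coord a l x" if "l \<in> S" for l k x
    using that by (auto simp: coord_def P_scaleC scaleC_prod_def scaleR_scaleC scaleC_scaleC mult.commute split: prod.splits)
  show "coord a l x \<in> E l \<times> E l \<times> E l \<times> E l" if "l \<in> S" for l x
    using that by (auto simp: coord_def split: prod.splits intro!: subspace_scale[OF real_subspace_E] P_in_E)
  show "0 \<le> energy_norm D A a x" for x
    using a by (cases x) auto
  show "((\<lambda>l. (norm (coord a l x))\<^sup>2) has_sum (energy_norm D A a x)\<^sup>2) S" if x: "x \<in> energy_space D A" for x
  proof -
    obtain u v y z where xe: "x = (u, v, y, z)" by (cases x) auto
    have m: "u \<in> pow_dom D A (1/2)" "y \<in> pow_dom D A (1/2)" using x by (auto simp: xe energy_space_def)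
    have "((\<lambda>l. a * (l * (norm (P l u))\<^sup>2) + (norm (P l v))\<^sup>2 + l * (norm (P l y))\<^sup>2 + (norm (P l z))\<^sup>2)
        has_sum a * (norm (pow D A (1/2) u))\<^sup>2 + (norm v)\<^sup>2 + (norm (pow D A (1/2) y))\<^sup>2 + (norm z)\<^sup>2) S"
      by (intro has_sum_add has_sum_cmult_right calculus_norm_has_sum m parseval)
    moreover have "a * (norm (pow D A (1/2) u))\<^sup>2 + (norm v)\<^sup>2 + (norm (pow D A (1/2) y))\<^sup>2 + (norm z)\<^sup>2
        = (energy_norm D A a x)\<^sup>2"
      using a by (simp add: xe)
    ultimately show ?thesis
      by (simp only:) (rule has_sum_cong[THEN iffD1, rotated], assumption, simp only: xe norm_coord[OF a])
  qed
  show "x = x'" if "x \<in> energy_space D A" "x' \<in> energy_space D A" "\<And>l. l \<in> S \<Longrightarrow> coord a l x = coord a l x'" for x x'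
  proof -
    obtain u v y z u' v' y' z' where xe: "x = (u, v, y, z)" "x' = (u', v', y', z')"
      by (cases x; cases x') auto
    have "P l u = P l u' \<and> P l v = P l v' \<and> P l y = P l y' \<and> P l z = P l z'" if "l \<in> S" for l
      using \<open>\<And>l. l \<in> S \<Longrightarrow> coord a l x = coord a l x'\<close>[OF that] S_pos[OF that] a
      by (simp add: xe coord_def)
    then have "u = u'" "v = v'" "y = y'" "z = z'" by (blast intro: P_ext)+
    then show ?thesis by (simp add: xe)
  qed
  show "\<exists>x\<in>energy_space D A. \<forall>l\<in>S. coord a l x = g l"
    if g: "\<And>l. l \<in> S \<Longrightarrow> g l \<in> E l \<times> E l \<times> E l \<times> E l" and sq: "(\<lambda>l. (norm (g l))\<^sup>2) summable_on S" for g
  proof -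
    define g1 g2 g3 g4 where "g1 = (\<lambda>l. fst (g l))" and "g2 = (\<lambda>l. fst (snd (g l)))"
      and "g3 = (\<lambda>l. fst (snd (snd (g l))))" and "g4 = (\<lambda>l. snd (snd (snd (g l))))"
    have ge: "g l = (g1 l, g2 l, g3 l, g4 l)" for l by (simp add: g1_def g2_def g3_def g4_def)
    have gE: "g1 l \<in> E l" "g2 l \<in> E l" "g3 l \<in> E l" "g4 l \<in> E l" if "l \<in> S" for l
      using g[OF that] by (auto simp: ge)
    have gs: "(\<lambda>l. (norm (g1 l))\<^sup>2) summable_on S" "(\<lambda>l. (norm (g2 l))\<^sup>2) summable_on S"
        "(\<lambda>l. (norm (g3 l))\<^sup>2) summable_on S" "(\<lambda>l. (norm (g4 l))\<^sup>2) summable_on S"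
      by (rule summable_on_comparison_test[OF sq]; simp add: ge norm4)+
    have div: "\<exists>x. x \<in> pow_dom D A (1/2) \<and> (\<forall>l\<in>S. sqrt (b * l) *\<^sub>R P l x = h l)"
      if b: "0 < b" and h: "\<And>l. l \<in> S \<Longrightarrow> h l \<in> E l" "(\<lambda>l. (norm (h l))\<^sup>2) summable_on S" for b h
    proof -
      have "(\<lambda>l. (norm ((1 / sqrt (b * l)) *\<^sub>R h l))\<^sup>2) summable_on S"
      proof (rule summable_on_comparison_test[OF summable_on_cmult_right[OF h(2), of "1 / (b * c)"]])
        fix l assume l: "l \<in> S"
        have "1 / (b * l) \<le> 1 / (b * c)"
          using b c_pos S_ge[OF l] S_pos[OF l] by (intro divide_left_mono mult_left_mono mult_pos_pos) auto
        then have "1 / (b * l) * (norm (h l))\<^sup>2 \<le> 1 / (b * c) * (norm (h l))\<^sup>2" by (rule mult_right_mono) simp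
        then show "(norm ((1 / sqrt (b * l)) *\<^sub>R h l))\<^sup>2 \<le> 1 / (b * c) * (norm (h l))\<^sup>2"
          using b S_pos[OF l] by (simp add: power_mult_distrib power_divide)
      qed simp
      then obtain x where x: "\<And>l. l \<in> S \<Longrightarrow> P l x = (1 / sqrt (b * l)) *\<^sub>R h l"
        by (rule E_synthesis[rotated]) (use h(1) subspace_scale[OF real_subspace_E] in blast)+
      have "(\<lambda>l. 1 / b * (norm (h l))\<^sup>2) summable_on S" by (intro summable_on_cmult_right h)
      then have "(\<lambda>l. l * (norm (P l x))\<^sup>2) summable_on S"
        by (rule summable_on_cong[THEN iffD1, rotated])
          (use b S_pos in \<open>force simp: x power_mult_distrib power_divide less_imp_le\<close>)
      moreover have "sqrt (b * l) *\<^sub>R P l x = h l" if "l \<in> S" for l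
        using b S_pos[OF that] by (simp add: x[OF that])
      ultimately show ?thesis by (auto simp: pow_dom_half_iff)
    qed
    obtain u where u: "u \<in> pow_dom D A (1/2)" "\<And>l. l \<in> S \<Longrightarrow> sqrt (a * l) *\<^sub>R P l u = g1 l"
      using div[OF a gE(1) gs(1)] by blast
    obtain y where y: "y \<in> pow_dom D A (1/2)" "\<And>l. l \<in> S \<Longrightarrow> sqrt (1 * l) *\<^sub>R P l y = g3 l"
      using div[OF _ gE(3) gs(3), of 1] by auto
    obtain v where v: "\<And>l. l \<in> S \<Longrightarrow> P l v = g2 l" by (rule E_synthesis[OF gE(2) gs(2)]) blast+
    obtain z where z: "\<And>l. l \<in> S \<Longrightarrow> P l z = g4 l" by (rule E_synthesis[OF gE(4) gs(4)]) blast+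
    show ?thesis
      using u y v z by (intro bexI[of _ "(u, v, y, z)"]) (auto simp: coord_def ge energy_space_def)
  qed
  show "subspace (E l \<times> E l \<times> E l \<times> E l)" for l
    by (intro subspace_Times real_subspace_E)
  show "closed (E l \<times> E l \<times> E l \<times> E l)" if "l \<in> S" for l
    using closed_E S_pos[OF that] by (intro closed_Times) auto
  show "bounded_linear (\<lambda>v::'h \<times> 'h \<times> 'h \<times> 'h. k *\<^sub>C v)" for k
    unfolding scaleC_prod_def
    by (intro bounded_linear_Pair bounded_linear_compose[OF bounded_linear_scaleC]
        bounded_linear_fst_comp bounded_linear_snd_comp bounded_linear_ident bounded_linear_fst bounded_linear_snd)
qed

text \<open>The domain is the largest possible one: if the coordinates of the image are square summable, so are
  \<open>l *\<^sub>R P l u\<close> and \<open>l *\<^sub>R P l y\<close>, because all other terms of the second and the fourth equation are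
  bounded (\<open>A\<^sup>\<gamma>\<close> is bounded for \<open>\<gamma> \<le> 0\<close>).\<close>

lemma diagonal_system:
  assumes a: "a > 0" and \<gamma>: "\<gamma> \<le> 0"
  shows "diagonal_generator (energy_space D A) (energy_norm D A a) S (coord a) (\<lambda>l. E l \<times> E l \<times> E l \<times> E l)
    (\<lambda>l. eigenmode_op (sqrt a) \<gamma> \<alpha> l) (system_dom D A) (system_op D A a \<gamma> \<alpha>)"
proof -
  let ?B = "\<lambda>l. eigenmode_op (sqrt a) \<gamma> \<alpha> l :: 'h \<times> 'h \<times> 'h \<times> 'h \<Rightarrow> _"
  interpret fibred_space "energy_space D A" "energy_norm D A a" S "coord a" "\<lambda>l. E l \<times> E l \<times> E l \<times> E l"
    by (rule fibred_energy_space[OF a])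
  have system: "x \<in> system_dom D A \<and> x' = system_op D A a \<gamma> \<alpha> x \<longleftrightarrow> (\<forall>l\<in>S. coord a l x' = ?B l (coord a l x))"
    if xx: "x \<in> energy_space D A" "x' \<in> energy_space D A" for x x'
  proof -
    obtain u v y z u' v' y' z' where xe: "x = (u, v, y, z)" "x' = (u', v', y', z')"
      by (cases x; cases x') auto
    have m: "u' \<in> pow_dom D A (1/2)" "y' \<in> pow_dom D A (1/2)" using xx by (auto simp: xe energy_space_def)
    have modes: "coord a l x' = ?B l (coord a l x) \<longleftrightarrow>
        P l u' = P l v \<and> P l v' = - (a *\<^sub>R l *\<^sub>R P l u) - (l powr \<gamma>) *\<^sub>R P l v - \<alpha> *\<^sub>R P l z
        \<and> P l y' = P l z \<and> P l z' = - (l *\<^sub>R P l y) + \<alpha> *\<^sub>R P l v" if "l \<in> S" for l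
      using a S_pos[OF that] by (simp add: xe coord_def mode_op_def real_sqrt_mult[symmetric])
    show ?thesis
    proof
      assume l: "x \<in> system_dom D A \<and> x' = system_op D A a \<gamma> \<alpha> x"
      then have uD: "u \<in> D" "y \<in> D" and x': "u' = v" "y' = z" "v' = - (a *\<^sub>R A u) - pow D A \<gamma> v - \<alpha> *\<^sub>R z"
          "z' = - A y + \<alpha> *\<^sub>R v" by (auto simp: system_dom_def xe)
      show "\<forall>l\<in>S. coord a l x' = ?B l (coord a l x)"
      proof
        fix l assume l: "l \<in> S"
        interpret P: bounded_linear "P l" by (rule bounded_linear_P[OF l])
        show "coord a l x' = ?B l (coord a l x)"
          unfolding modes[OF l] x'
          by (simp add: P.add P.diff P.neg P.scaleR P_A uD l P_pow_nonpos \<gamma>)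
      qed
    next
      assume r: "\<forall>l\<in>S. coord a l x' = ?B l (coord a l x)"
      then have u': "u' = v" and y': "y' = z" using modes by (auto intro: P_ext)
      have in_dom: "w \<in> D" if "\<And>l. l \<in> S \<Longrightarrow> l *\<^sub>R P l w = P l f" for w f
      proof -
        have "(\<lambda>l. l\<^sup>2 * (norm (P l w))\<^sup>2) summable_on S"
          using bessel[of f]
          by (rule summable_on_cong[THEN iffD1, rotated]) (simp add: that[symmetric] power_mult_distrib)
        then show ?thesis by (simp add: dom_iff)
      qed
      have "u \<in> D"
      proof (rule in_dom)
        fix l assume l: "l \<in> S"
        interpret P: bounded_linear "P l" by (rule bounded_linear_P[OF l])
        have "a *\<^sub>R l *\<^sub>R P l u = P l (- v' - pow D A \<gamma> v - \<alpha> *\<^sub>R z)"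
          using r l modes[OF l] by (simp add: P.diff P.neg P.scaleR P_pow_nonpos \<gamma>)
        then show "l *\<^sub>R P l u = P l ((1 / a) *\<^sub>R (- v' - pow D A \<gamma> v - \<alpha> *\<^sub>R z))"
          using a by (simp add: P.scaleR flip: \<open>a *\<^sub>R l *\<^sub>R P l u = _\<close>)
      qed
      moreover have "y \<in> D"
      proof (rule in_dom)
        fix l assume l: "l \<in> S"
        interpret P: bounded_linear "P l" by (rule bounded_linear_P[OF l])
        show "l *\<^sub>R P l y = P l (- z' + \<alpha> *\<^sub>R v)"
          using r l modes[OF l] by (simp add: P.diff P.scaleR)
      qed
      moreover have "v' = - (a *\<^sub>R A u) - pow D A \<gamma> v - \<alpha> *\<^sub>R z"
      proof (rule P_ext)
        fix l assume l: "l \<in> S"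
        interpret P: bounded_linear "P l" by (rule bounded_linear_P[OF l])
        show "P l v' = P l (- (a *\<^sub>R A u) - pow D A \<gamma> v - \<alpha> *\<^sub>R z)"
          using r l modes[OF l] \<open>u \<in> D\<close> by (simp add: P.diff P.neg P.scaleR P_A P_pow_nonpos \<gamma>)
      qed
      moreover have "z' = - A y + \<alpha> *\<^sub>R v"
      proof (rule P_ext)
        fix l assume l: "l \<in> S"
        interpret P: bounded_linear "P l" by (rule bounded_linear_P[OF l])
        show "P l z' = P l (- A y + \<alpha> *\<^sub>R v)"
          using r l modes[OF l] \<open>y \<in> D\<close> by (simp add: P.diff P.scaleR P_A)
      qed
      ultimately show "x \<in> system_dom D A \<and> x' = system_op D A a \<gamma> \<alpha> x"
        using xx m u' y' by (auto simp: xe system_dom_def)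
    qed
  qed
  show ?thesis
  proof (intro diagonal_generator.intro diagonal_generator_axioms.intro fibred_space_axioms)
    show "dissipative (?B l)" for l by (rule dissipative_mode_op) simp
    show "?B l (k *\<^sub>C x) = k *\<^sub>C ?B l x" for l k x
      by (simp add: mode_op_def scaleC_prod_def scaleR_scaleC scaleC_scaleC scaleC_diff scaleC_add_right
          linear_neg[OF bounded_linear.linear[OF bounded_linear_scaleC]] mult.commute split: prod.split)
    show "?B l x \<in> E l \<times> E l \<times> E l \<times> E l" if "x \<in> E l \<times> E l \<times> E l \<times> E l" for l x
      using that by (auto simp: mode_op_def intro!: subspace_add[OF real_subspace_E]
          subspace_diff[OF real_subspace_E] subspace_neg[OF real_subspace_E] subspace_scale[OF real_subspace_E])
    show "system_dom D A \<subseteq> energy_space D A" by (auto simp: system_dom_def)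
    show "system_op D A a \<gamma> \<alpha> x \<in> energy_space D A" if "x \<in> system_dom D A" for x
      using that by (auto simp: system_dom_def energy_space_def)
  qed (rule system)
qed

section \<open>The decay rate of the energy and its optimality\<close>

lemma dom_imp_pow_dom_half: "x \<in> D \<Longrightarrow> x \<in> pow_dom D A (1/2)"
  unfolding pow_dom_half_iff dom_iff
proof (rule summable_on_comparison_test)
  assume "(\<lambda>l. l\<^sup>2 * (norm (P l x))\<^sup>2) summable_on S"
  then show "(\<lambda>l. 1 / c * (l\<^sup>2 * (norm (P l x))\<^sup>2)) summable_on S" by (rule summable_on_cmult_right)
  fix l assume l: "l \<in> S"
  have "c * l \<le> l * l" using S_ge[OF l] S_pos[OF l] by (intro mult_right_mono) auto
  then have "l \<le> 1 / c * l\<^sup>2" using c_pos by (simp add: field_simps power2_eq_square)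
  then have "l * (norm (P l x))\<^sup>2 \<le> 1 / c * l\<^sup>2 * (norm (P l x))\<^sup>2" by (rule mult_right_mono) simp
  then show "l * (norm (P l x))\<^sup>2 \<le> 1 / c * (l\<^sup>2 * (norm (P l x))\<^sup>2)" by simp
  show "0 \<le> l * (norm (P l x))\<^sup>2" using S_pos[OF l] by simp
qed

lemma energy_decay_upper:
  assumes a: "a > 0" and \<alpha>: "\<alpha> \<noteq> 0" and \<gamma>: "\<gamma> \<le> 0" and p: "0 < damping_exponent a \<gamma>"
  shows "\<exists>C>0. \<forall>U0\<in>system_dom D A. \<forall>t>0. energy D A a \<gamma> \<alpha> U0 t
    \<le> C / t powr decay_rate a \<gamma> * (energy_norm D A a (system_op D A a \<gamma> \<alpha> U0))\<^sup>2"
proof -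
  interpret diagonal_generator "energy_space D A" "energy_norm D A a" S "coord a" "\<lambda>l. E l \<times> E l \<times> E l \<times> E l"
    "\<lambda>l. eigenmode_op (sqrt a) \<gamma> \<alpha> l" "system_dom D A" "system_op D A a \<gamma> \<alpha>"
    by (rule diagonal_system[OF a \<gamma>])
  have r: "0 < sqrt a" "(sqrt a)\<^sup>2 = a" using a by auto
  obtain C where C: "0 < C" "\<And>l t (x :: 'h \<times> 'h \<times> 'h \<times> 'h). c \<le> l \<Longrightarrow> 0 < t \<Longrightarrow>
    (norm (op_exp (eigenmode_op (sqrt a) \<gamma> \<alpha> l) t x))\<^sup>2
      \<le> C / t powr decay_rate a \<gamma> * (norm (eigenmode_op (sqrt a) \<gamma> \<alpha> l x))\<^sup>2"
    by (rule uniform_mode_decay[OF r(1) c_pos \<alpha> \<gamma>, unfolded r(2), OF p]) blast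
  show ?thesis
  proof (intro exI[of _ C] conjI ballI allI impI C(1))
    fix U0 and t :: real assume U0: "U0 \<in> system_dom D A" and t: "0 < t"
    let ?G = "system_op D A a \<gamma> \<alpha> U0"
    have G: "U0 \<in> energy_space D A" "?G \<in> energy_space D A" using U0 DG_X G_X by auto
    have "(energy_norm D A a (system_semigroup D A a \<gamma> \<alpha> t U0))\<^sup>2
        \<le> C / t powr decay_rate a \<gamma> * (energy_norm D A a ?G)\<^sup>2"
    proof (rule has_sum_mono)
      show "((\<lambda>l. (norm (op_exp (eigenmode_op (sqrt a) \<gamma> \<alpha> l) t (coord a l U0)))\<^sup>2)
          has_sum (energy_norm D A a (system_semigroup D A a \<gamma> \<alpha> t U0))\<^sup>2) S"
        unfolding system_semigroup_def using U0 t by (intro norm_semigroup_of) auto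
      show "((\<lambda>l. C / t powr decay_rate a \<gamma> * (norm (coord a l ?G))\<^sup>2)
          has_sum C / t powr decay_rate a \<gamma> * (energy_norm D A a ?G)\<^sup>2) S"
        by (intro has_sum_cmult_right W_norm G)
      fix l assume l: "l \<in> S"
      have "coord a l ?G = eigenmode_op (sqrt a) \<gamma> \<alpha> l (coord a l U0)"
        using G_iff[OF G] U0 l by blast
      then show "(norm (op_exp (eigenmode_op (sqrt a) \<gamma> \<alpha> l) t (coord a l U0)))\<^sup>2
          \<le> C / t powr decay_rate a \<gamma> * (norm (coord a l ?G))\<^sup>2"
        using C(2)[OF S_ge[OF l] t] by simp
    qed
    then show "energy D A a \<gamma> \<alpha> U0 t \<le> C / t powr decay_rate a \<gamma> * (energy_norm D A a ?G)\<^sup>2"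
      unfolding energy_def using zero_le_power2[of "energy_norm D A a (system_semigroup D A a \<gamma> \<alpha> t U0)"]
      by linarith
  qed
qed

lemma single_mode_energy:
  assumes a: "a > 0" and \<gamma>: "\<gamma> \<le> 0" and l: "l \<in> S" and e: "e \<in> E l" "norm e = 1" and t: "0 \<le> t"
  defines "U0 \<equiv> (0, 0, 0, e)"
  shows "U0 \<in> system_dom D A"
    and "energy D A a \<gamma> \<alpha> U0 t \<ge> 1 / 2 * (norm (op_exp (eigenmode_op (sqrt a) \<gamma> \<alpha> l) t U0))\<^sup>2"
    and "(energy_norm D A a (system_op D A a \<gamma> \<alpha> U0))\<^sup>2 = l + \<alpha>\<^sup>2"
proof -
  interpret diagonal_generator "energy_space D A" "energy_norm D A a" S "coord a" "\<lambda>l. E l \<times> E l \<times> E l \<times> E l"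
    "\<lambda>l. eigenmode_op (sqrt a) \<gamma> \<alpha> l" "system_dom D A" "system_op D A a \<gamma> \<alpha>"
    by (rule diagonal_system[OF a \<gamma>])
  let ?G = "system_op D A a \<gamma> \<alpha> U0"
  have "0 \<in> D" "e \<in> D" using e(1) subspace_0[OF subspace_dom] by (auto simp: E_iff)
  then show U0: "U0 \<in> system_dom D A"
    by (simp add: U0_def system_dom_def energy_space_def dom_imp_pow_dom_half)
  have P0: "P m 0 = 0" for m by (rule P_E[OF zero_in_E])
  have coord: "coord a l U0 = U0" "m \<noteq> l \<Longrightarrow> coord a m U0 = 0" for m
    using P_E[OF e(1)] P_E_other[OF e(1)] by (auto simp: U0_def coord_def P0 zero_prod_def)
  have "(\<Sum>m\<in>{l}. (norm (op_exp (eigenmode_op (sqrt a) \<gamma> \<alpha> m) t (coord a m U0)))\<^sup>2)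
      \<le> (energy_norm D A a (system_semigroup D A a \<gamma> \<alpha> t U0))\<^sup>2"
    unfolding system_semigroup_def
    by (rule finite_sum_le_has_sum[OF norm_semigroup_of[OF U0 t]]) (use l in auto)
  then show "energy D A a \<gamma> \<alpha> U0 t \<ge> 1 / 2 * (norm (op_exp (eigenmode_op (sqrt a) \<gamma> \<alpha> l) t U0))\<^sup>2"
    by (simp add: energy_def coord)
  have G: "U0 \<in> energy_space D A" "?G \<in> energy_space D A" using U0 DG_X G_X by auto
  have WG: "coord a m ?G = eigenmode_op (sqrt a) \<gamma> \<alpha> m (coord a m U0)" if "m \<in> S" for m
    using G_iff[OF G] U0 that by blast
  have "((\<lambda>m. (norm (coord a m ?G))\<^sup>2) has_sum (l + \<alpha>\<^sup>2)) S"
  proof (rule has_sum_finite_neutralI[of "{l}"])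
    show "(norm (coord a m ?G))\<^sup>2 = 0" if "m \<in> S - {l}" for m
      using that WG[of m] coord(2)[of m] by (simp add: mode_op_def zero_prod_def)
    show "l + \<alpha>\<^sup>2 = (\<Sum>m\<in>{l}. (norm (coord a m ?G))\<^sup>2)"
    proof -
      have "coord a l ?G = (0, - (\<alpha> *\<^sub>R e), sqrt l *\<^sub>R e, 0)"
        unfolding WG[OF l] coord by (simp add: U0_def mode_op_def)
      then have "(norm (coord a l ?G))\<^sup>2 = \<alpha>\<^sup>2 + l"
        using norm4[of 0 "- (\<alpha> *\<^sub>R e)" "sqrt l *\<^sub>R e" 0] e(2) S_pos[OF l] by (simp add: power_mult_distrib)
      then show ?thesis by simp
    qed
  qed (use l in auto)
  then show "(energy_norm D A a ?G)\<^sup>2 = l + \<alpha>\<^sup>2"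
    by (rule has_sum_unique[OF W_norm[OF G(2)]])
qed

text \<open>At the time \<open>t = \<kappa> * l powr p\<close> a slow mode has energy at least \<open>1 / 4\<close>, whereas a bound with the rate
  \<open>1 / p + \<epsilon>\<close> would be of order \<open>l powr (- 1 - p * \<epsilon>) * l\<close>, which tends to \<open>0\<close> along the spectrum.\<close>

lemma energy_decay_optimal:
  assumes a: "a > 0" and \<gamma>: "\<gamma> \<le> 0" and p: "0 < damping_exponent a \<gamma>"
    and unbounded: "\<And>L. \<exists>l\<in>S. l > L" and \<epsilon>: "0 < \<epsilon>"
  shows "\<not> (\<exists>C'>0. \<forall>t>0. \<forall>U0\<in>system_dom D A. energy D A a \<gamma> \<alpha> U0 t
    \<le> C' * t powr (- (decay_rate a \<gamma> + \<epsilon>)) * (energy_norm D A a (system_op D A a \<gamma> \<alpha> U0))\<^sup>2)"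
proof
  define p where "p = damping_exponent a \<gamma>"
  have p: "0 < p" using assms(3) by (simp add: p_def)
  assume "\<exists>C'>0. \<forall>t>0. \<forall>U0\<in>system_dom D A. energy D A a \<gamma> \<alpha> U0 t
    \<le> C' * t powr (- (decay_rate a \<gamma> + \<epsilon>)) * (energy_norm D A a (system_op D A a \<gamma> \<alpha> U0))\<^sup>2"
  then obtain C' where C': "0 < C'" "\<And>t U0. 0 < t \<Longrightarrow> U0 \<in> system_dom D A \<Longrightarrow> energy D A a \<gamma> \<alpha> U0 t
    \<le> C' * t powr (- (1 / p + \<epsilon>)) * (energy_norm D A a (system_op D A a \<gamma> \<alpha> U0))\<^sup>2"
    unfolding decay_rate_eq p_def[symmetric] by blast
  have r: "0 < sqrt a" "(sqrt a)\<^sup>2 = a" using a by auto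
  obtain \<kappa> L where \<kappa>: "0 < \<kappa>" "0 < L"
    "\<And>l (e :: 'h). L \<le> l \<Longrightarrow>
      (norm e)\<^sup>2 / 2 \<le> (norm (op_exp (eigenmode_op (sqrt a) \<gamma> \<alpha> l) (\<kappa> * l powr p) (0, 0, 0, e)))\<^sup>2"
    unfolding p_def by (rule slow_modes[OF r(1), of \<gamma> \<alpha>, unfolded r(2)]) blast
  define M where "M = 4 * C' * \<kappa> powr (- (1 / p + \<epsilon>)) * (1 + \<alpha>\<^sup>2)"
  have M: "0 < M" using C'(1) \<kappa>(1) by (simp add: M_def add_pos_nonneg)
  \<comment> \<open>An eigenvalue for which the claimed bound is violated: its power with exponent \<open>p * \<epsilon>\<close> exceeds \<open>M\<close>.\<close>
  obtain l where l: "l \<in> S" "l > max L (max 1 (M powr (1 / (p * \<epsilon>))))" using unbounded by blast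
  have l1: "1 < l" "L \<le> l" "M powr (1 / (p * \<epsilon>)) < l" using l(2) by auto
  obtain e0 where "e0 \<in> E l" "e0 \<noteq> 0" using l(1) S_iff by blast
  then have e: "(1 / norm e0) *\<^sub>R e0 \<in> E l" "norm ((1 / norm e0) *\<^sub>R e0) = 1"
    using subspace_scale[OF real_subspace_E] by auto
  define e where "e = (1 / norm e0) *\<^sub>R e0"
  define t where "t = \<kappa> * l powr p"
  have t: "0 < t" using \<kappa>(1) l1 by (simp add: t_def)
  note mode = single_mode_energy[OF a \<gamma> l(1) e[folded e_def] less_imp_le[OF t]]
  have "1 / 4 \<le> 1 / 2 * (norm (op_exp (eigenmode_op (sqrt a) \<gamma> \<alpha> l) t (0, 0, 0, e)))\<^sup>2"
    using \<kappa>(3)[OF l1(2), of e] e(2) by (simp add: t_def e_def)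
  also have "\<dots> \<le> energy D A a \<gamma> \<alpha> (0, 0, 0, e) t" by (rule mode(2))
  also have "\<dots> \<le> C' * t powr (- (1 / p + \<epsilon>)) * (l + \<alpha>\<^sup>2)"
    using C'(2)[OF t mode(1)] unfolding mode(3) .
  also have "\<dots> \<le> C' * t powr (- (1 / p + \<epsilon>)) * (l * (1 + \<alpha>\<^sup>2))"
  proof -
    have "1 * \<alpha>\<^sup>2 \<le> l * \<alpha>\<^sup>2" using l1 by (intro mult_right_mono) auto
    then show ?thesis using C'(1) by (intro mult_left_mono) (auto simp: algebra_simps)
  qed
  also have "t powr (- (1 / p + \<epsilon>)) = \<kappa> powr (- (1 / p + \<epsilon>)) * (l powr (- 1) * l powr (- (p * \<epsilon>)))"
  proof -
    have "p * (- (1 / p + \<epsilon>)) = - 1 + - (p * \<epsilon>)" using p by (simp add: field_simps)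
    then show ?thesis using l1 \<kappa>(1) by (simp only: t_def powr_mult powr_powr powr_add)
  qed
  also have "C' * (\<kappa> powr (- (1 / p + \<epsilon>)) * (l powr (- 1) * l powr (- (p * \<epsilon>)))) * (l * (1 + \<alpha>\<^sup>2))
      = M / 4 / l powr (p * \<epsilon>)"
  proof -
    have "l powr (- 1) = 1 / l" "l powr (- (p * \<epsilon>)) = 1 / l powr (p * \<epsilon>)"
      using l1 by (simp_all add: powr_minus_divide)
    then show ?thesis using l1 unfolding M_def by (simp only:) simp
  qed
  finally have "l powr (p * \<epsilon>) \<le> M" using l1 by (simp add: field_simps)
  moreover have "(M powr (1 / (p * \<epsilon>))) powr (p * \<epsilon>) < l powr (p * \<epsilon>)"
    using l1 p \<epsilon> by (intro powr_less_mono2) auto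
  then have "M < l powr (p * \<epsilon>)" using M p \<epsilon> by (simp add: powr_powr)
  ultimately show False by simp
qed

end

theorem theorem4p1:
  fixes A :: "'h::complex_hilbert \<Rightarrow> 'h" and D :: "'h set" and a \<gamma> \<alpha> :: real
  assumes "infinite_dimensional TYPE('h)"
    and "separable_space (euclidean :: 'h topology)"
    and "self_adjoint D A"
    and "coercive D A"
    and "compact_resolvent D A"
    and "simple_spectrum D A"
    and "a > 0" and "\<alpha> \<noteq> 0"
    and "(a = 1 \<and> \<gamma> < 0) \<or> (a \<noteq> 1 \<and> \<gamma> \<le> 0)"
  shows "(\<exists>C>0. \<forall>U0\<in>system_dom D A. \<forall>t>0.
            energy D A a \<gamma> \<alpha> U0 t
              \<le> C / t powr decay_rate a \<gamma> * (energy_norm D A a (system_op D A a \<gamma> \<alpha> U0))\<^sup>2)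
       \<and> (\<forall>\<^sub>F \<epsilon> in at_right 0. \<not> (\<exists>C'>0. \<forall>t>0. \<forall>U0\<in>system_dom D A.
            energy D A a \<gamma> \<alpha> U0 t
              \<le> C' * t powr (- (decay_rate a \<gamma> + \<epsilon>))
                   * (energy_norm D A a (system_op D A a \<gamma> \<alpha> U0))\<^sup>2))"
proof -
  obtain c where c: "c > 0" "\<forall>x\<in>D. Re (cinner (A x) x) \<ge> c * (norm x)\<^sup>2"
    using assms(4) by (auto simp: coercive_def)
  interpret coercive_operator D A c
    by unfold_locales (use assms(3,5) c in \<open>auto simp: inner_eq_Re_cinner\<close>)
  have \<gamma>: "\<gamma> \<le> 0" and p: "0 < damping_exponent a \<gamma>"
    using assms(9) by (auto simp: damping_exponent_def)
  show ?thesis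
  proof (intro conjI eventually_mono[OF eventually_at_right_less[of 0]])
    show "\<exists>C>0. \<forall>U0\<in>system_dom D A. \<forall>t>0. energy D A a \<gamma> \<alpha> U0 t
        \<le> C / t powr decay_rate a \<gamma> * (energy_norm D A a (system_op D A a \<gamma> \<alpha> U0))\<^sup>2"
      by (rule energy_decay_upper[OF assms(7,8) \<gamma> p])
    show "\<not> (\<exists>C'>0. \<forall>t>0. \<forall>U0\<in>system_dom D A. energy D A a \<gamma> \<alpha> U0 t
        \<le> C' * t powr (- (decay_rate a \<gamma> + \<epsilon>)) * (energy_norm D A a (system_op D A a \<gamma> \<alpha> U0))\<^sup>2)"
      if "0 < \<epsilon>" for \<epsilon>
      by (rule energy_decay_optimal[OF assms(7) \<gamma> p spectrum_unbounded[OF assms(1,6)] that])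
  qed
qed

end
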